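(* Let $0<K<H<1$, let $B^H$ and $B^K$ be independent fractional Brownian motions with Hurst parameters $H$ and $K$, respectively, and let $a,b\in\mathbb{R}$ with $ab\ne 0$. Then $$\mathbb{P}\left(\sup_{t\in[0,T]}\left(aB^H_t+bB^K_t\right)\le 1\right)=T^{-(1-H)+o(1)},\qquad T\to\infty.$$ In particular, for every $H\in(0,1)$ and $\alpha\in\mathbb{R}\setminus\{0\}$, the mixed fractional Brownian motion $M^{H,\alpha}_t:=B^{1/2}_t+\alpha B^H_t$, $t\ge 0$, where $B^H$ is a fractional Brownian motion with Hurst parameter $H$ and $B^{1/2}$ is a Brownian motion independent of $B^H$, satisfies $$\mathbb{P}\left(\sup_{t\in[0,T]}M^{H,\alpha}_t\le 1\right)=T^{-(1-\max\{\frac12,H\})+o(1)},\qquad T\to\infty.$$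
   Context: Fractional Brownian motion (FBM) $B^H=(B^H_t)_{t\ge0}$ with Hurst parameter $H\in(0,1)$ is the centred Gaussian process (taken with continuous sample paths) with covariance function $\operatorname{cov}(B^H_s,B^H_t)=\frac12\left(t^{2H}+s^{2H}-|t-s|^{2H}\right)$; for $H=1/2$ it is standard Brownian motion. The notation $f(T)=T^{-\theta+o(1)}$ as $T\to\infty$ means $\lim_{T\to\infty}\log f(T)/\log T=-\theta$. *)

theory Defs
  imports "HOL-Probability.Probability"
begin

text \<open>The normal law with mean \<open>\<mu>\<close> and standard deviation \<open>\<sigma> \<ge> 0\<close>, where \<open>\<sigma> = 0\<close> gives the
  point mass at \<open>\<mu>\<close>; the library's \<^const>\<open>normal_density\<close> covers only \<open>\<sigma> > 0\<close>.\<close>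

definition normal_law :: "real \<Rightarrow> real \<Rightarrow> real measure" where
  "normal_law \<mu> \<sigma> =
     (if \<sigma> = 0 then return borel \<mu> else density lborel (\<lambda>x. ennreal (normal_density \<mu> \<sigma> x)))"

definition (in prob_space) gaussian_process :: "'i set \<Rightarrow> ('i \<Rightarrow> 'a \<Rightarrow> real) \<Rightarrow> bool" where
  "gaussian_process I X \<longleftrightarrow>
     (\<forall>t\<in>I. random_variable borel (X t)) \<and>
     (\<forall>F c. finite F \<and> F \<subseteq> I \<longrightarrow>
        (\<exists>\<mu> \<sigma>. 0 \<le> \<sigma> \<and> distr M borel (\<lambda>\<omega>. \<Sum>t\<in>F. c t * X t \<omega>) = normal_law \<mu> \<sigma>))"

definition (in prob_space) covariance :: "('a \<Rightarrow> real) \<Rightarrow> ('a \<Rightarrow> real) \<Rightarrow> real" where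
  "covariance X Y = expectation (\<lambda>\<omega>. (X \<omega> - expectation X) * (Y \<omega> - expectation Y))"

text \<open>Processes are indexed by all reals for typing reasons; only times in \<open>{0..}\<close> matter.
  The convention \<open>0 powr x = 0\<close> is the intended value below, since \<open>2 * H > 0\<close>.\<close>

definition (in prob_space) fractional_brownian_motion ::
    "real \<Rightarrow> (real \<Rightarrow> 'a \<Rightarrow> real) \<Rightarrow> bool" where
  "fractional_brownian_motion H B \<longleftrightarrow>
     0 < H \<and> H < 1 \<and>
     gaussian_process {0..} B \<and>
     (\<forall>t\<ge>0. expectation (B t) = 0) \<and>
     (\<forall>s\<ge>0. \<forall>t\<ge>0. covariance (B s) (B t) =
        (t powr (2 * H) + s powr (2 * H) - \<bar>t - s\<bar> powr (2 * H)) / 2) \<and>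
     (\<forall>\<omega>\<in>space M. continuous_on {0..} (\<lambda>t. B t \<omega>))"

text \<open>Independence of the two processes as random elements of the path space \<open>\<real>\<^bsup>{0..}\<^esup>\<close> with
  the product \<open>\<sigma>\<close>-algebra.\<close>

definition (in prob_space) indep_processes ::
    "(real \<Rightarrow> 'a \<Rightarrow> real) \<Rightarrow> (real \<Rightarrow> 'a \<Rightarrow> real) \<Rightarrow> bool" where
  "indep_processes X Y \<longleftrightarrow>
     indep_var (Pi\<^sub>M {0..} (\<lambda>_. borel)) (\<lambda>\<omega>. \<lambda>t\<in>{0..}. X t \<omega>)
               (Pi\<^sub>M {0..} (\<lambda>_. borel)) (\<lambda>\<omega>. \<lambda>t\<in>{0..}. Y t \<omega>)"

text \<open>For processes with continuous paths the supremum below is over a nonempty bounded set when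
  \<open>T \<ge> 0\<close>, and the event is measurable.\<close>

definition (in prob_space) persistence_prob :: "(real \<Rightarrow> 'a \<Rightarrow> real) \<Rightarrow> real \<Rightarrow> real" where
  "persistence_prob X T = prob {\<omega> \<in> space M. (SUP t\<in>{0..T}. X t \<omega>) \<le> 1}"

text \<open>\<open>f T = T powr (-\<theta> + o(1))\<close> as \<open>T \<rightarrow> \<infinity>\<close>. Eventual positivity is stated explicitly because
  \<open>ln 0 = 0\<close>.\<close>

definition has_decay_exponent :: "(real \<Rightarrow> real) \<Rightarrow> real \<Rightarrow> bool" where
  "has_decay_exponent f \<theta> \<longleftrightarrow>
     eventually (\<lambda>T. 0 < f T) at_top \<and> ((\<lambda>T. ln (f T) / ln T) \<longlongrightarrow> - \<theta>) at_top"

end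

theory Submission
  imports Defs "HOL-Real_Asymp.Real_Asymp"
begin

text \<open>
The process \<open>Y = - (a B\<^sup>H + b B\<^sup>K)\<close> is centred Gaussian with stationary increments; its
variance \<open>V t = a\<^sup>2 t\<^bsup>2H\<^esup> + b\<^sup>2 t\<^bsup>2K\<^esup>\<close> is increasing, of order \<open>t\<^bsup>2H\<^esup>\<close> for large \<open>t\<close> and at most
of order \<open>t\<^bsup>2K\<^esup>\<close> for small \<open>t\<close>. The exponent \<open>1 - H\<close> follows from these properties and the continuity of the paths, so one argument covers the
mixture, the ordering of the two indices and the case \<open>H = K\<close>.

The heart of the matter is a discrete form of Molchan's identity. Let \<open>S n\<close> be the expected maximum
of \<open>Y\<close> over the mesh points \<open>0, \<delta>, \<dots>, n\<delta>\<close>. The step \<open>S (n + 1) - S n\<close> is the mean of the positive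
part of \<open>Y ((n + 1)\<delta>) - max\<^bsub>k \<le> n\<^esub> Y (k\<delta>)\<close>, and seen backwards from time \<open>(n + 1)\<delta>\<close> the increments
have the law of \<open>Y\<close> itself. Hence the step equals \<open>d (n + 1)\<close>, where \<open>d n\<close> is the mean of the positive part
of \<open>min\<^bsub>1 \<le> k \<le> n\<^esub> Y (k\<delta>)\<close> (lemma \<open>expected_max_increment\<close>). Since \<open>d\<close> is decreasing
and \<open>S n\<close> is of order \<open>T\<^bsup>H\<^esup>\<close> up to factors \<open>T\<^bsup>o(1)\<^esup>\<close> when \<open>n\<delta>\<close> is comparable with \<open>T\<close>, \<open>d n\<close> is then of order \<open>T\<^bsup>H\<^esup> / n\<close>
up to such factors.

It remains to compare \<open>d n\<close> with the persistence probability, where every factor \<open>T\<^bsup>o(1)\<^esup>\<close> may be lost.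

For the upper bound take \<open>\<delta> = 1\<close>. By Markov's inequality \<open>d n\<close> dominates the probability that \<open>Y \<ge> 1\<close> at the times
\<open>1, \<dots>, n\<close>. The barrier \<open>-1\<close> is raised to \<open>1\<close> by moving \<open>Y\<close> along the covariance function
\<open>t \<mapsto> E (Y t Y 1)\<close>, which is bounded below on \<open>[1, \<infinity>)\<close>: this only changes the Gaussian variable
\<open>Y 1\<close>, with the component of \<open>Y\<close> independent of \<open>Y 1\<close> kept fixed (lemma \<open>prob_lift\<close>).

For the lower bound take \<open>\<delta> = T\<^bsup>-e\<^esup>\<close> with small \<open>e\<close>. The variable averaged in \<open>d n\<close> is at most the positive part
of \<open>Y \<delta>\<close> and vanishes unless \<open>Y \<ge> 0\<close> at the mesh points, so \<open>d n\<close> bounds the probability of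
this event from below up to a factor \<open>T\<^bsup>o(1)\<^esup>\<close> (lemma \<open>mesh_persistence_lower\<close>). Between mesh points \<open>Y\<close> drops by more than \<open>1\<close> with
a probability that is smaller than every power of \<open>T\<close> (lemma \<open>oscillation_tail\<close>).

The bounds for maxima and oscillations rest on the even moments \<open>E Z\<^bsup>2p\<^esup> = c\<^sub>p (E Z\<^sup>2)\<^bsup>p\<^esup>\<close> with large \<open>p\<close>. Equalities of
joint Gaussian laws are reduced to equality of covariances by a Cramer-Wold argument
(theorem \<open>joint_law_eqI\<close>).
\<close>

section \<open>Joint laws and one-dimensional projections\<close>

text \<open>Normalising the weight turns both sides into probability laws, to which the uniqueness
theorem for characteristic functions applies; the induction behind \<open>joint_law_eqI\<close>
produces such weights.\<close>

lemma weighted_law_eqI_nonneg: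
  fixes U w :: "'a \<Rightarrow> real" and U' w' :: "'b \<Rightarrow> real"
  assumes M: "prob_space M" and N: "prob_space N"
    and [measurable]: "U \<in> borel_measurable M" "w \<in> borel_measurable M"
      "U' \<in> borel_measurable N" "w' \<in> borel_measurable N"
    and w: "\<And>x. 0 \<le> w x" "\<And>x. w x \<le> C" and w': "\<And>x. 0 \<le> w' x" "\<And>x. w' x \<le> C"
    and cos: "\<And>t. (\<integral>x. w x * cos (t * U x) \<partial>M) = (\<integral>x. w' x * cos (t * U' x) \<partial>N)"
    and sin: "\<And>t. (\<integral>x. w x * sin (t * U x) \<partial>M) = (\<integral>x. w' x * sin (t * U' x) \<partial>N)"
    and B[measurable]: "B \<in> sets borel"
  shows "(\<integral>x. w x * indicator B (U x) \<partial>M) = (\<integral>x. w' x * indicator B (U' x) \<partial>N)"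
proof -
  interpret M: prob_space M by (rule M)
  interpret N: prob_space N by (rule N)
  define m where "m = (\<integral>x. w x \<partial>M)"
  have m': "m = (\<integral>x. w' x \<partial>N)" unfolding m_def using cos[of 0] by simp
  have int_w: "integrable M w"
    by (rule M.integrable_const_bound[where B=C]) (auto simp: w)
  have int_w': "integrable N w'"
    by (rule N.integrable_const_bound[where B=C]) (auto simp: w')
  show ?thesis
  proof (cases "m = 0")
    case True
    have "AE x in M. w x = 0"
      using integral_nonneg_eq_0_iff_AE[OF int_w] w True by (auto simp: m_def)
    hence a: "(\<integral>x. w x * indicator B (U x) \<partial>M) = 0"
      by (intro integral_eq_zero_AE) auto
    have "AE x in N. w' x = 0"
      using integral_nonneg_eq_0_iff_AE[OF int_w'] w' True by (auto simp: m')
    hence "(\<integral>x. w' x * indicator B (U' x) \<partial>N) = 0"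
      by (intro integral_eq_zero_AE) auto
    with a show ?thesis by simp
  next
    case False
    have "m \<ge> 0" unfolding m_def using w by simp
    with False have m: "m > 0" by simp
    define P where "P = distr (density M (\<lambda>x. ennreal (w x / m))) borel U"
    define Q where "Q = distr (density N (\<lambda>x. ennreal (w' x / m))) borel U'"
    have law: "prob_space (distr (density L (\<lambda>x. ennreal (v x / m))) borel V)"
      "char (distr (density L (\<lambda>x. ennreal (v x / m))) borel V) t =
         Complex ((\<integral>x. v x * cos (t * V x) \<partial>L) / m) ((\<integral>x. v x * sin (t * V x) \<partial>L) / m)"
      "measure (distr (density L (\<lambda>x. ennreal (v x / m))) borel V) B =
         (\<integral>x. v x * indicator B (V x) \<partial>L) / m"
      if L: "prob_space L" and [measurable]: "V \<in> borel_measurable L" "v \<in> borel_measurable L"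
        and v: "\<And>x. 0 \<le> v x" "\<And>x. v x \<le> C" and vm: "m = (\<integral>x. v x \<partial>L)"
      for L :: "'c measure" and v V t
    proof -
      interpret L: prob_space L by (rule L)
      have int_v: "integrable L v"
        by (rule L.integrable_const_bound[where B=C]) (auto simp: v)
      show pr: "prob_space (distr (density L (\<lambda>x. ennreal (v x / m))) borel V)"
      proof (rule prob_space.prob_space_distr)
        have "(\<integral>\<^sup>+ x. ennreal (v x / m) \<partial>L) = ennreal (\<integral>x. v x / m \<partial>L)"
          by (rule nn_integral_eq_integral) (use int_v v m in auto)
        also have "\<dots> = 1" using m vm by simp
        finally show "prob_space (density L (\<lambda>x. ennreal (v x / m)))"
          by (intro prob_spaceI) (simp add: emeasure_density cong: nn_integral_cong)
      qed simp
      have int_c: "integrable L (\<lambda>x. (v x / m) *\<^sub>R iexp (t * V x))"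
        by (rule L.integrable_const_bound[where B="C / m"])
           (use v m in \<open>auto simp: norm_mult intro!: AE_I2 divide_right_mono\<close>)
      have "char (distr (density L (\<lambda>x. ennreal (v x / m))) borel V) t
          = (CLINT x|L. (v x / m) *\<^sub>R iexp (t * V x))"
        unfolding char_def by (subst integral_distr; (subst integral_density)?) (use v m in auto)
      also have "\<dots> = Complex (\<integral>x. v x * cos (t * V x) / m \<partial>L) (\<integral>x. v x * sin (t * V x) / m \<partial>L)"
        by (subst complex_eq_iff, unfold integral_Re[OF int_c, symmetric] integral_Im[OF int_c, symmetric])
           (auto simp: Re_exp Im_exp mult.commute)
      finally show "char (distr (density L (\<lambda>x. ennreal (v x / m))) borel V) t =
         Complex ((\<integral>x. v x * cos (t * V x) \<partial>L) / m) ((\<integral>x. v x * sin (t * V x) \<partial>L) / m)"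
        by simp
      interpret P: prob_space "distr (density L (\<lambda>x. ennreal (v x / m))) borel V" by (rule pr)
      have "measure (distr (density L (\<lambda>x. ennreal (v x / m))) borel V) B =
        (\<integral>x. indicator B x \<partial>distr (density L (\<lambda>x. ennreal (v x / m))) borel V)" by simp
      also have "\<dots> = (\<integral>x. (v x / m) * indicator B (V x) \<partial>L)"
        by (subst integral_distr; (subst integral_density)?) (use v m in auto)
      finally show "measure (distr (density L (\<lambda>x. ennreal (v x / m))) borel V) B =
         (\<integral>x. v x * indicator B (V x) \<partial>L) / m" by simp
    qed
    have "P = Q"
      unfolding P_def Q_def
    proof (rule Levy_uniqueness)
      show "char (distr (density M (\<lambda>x. ennreal (w x / m))) borel U) =
            char (distr (density N (\<lambda>x. ennreal (w' x / m))) borel U')"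
        using law(2)[OF M, of U w] law(2)[OF N, of U' w'] w w' m_def m' cos sin
        by (auto simp: fun_eq_iff)
    qed (use law(1)[OF M, of U w] law(1)[OF N, of U' w'] w w' m_def m' in
        \<open>auto simp: real_distribution_def real_distribution_axioms_def\<close>)
    hence "measure P B = measure Q B" by simp
    thus ?thesis
      unfolding P_def Q_def using law(3)[OF M, of U w] law(3)[OF N, of U' w'] w w' m_def m' m
      by auto
  qed
qed

text \<open>A signed weight \<open>v\<close> has no law attached to it, but \<open>w\<close> and \<open>w + v\<close> are nonnegative, and
\<open>v\<close> is their difference.\<close>

lemma weighted_law_eqI:
  fixes U w :: "'a \<Rightarrow> real" and U' w' :: "'b \<Rightarrow> real"
  assumes M: "prob_space M" and N: "prob_space N"
    and [measurable]: "U \<in> borel_measurable M" "w \<in> borel_measurable M" "v \<in> borel_measurable M"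
      "U' \<in> borel_measurable N" "w' \<in> borel_measurable N" "v' \<in> borel_measurable N"
    and w: "\<And>x. \<bar>v x\<bar> \<le> w x" "\<And>x. w x \<le> C" and w': "\<And>x. \<bar>v' x\<bar> \<le> w' x" "\<And>x. w' x \<le> C"
    and cw: "\<And>t. (\<integral>x. w x * cos (t * U x) \<partial>M) = (\<integral>x. w' x * cos (t * U' x) \<partial>N)"
    and sw: "\<And>t. (\<integral>x. w x * sin (t * U x) \<partial>M) = (\<integral>x. w' x * sin (t * U' x) \<partial>N)"
    and cv: "\<And>t. (\<integral>x. v x * cos (t * U x) \<partial>M) = (\<integral>x. v' x * cos (t * U' x) \<partial>N)"
    and sv: "\<And>t. (\<integral>x. v x * sin (t * U x) \<partial>M) = (\<integral>x. v' x * sin (t * U' x) \<partial>N)"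
    and B[measurable]: "B \<in> sets borel"
  shows "(\<integral>x. v x * indicator B (U x) \<partial>M) = (\<integral>x. v' x * indicator B (U' x) \<partial>N)"
proof -
  interpret M: prob_space M by (rule M)
  interpret N: prob_space N by (rule N)
  have w0: "0 \<le> w x" "v x \<le> w x" "- v x \<le> w x" "\<bar>w x\<bar> \<le> C" "\<bar>v x\<bar> \<le> C" for x
    using w[of x] by linarith+
  have w'0: "0 \<le> w' x" "v' x \<le> w' x" "- v' x \<le> w' x" "\<bar>w' x\<bar> \<le> C" "\<bar>v' x\<bar> \<le> C" for x
    using w'[of x] by linarith+
  have intM: "integrable M (\<lambda>x. f x * g x)" if "f = w \<or> f = v" "\<And>x. \<bar>g x\<bar> \<le> 1" 
    "g \<in> borel_measurable M" for f g :: "'a \<Rightarrow> real"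
  proof (rule M.integrable_const_bound[where B=C])
    show "AE x in M. norm (f x * g x) \<le> C"
    proof (rule AE_I2)
      fix x
      have "\<bar>f x\<bar> * \<bar>g x\<bar> \<le> C * 1" using that(1) w0(4,5)[of x] that(2)[of x] w0(1)[of x]
        by (intro mult_mono) auto
      thus "norm (f x * g x) \<le> C" by (simp add: abs_mult)
    qed
    show "(\<lambda>x. f x * g x) \<in> borel_measurable M" using that by auto
  qed
  have intN: "integrable N (\<lambda>x. f x * g x)" if "f = w' \<or> f = v'" "\<And>x. \<bar>g x\<bar> \<le> 1" 
    "g \<in> borel_measurable N" for f g :: "'b \<Rightarrow> real"
  proof (rule N.integrable_const_bound[where B=C])
    show "AE x in N. norm (f x * g x) \<le> C"
    proof (rule AE_I2)
      fix x
      have "\<bar>f x\<bar> * \<bar>g x\<bar> \<le> C * 1" using that(1) w'0(4,5)[of x] that(2)[of x] w'0(1)[of x]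
        by (intro mult_mono) auto
      thus "norm (f x * g x) \<le> C" by (simp add: abs_mult)
    qed
    show "(\<lambda>x. f x * g x) \<in> borel_measurable N" using that by auto
  qed
  have 1: "(\<integral>x. w x * indicator B (U x) \<partial>M) = (\<integral>x. w' x * indicator B (U' x) \<partial>N)"
    by (rule weighted_law_eqI_nonneg[OF M N, where C=C]) (use w w' w0 w'0 cw sw in auto)
  have 2: "(\<integral>x. (w x + v x) * indicator B (U x) \<partial>M) = (\<integral>x. (w' x + v' x) * indicator B (U' x) \<partial>N)"
  proof (rule weighted_law_eqI_nonneg[OF M N, where C="2 * C"])
    fix t
    show "(\<integral>x. (w x + v x) * cos (t * U x) \<partial>M) = (\<integral>x. (w' x + v' x) * cos (t * U' x) \<partial>N)"
      by (simp add: distrib_right Bochner_Integration.integral_add intM intN cw cv)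
    show "(\<integral>x. (w x + v x) * sin (t * U x) \<partial>M) = (\<integral>x. (w' x + v' x) * sin (t * U' x) \<partial>N)"
      by (simp add: distrib_right Bochner_Integration.integral_add intM intN sw sv)
    fix x show "0 \<le> w x + v x" "w x + v x \<le> 2 * C" using w0[of x] w[of x] by linarith+
    fix x show "0 \<le> w' x + v' x" "w' x + v' x \<le> 2 * C" using w'0[of x] w'[of x] by linarith+
  qed auto
  have "(\<integral>x. (w x + v x) * indicator B (U x) \<partial>M) 
      = (\<integral>x. w x * indicator B (U x) \<partial>M) + (\<integral>x. v x * indicator B (U x) \<partial>M)"
    by (simp add: distrib_right Bochner_Integration.integral_add intM)
  moreover have "(\<integral>x. (w' x + v' x) * indicator B (U' x) \<partial>N) 
      = (\<integral>x. w' x * indicator B (U' x) \<partial>N) + (\<integral>x. v' x * indicator B (U' x) \<partial>N)"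
    by (simp add: distrib_right Bochner_Integration.integral_add intN)
  ultimately show ?thesis using 1 2 by simp
qed

text \<open>Multiplying by a trigonometric function of one coordinate only shifts a coefficient of the
linear form, by the addition theorems.\<close>

lemma (in prob_space) weighted_trig_product:
  fixes U :: "'i \<Rightarrow> 'a \<Rightarrow> real" and w :: "'a \<Rightarrow> real"
  assumes I: "finite I" "j \<in> I" and U: "\<forall>i\<in>I. U i \<in> borel_measurable M"
    and w[measurable]: "w \<in> borel_measurable M" and w1: "\<And>x. \<bar>w x\<bar> \<le> 1"
  defines "C \<equiv> \<lambda>c. expectation (\<lambda>x. w x * cos (\<Sum>i\<in>I. c i * U i x))"
    and "S \<equiv> \<lambda>c. expectation (\<lambda>x. w x * sin (\<Sum>i\<in>I. c i * U i x))"
  shows "expectation (\<lambda>x. (w x * cos (\<Sum>i\<in>I. c i * U i x)) * cos (t * U j x))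
           = (C (c(j := c j + t)) + C (c(j := c j - t))) / 2"
    and "expectation (\<lambda>x. (w x * cos (\<Sum>i\<in>I. c i * U i x)) * sin (t * U j x))
           = (S (c(j := c j + t)) - S (c(j := c j - t))) / 2"
    and "expectation (\<lambda>x. (w x * sin (\<Sum>i\<in>I. c i * U i x)) * cos (t * U j x))
           = (S (c(j := c j + t)) + S (c(j := c j - t))) / 2"
    and "expectation (\<lambda>x. (w x * sin (\<Sum>i\<in>I. c i * U i x)) * sin (t * U j x))
           = (C (c(j := c j - t)) - C (c(j := c j + t))) / 2"
proof -
  define V where "V c x = (\<Sum>i\<in>I. c i * U i x)" for c x
  have Vm[measurable]: "V c \<in> borel_measurable M" for c
    unfolding V_def using U by (intro borel_measurable_sum borel_measurable_times) auto
  have upd: "V (c(j := c j + t)) x = V c x + t * U j x" for c t x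
  proof -
    have "V (c(j := c j + t)) x = (\<Sum>i\<in>I. c i * U i x + (if i = j then t * U j x else 0))"
      unfolding V_def by (intro sum.cong) (auto simp: algebra_simps)
    also have "\<dots> = V c x + t * U j x"
      using I by (simp add: sum.distrib V_def)
    finally show ?thesis .
  qed
  have upd': "V (c(j := c j - t)) x = V c x - t * U j x" for x
    using upd[of c "-t" x] by simp
  have ic: "integrable M (\<lambda>x. w x * cos (V c x))" "integrable M (\<lambda>x. w x * sin (V c x))" for c
    by (rule integrable_const_bound[where B=1], use w1 in 
        \<open>auto intro!: AE_I2 mult_le_one simp: abs_mult\<close>)+
  note lin = Bochner_Integration.integral_add[OF ic(1) ic(1), symmetric]
    Bochner_Integration.integral_add[OF ic(2) ic(2), symmetric]
    Bochner_Integration.integral_diff[OF ic(1) ic(1), symmetric]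
    Bochner_Integration.integral_diff[OF ic(2) ic(2), symmetric]
  show "expectation (\<lambda>x. (w x * cos (\<Sum>i\<in>I. c i * U i x)) * cos (t * U j x))
           = (C (c(j := c j + t)) + C (c(j := c j - t))) / 2"
    "expectation (\<lambda>x. (w x * cos (\<Sum>i\<in>I. c i * U i x)) * sin (t * U j x))
           = (S (c(j := c j + t)) - S (c(j := c j - t))) / 2"
    "expectation (\<lambda>x. (w x * sin (\<Sum>i\<in>I. c i * U i x)) * cos (t * U j x))
           = (S (c(j := c j + t)) + S (c(j := c j - t))) / 2"
    "expectation (\<lambda>x. (w x * sin (\<Sum>i\<in>I. c i * U i x)) * sin (t * U j x))
           = (C (c(j := c j - t)) - C (c(j := c j + t))) / 2"
    unfolding C_def S_def V_def[symmetric] lin integral_divide_zero[symmetric]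
    by (rule Bochner_Integration.integral_cong[OF refl],
        simp only: upd upd' cos_add sin_add cos_diff sin_diff, simp add: field_simps)+
qed

text \<open>The Cramer-Wold device. By induction on \<open>J\<close>, the mixed functionals
\<open>E (\<Prod>\<^bsub>j \<in> J\<^esub> 1\<^bsub>A j\<^esub> (U j) \<cdot> e\<^bsup>i \<Sum> c U\<^esup>)\<close> agree on both sides: the induction step trades one
oscillating coordinate for an indicator, using the one-dimensional uniqueness theorem with the
remaining factors as a weight. With \<open>J = I\<close> and \<open>c = 0\<close> these are the probabilities of boxes.\<close>

theorem joint_law_eqI:
  fixes U :: "'i \<Rightarrow> 'a \<Rightarrow> real" and U' :: "'i \<Rightarrow> 'b \<Rightarrow> real"
  assumes M: "prob_space M" and N: "prob_space N" and I: "finite I"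
    and U: "\<And>i. i \<in> I \<Longrightarrow> U i \<in> borel_measurable M"
    and U': "\<And>i. i \<in> I \<Longrightarrow> U' i \<in> borel_measurable N"
    and eq: "\<And>c. distr M borel (\<lambda>x. \<Sum>i\<in>I. c i * U i x) = distr N borel (\<lambda>x. \<Sum>i\<in>I. c i * U' i x)"
  shows "distr M (Pi\<^sub>M I (\<lambda>_. borel)) (\<lambda>x. \<lambda>i\<in>I. U i x) = distr N (Pi\<^sub>M I (\<lambda>_. borel)) (\<lambda>x. \<lambda>i\<in>I. U' i x)"
proof -
  interpret M: prob_space M by (rule M)
  interpret N: prob_space N by (rule N)
  have key: "(\<integral>x. (\<Prod>j\<in>J. indicator (A j) (U j x)) * cos (\<Sum>i\<in>I. c i * U i x) \<partial>M) =
      (\<integral>x. (\<Prod>j\<in>J. indicator (A j) (U' j x)) * cos (\<Sum>i\<in>I. c i * U' i x) \<partial>N) \<and>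
      (\<integral>x. (\<Prod>j\<in>J. indicator (A j) (U j x)) * sin (\<Sum>i\<in>I. c i * U i x) \<partial>M) =
      (\<integral>x. (\<Prod>j\<in>J. indicator (A j) (U' j x)) * sin (\<Sum>i\<in>I. c i * U' i x) \<partial>N)"
    if "finite J" "J \<subseteq> I" "\<And>j. j \<in> J \<Longrightarrow> A j \<in> sets borel" for J and A :: "'i \<Rightarrow> real set" and c
    using that
  proof (induction J arbitrary: c rule: finite_induct)
    case empty
    have [measurable]: "(\<lambda>x. \<Sum>i\<in>I. c i * U i x) \<in> borel_measurable M"
       "(\<lambda>x. \<Sum>i\<in>I. c i * U' i x) \<in> borel_measurable N" using U U' by auto
    have "(\<integral>x. f (\<Sum>i\<in>I. c i * U i x) \<partial>M) = (\<integral>x. f (\<Sum>i\<in>I. c i * U' i x) \<partial>N)"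
      if [measurable]: "f \<in> borel_measurable borel" for f :: "real \<Rightarrow> real"
    proof -
      have "(\<integral>x. f (\<Sum>i\<in>I. c i * U i x) \<partial>M) = (\<integral>y. f y \<partial>distr M borel (\<lambda>x. \<Sum>i\<in>I. c i * U i x))"
        by (subst integral_distr) auto
      also have "\<dots> = (\<integral>x. f (\<Sum>i\<in>I. c i * U' i x) \<partial>N)"
        unfolding eq by (subst integral_distr) auto
      finally show ?thesis .
    qed
    from this[of cos] this[of sin] show ?case by simp
  next
    case (insert j J)
    define w where "w x = (\<Prod>j\<in>J. indicator (A j) (U j x) :: real)" for x
    define w' where "w' x = (\<Prod>j\<in>J. indicator (A j) (U' j x) :: real)" for x
    from insert.prems have J: "J \<subseteq> I" "j \<in> I" by auto
    have [measurable]: "A j \<in> sets borel" using insert.prems by auto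
    have A: "\<And>i. i \<in> J \<Longrightarrow> A i \<in> sets borel" using insert.prems by auto
    have IH: "(\<integral>x. w x * cos (\<Sum>i\<in>I. c i * U i x) \<partial>M) = (\<integral>x. w' x * cos (\<Sum>i\<in>I. c i * U' i x) \<partial>N)"
      "(\<integral>x. w x * sin (\<Sum>i\<in>I. c i * U i x) \<partial>M) = (\<integral>x. w' x * sin (\<Sum>i\<in>I. c i * U' i x) \<partial>N)" for c
      using insert.IH[OF J(1) A, of c] unfolding w_def w'_def by auto
    have "(\<lambda>x. indicator (A i) (U i x) :: real) \<in> borel_measurable M" if "i \<in> J" for i
      using A[OF that] U[of i] that J by (intro measurable_compose[OF U borel_measurable_indicator]) auto
    hence wm[measurable]: "w \<in> borel_measurable M" unfolding w_def by (rule borel_measurable_prod)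
    have "(\<lambda>x. indicator (A i) (U' i x) :: real) \<in> borel_measurable N" if "i \<in> J" for i
      using A[OF that] U'[of i] that J by (intro measurable_compose[OF U' borel_measurable_indicator]) auto
    hence wm'[measurable]: "w' \<in> borel_measurable N" unfolding w'_def by (rule borel_measurable_prod)
    have w01: "0 \<le> w x" "w x \<le> 1" "\<bar>w x\<bar> \<le> 1" for x 
      unfolding w_def by (auto intro!: prod_nonneg prod_le_1 simp: abs_prod)
    have w'01: "0 \<le> w' x" "w' x \<le> 1" "\<bar>w' x\<bar> \<le> 1" for x 
      unfolding w'_def by (auto intro!: prod_nonneg prod_le_1 simp: abs_prod)
    have [measurable]: "U j \<in> borel_measurable M" "U' j \<in> borel_measurable N"
      "\<And>c. (\<lambda>x. \<Sum>i\<in>I. c i * U i x) \<in> borel_measurable M"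
      "\<And>c. (\<lambda>x. \<Sum>i\<in>I. c i * U' i x) \<in> borel_measurable N" using U U' J by auto
    have single: "(\<Sum>i\<in>I. (if i = j then t else 0) * f i) = t * f j" for t and f :: "'i \<Rightarrow> real"
    proof -
      have "(\<Sum>i\<in>I. (if i = j then t else 0) * f i) = (\<Sum>i\<in>I. if i = j then t * f i else 0)"
        by (intro sum.cong) auto
      thus ?thesis using I J by simp
    qed
    have ball: "\<forall>i\<in>I. U i \<in> borel_measurable M" "\<forall>i\<in>I. U' i \<in> borel_measurable N"
      using U U' by auto
    note tr = M.weighted_trig_product[OF I J(2) ball(1) wm w01(3)] 
      N.weighted_trig_product[OF I J(2) ball(2) wm' w'01(3)]
    have w_eqs: "(\<integral>x. w x * cos (t * U j x) \<partial>M) = (\<integral>x. w' x * cos (t * U' j x) \<partial>N)"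
      "(\<integral>x. w x * sin (t * U j x) \<partial>M) = (\<integral>x. w' x * sin (t * U' j x) \<partial>N)" for t
      using IH[of "\<lambda>i. if i = j then t else 0"] unfolding single by auto
    have v_eqs:
      "(\<integral>x. (w x * cos (\<Sum>i\<in>I. c i * U i x)) * cos (t * U j x) \<partial>M) =
        (\<integral>x. (w' x * cos (\<Sum>i\<in>I. c i * U' i x)) * cos (t * U' j x) \<partial>N)"
      "(\<integral>x. (w x * cos (\<Sum>i\<in>I. c i * U i x)) * sin (t * U j x) \<partial>M) =
        (\<integral>x. (w' x * cos (\<Sum>i\<in>I. c i * U' i x)) * sin (t * U' j x) \<partial>N)"
      "(\<integral>x. (w x * sin (\<Sum>i\<in>I. c i * U i x)) * cos (t * U j x) \<partial>M) =
        (\<integral>x. (w' x * sin (\<Sum>i\<in>I. c i * U' i x)) * cos (t * U' j x) \<partial>N)"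
      "(\<integral>x. (w x * sin (\<Sum>i\<in>I. c i * U i x)) * sin (t * U j x) \<partial>M) =
        (\<integral>x. (w' x * sin (\<Sum>i\<in>I. c i * U' i x)) * sin (t * U' j x) \<partial>N)" for t
      by (simp_all only: tr IH)
    have bd: "\<bar>w x * cos y\<bar> \<le> w x" "\<bar>w x * sin y\<bar> \<le> w x" for x y
      using w01[of x] by (auto simp: abs_mult intro!: mult_left_le)
    have bd': "\<bar>w' x * cos y\<bar> \<le> w' x" "\<bar>w' x * sin y\<bar> \<le> w' x" for x y
      using w'01[of x] by (auto simp: abs_mult intro!: mult_left_le)
    have 1: "(\<integral>x. (w x * cos (\<Sum>i\<in>I. c i * U i x)) * indicator (A j) (U j x) \<partial>M) = 
       (\<integral>x. (w' x * cos (\<Sum>i\<in>I. c i * U' i x)) * indicator (A j) (U' j x) \<partial>N)"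
      by (rule weighted_law_eqI[OF M N, where w=w and w'=w' and C=1])
         (use w_eqs v_eqs w01 w'01 bd bd' in auto)
    have 2: "(\<integral>x. (w x * sin (\<Sum>i\<in>I. c i * U i x)) * indicator (A j) (U j x) \<partial>M) = 
       (\<integral>x. (w' x * sin (\<Sum>i\<in>I. c i * U' i x)) * indicator (A j) (U' j x) \<partial>N)"
      by (rule weighted_law_eqI[OF M N, where w=w and w'=w' and C=1])
         (use w_eqs v_eqs w01 w'01 bd bd' in auto)
    show ?case
      using 1 2 insert.hyps by (simp add: w_def w'_def mult_ac)
  qed
  have mM[measurable]: "(\<lambda>x. \<lambda>i\<in>I. U i x) \<in> measurable M (Pi\<^sub>M I (\<lambda>_. borel))"
    using U by (intro measurable_restrict) auto
  have mN[measurable]: "(\<lambda>x. \<lambda>i\<in>I. U' i x) \<in> measurable N (Pi\<^sub>M I (\<lambda>_. borel))"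
    using U' by (intro measurable_restrict) auto
  have pr: "(\<Prod>i\<in>I. indicator (A i) (V i x)) = (indicator ({x. \<forall>i\<in>I. V i x \<in> A i}) x :: real)"
    for A :: "'i \<Rightarrow> real set" and V :: "'i \<Rightarrow> 'c \<Rightarrow> real" and x
    using I by (induction I rule: finite_induct) (auto simp: indicator_def)
  show ?thesis
  proof (rule measure_eqI_PiM_finite[OF I])
    fix A :: "'i \<Rightarrow> real set" assume A: "\<And>i. i \<in> I \<Longrightarrow> A i \<in> sets borel"
    have Ps: "Pi\<^sub>E I A \<in> sets (Pi\<^sub>M I (\<lambda>_. borel))"
      using A by (intro sets_PiM_I_finite I) auto
    have "emeasure (distr M (Pi\<^sub>M I (\<lambda>_. borel)) (\<lambda>x. \<lambda>i\<in>I. U i x)) (Pi\<^sub>E I A)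
        = ennreal (\<integral>x. (\<Prod>j\<in>I. indicator (A j) (U j x)) \<partial>M)"
    proof -
      have "(\<lambda>x. \<lambda>i\<in>I. U i x) -` Pi\<^sub>E I A \<inter> space M = {x. \<forall>i\<in>I. U i x \<in> A i} \<inter> space M"
        by (auto simp: PiE_iff)
      thus ?thesis unfolding pr
        using measurable_sets[OF mM Ps] by (simp add: emeasure_distr Ps M.emeasure_eq_measure)
    qed
    also have "(\<integral>x. (\<Prod>j\<in>I. indicator (A j) (U j x)) \<partial>M) = (\<integral>x. (\<Prod>j\<in>I. indicator (A j) (U' j x)) \<partial>N :: real)"
      using key[OF I subset_refl, of A "\<lambda>_. 0"] A by simp
    also have "ennreal \<dots> = emeasure (distr N (Pi\<^sub>M I (\<lambda>_. borel)) (\<lambda>x. \<lambda>i\<in>I. U' i x)) (Pi\<^sub>E I A)"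
    proof -
      have "(\<lambda>x. \<lambda>i\<in>I. U' i x) -` Pi\<^sub>E I A \<inter> space N = {x. \<forall>i\<in>I. U' i x \<in> A i} \<inter> space N"
        by (auto simp: PiE_iff)
      thus ?thesis unfolding pr
        using measurable_sets[OF mN Ps] by (simp add: emeasure_distr Ps N.emeasure_eq_measure)
    qed
    finally show "emeasure (distr M (Pi\<^sub>M I (\<lambda>_. borel)) (\<lambda>x. \<lambda>i\<in>I. U i x)) (Pi\<^sub>E I A) = 
      emeasure (distr N (Pi\<^sub>M I (\<lambda>_. borel)) (\<lambda>x. \<lambda>i\<in>I. U' i x)) (Pi\<^sub>E I A)" .
  next
    show "range (\<lambda>_::nat. Pi\<^sub>E I (\<lambda>_. UNIV)) \<subseteq> prod_algebra I (\<lambda>_. borel :: real measure)"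
      using I by (auto intro!: prod_algebraI_finite)
    show "(\<Union>i::nat. Pi\<^sub>E I (\<lambda>_. UNIV)) = space (Pi\<^sub>M I (\<lambda>_. borel :: real measure))"
      by (simp add: space_PiM)
    fix i :: nat
    interpret D: prob_space "distr M (Pi\<^sub>M I (\<lambda>_. borel)) (\<lambda>x. \<lambda>i\<in>I. U i x)"
      by (rule M.prob_space_distr) simp
    show "emeasure (distr M (Pi\<^sub>M I (\<lambda>_. borel)) (\<lambda>x. \<lambda>i\<in>I. U i x)) (Pi\<^sub>E I (\<lambda>_. UNIV)) \<noteq> \<infinity>"
      by simp
  qed simp_all
qed

section \<open>Gaussian spaces\<close>

text \<open>The moment of order \<open>2p\<close> of the standard normal law.\<close>

definition even_moment :: "nat \<Rightarrow> real" where
  "even_moment p = fact (2 * p) / (2 ^ p * fact p)"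

lemma even_moment_pos: "even_moment p > 0" by (simp add: even_moment_def)

lemma even_moment_1: "even_moment 1 = 1" by (simp add: even_moment_def)

lemma normal_law_has_moment:
  assumes "0 \<le> \<sigma>"
  shows "has_bochner_integral (normal_law \<mu> \<sigma>) (\<lambda>x. (x - \<mu>) ^ (2 * p)) (even_moment p * \<sigma> ^ (2 * p))"
    "has_bochner_integral (normal_law \<mu> \<sigma>) (\<lambda>x. \<bar>x - \<mu>\<bar>) (sqrt (2 / pi) * \<sigma>)"
    "has_bochner_integral (normal_law \<mu> \<sigma>) (\<lambda>x. x - \<mu>) 0"
proof -
  have ret: "has_bochner_integral (return borel \<mu>) f (f \<mu>)" if "f \<in> borel_measurable borel" for f :: "real \<Rightarrow> real"
  proof -
    interpret R: prob_space "return borel \<mu> :: real measure" by (rule prob_space_return) simp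
    have "integrable (return borel \<mu>) f"
      by (rule R.integrable_const_bound[where B="\<bar>f \<mu>\<bar>"]) (use that in \<open>auto simp: AE_return\<close>)
    thus ?thesis using that by (simp add: has_bochner_integral_iff integral_return)
  qed
  have a: "has_bochner_integral (density lborel (\<lambda>x. ennreal (normal_density \<mu> \<sigma> x))) f c"
    if "has_bochner_integral lborel (\<lambda>x. normal_density \<mu> \<sigma> x * f x) c" "f \<in> borel_measurable borel" for f c
    using that by (intro has_bochner_integral_density) auto
  consider "\<sigma> = 0" | "\<sigma> > 0" using assms by linarith
  note cs = this
  show "has_bochner_integral (normal_law \<mu> \<sigma>) (\<lambda>x. (x - \<mu>) ^ (2 * p)) (even_moment p * \<sigma> ^ (2 * p))"
    using cs
  proof cases
    case 1
    have eq: "even_moment p * 0 ^ (2 * p) = (\<mu> - \<mu>) ^ (2 * p)"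
      by (cases "p = 0") (auto simp: even_moment_def zero_power)
    show ?thesis
      unfolding 1 normal_law_def if_P[OF refl] eq by (rule ret) simp
  next
    case 2
    have "(fact (2 * p) / ((2 / \<sigma>\<^sup>2)^p * fact p)) = even_moment p * \<sigma> ^ (2 * p)"
      using 2 by (simp add: even_moment_def field_simps power_mult[symmetric] mult.commute)
    with a[OF normal_moment_even[of \<sigma> \<mu> p]] 2 show ?thesis
      by (simp add: normal_law_def)
  qed
  show "has_bochner_integral (normal_law \<mu> \<sigma>) (\<lambda>x. \<bar>x - \<mu>\<bar>) (sqrt (2 / pi) * \<sigma>)"
    using cs
  proof cases
    case 1
    with ret[of "\<lambda>x. \<bar>x - \<mu>\<bar>"] show ?thesis by (simp add: normal_law_def)
  next
    case 2
    with a[of "\<lambda>x. \<bar>x - \<mu>\<bar>"] normal_moment_abs_odd[of \<sigma> \<mu> 0] 2 show ?thesis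
      by (simp add: normal_law_def mult_ac)
  qed
  show "has_bochner_integral (normal_law \<mu> \<sigma>) (\<lambda>x. x - \<mu>) 0"
    using cs
  proof cases
    case 1
    with ret[of "\<lambda>x. x - \<mu>"] show ?thesis by (simp add: normal_law_def)
  next
    case 2
    with a[of "\<lambda>x. x - \<mu>"] normal_moment_odd[of \<sigma> \<mu> 0] 2 show ?thesis
      by (simp add: normal_law_def mult_ac)
  qed
qed

lemma prob_space_normal_law: "0 \<le> \<sigma> \<Longrightarrow> prob_space (normal_law \<mu> \<sigma>)"
  unfolding normal_law_def by (auto intro: prob_space_return prob_space_normal_density)

lemma sets_normal_law[simp, measurable_cong]: "sets (normal_law \<mu> \<sigma>) = sets borel"
  by (simp add: normal_law_def)

lemma (in prob_space) normal_law_indep_add: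
  assumes ind: "indep_var borel X borel Y" and s: "0 \<le> \<sigma>" "0 \<le> \<tau>"
    and X: "distr M borel X = normal_law 0 \<sigma>" and Y: "distr M borel Y = normal_law 0 \<tau>"
  shows "distr M borel (\<lambda>\<omega>. X \<omega> + Y \<omega>) = normal_law 0 (sqrt (\<sigma>\<^sup>2 + \<tau>\<^sup>2))"
proof -
  have [measurable]: "X \<in> borel_measurable M" "Y \<in> borel_measurable M"
    using ind by (auto dest: indep_var_rv1 indep_var_rv2)
  have zero: "AE \<omega> in M. Z \<omega> = 0" if "distr M borel Z = normal_law 0 0" "Z \<in> borel_measurable M" for Z
  proof -
    have "AE x in distr M borel Z. x = 0"
      unfolding that(1) normal_law_def if_P[OF refl] by (subst AE_return) auto
    thus ?thesis using that(2) by (subst (asm) AE_distr_iff) auto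
  qed
  consider "\<sigma> = 0" | "\<tau> = 0" | "\<sigma> > 0" "\<tau> > 0" using s by linarith
  thus ?thesis
  proof cases
    case 1
    have "distr M borel (\<lambda>\<omega>. X \<omega> + Y \<omega>) = distr M borel Y"
      using zero[of X] X 1 by (intro distr_cong_AE) auto
    with Y 1 s show ?thesis by simp
  next
    case 2
    have "distr M borel (\<lambda>\<omega>. X \<omega> + Y \<omega>) = distr M borel X"
      using zero[of Y] Y 2 by (intro distr_cong_AE) auto
    with X 2 s show ?thesis by simp
  next
    case 3
    have lb: "distr M lborel Z = distr M borel Z" for Z
      by (rule distr_cong) auto
    have "distributed M lborel X (normal_density 0 \<sigma>)" "distributed M lborel Y (normal_density 0 \<tau>)"
      using X Y 3 by (auto simp: distributed_def lb normal_law_def)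
    from add_indep_normal[OF ind 3 this]
    have "distributed M lborel (\<lambda>\<omega>. X \<omega> + Y \<omega>) (normal_density 0 (sqrt (\<sigma>\<^sup>2 + \<tau>\<^sup>2)))" by simp
    moreover have "sqrt (\<sigma>\<^sup>2 + \<tau>\<^sup>2) \<noteq> 0" using 3 by (simp add: sum_power2_eq_zero_iff)
    ultimately show ?thesis unfolding normal_law_def by (simp only: if_False distributed_def lb)
  qed
qed

lemma norm_mult_le_sum_squares: "norm (x * y) \<le> norm (x\<^sup>2 + y\<^sup>2)" for x y :: real
proof -
  have "2 * (\<bar>x\<bar> * \<bar>y\<bar>) \<le> x\<^sup>2 + y\<^sup>2"
    using zero_le_power2[of "\<bar>x\<bar> - \<bar>y\<bar>"] by (simp add: power2_diff)
  moreover have "0 \<le> \<bar>x\<bar> * \<bar>y\<bar>" by simp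
  ultimately have "\<bar>x\<bar> * \<bar>y\<bar> \<le> x\<^sup>2 + y\<^sup>2" by linarith
  thus ?thesis by (simp add: abs_mult)
qed

lemma has_bochner_integral_law:
  fixes f :: "real \<Rightarrow> real"
  assumes Z: "Z \<in> borel_measurable M" and f: "has_bochner_integral (distr M borel Z) f c"
  shows "has_bochner_integral M (\<lambda>\<omega>. f (Z \<omega>)) c"
proof -
  have "f \<in> borel_measurable borel" using f by (auto dest: borel_measurable_has_bochner_integral)
  note fm = integrable_distr_eq[OF Z this] integral_distr[OF Z this]
  show ?thesis
    using f fm by (simp add: has_bochner_integral_iff)
qed

text \<open>A Gaussian Hilbert space without the closedness requirement: a linear space of random variables,
each of which is centred normal. Membership replaces statements about vectors of jointly
Gaussian variables.\<close>

definition gaussian_space :: "'a measure \<Rightarrow> ('a \<Rightarrow> real) set \<Rightarrow> bool" where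
  "gaussian_space M G \<longleftrightarrow> (\<lambda>_. 0) \<in> G \<and>
     (\<forall>Z\<in>G. Z \<in> borel_measurable M \<and>
        distr M borel Z = normal_law 0 (sqrt (\<integral>\<omega>. (Z \<omega>)\<^sup>2 \<partial>M))) \<and>
     (\<forall>Y\<in>G. \<forall>Z\<in>G. \<forall>a b. (\<lambda>\<omega>. a * Y \<omega> + b * Z \<omega>) \<in> G)"

lemma gaussian_space_lincomb:
  assumes "gaussian_space M G" "Y \<in> G" "Z \<in> G"
  shows "(\<lambda>\<omega>. a * Y \<omega> + b * Z \<omega>) \<in> G"
  using assms unfolding gaussian_space_def by blast

lemma gaussian_space_diff:
  assumes "gaussian_space M G" "Y \<in> G" "Z \<in> G"
  shows "(\<lambda>\<omega>. Y \<omega> - Z \<omega>) \<in> G"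
  using gaussian_space_lincomb[OF assms, of 1 "-1"] by simp

lemma gaussian_space_sum:
  assumes G: "gaussian_space M G" and "finite I" "\<And>i. i \<in> I \<Longrightarrow> U i \<in> G"
  shows "(\<lambda>\<omega>. \<Sum>i\<in>I. c i * U i \<omega>) \<in> G"
  using assms(2,3)
proof (induction I rule: finite_induct)
  case empty
  then show ?case using G by (simp add: gaussian_space_def)
next
  case (insert i I)
  from gaussian_space_lincomb[OF G, of "U i" "\<lambda>\<omega>. \<Sum>i\<in>I. c i * U i \<omega>" "c i" 1] insert
  show ?case by simp
qed

context
  fixes M :: "'a measure" and G
  assumes G: "gaussian_space M G"
begin

lemma gaussian_space_measurable: "Z \<in> G \<Longrightarrow> Z \<in> borel_measurable M"
  using G by (auto simp: gaussian_space_def)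

lemma gaussian_space_law: "Z \<in> G \<Longrightarrow> distr M borel Z = normal_law 0 (sqrt (\<integral>\<omega>. (Z \<omega>)\<^sup>2 \<partial>M))"
  using G by (auto simp: gaussian_space_def)

lemma gaussian_space_has_integral:
  assumes Z: "Z \<in> G" and f: "has_bochner_integral (normal_law 0 (sqrt (\<integral>\<omega>. (Z \<omega>)\<^sup>2 \<partial>M))) f (c::real)"
  shows "has_bochner_integral M (\<lambda>\<omega>. f (Z \<omega>)) c"
  using has_bochner_integral_law[OF gaussian_space_measurable[OF Z]] f
  unfolding gaussian_space_law[OF Z] by blast

lemma gaussian_space_even_moment:
  assumes "Z \<in> G"
  shows "has_bochner_integral M (\<lambda>\<omega>. Z \<omega> ^ (2 * p)) (even_moment p * (\<integral>\<omega>. (Z \<omega>)\<^sup>2 \<partial>M) ^ p)"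
  using gaussian_space_has_integral[OF assms normal_law_has_moment(1)[of _ 0 p]]
  by (simp add: power_mult)

lemma gaussian_space_mean_abs:
  assumes "Z \<in> G"
  shows "has_bochner_integral M (\<lambda>\<omega>. \<bar>Z \<omega>\<bar>) (sqrt (2 / pi) * sqrt (\<integral>\<omega>. (Z \<omega>)\<^sup>2 \<partial>M))"
  using gaussian_space_has_integral[OF assms normal_law_has_moment(2)[of _ 0]] by simp

lemma gaussian_space_mean:
  assumes "Z \<in> G"
  shows "has_bochner_integral M Z 0"
  using gaussian_space_has_integral[OF assms normal_law_has_moment(3)[of _ 0]] by simp

lemma gaussian_space_integrable_square: "Z \<in> G \<Longrightarrow> integrable M (\<lambda>\<omega>. (Z \<omega>)\<^sup>2)"
  using gaussian_space_even_moment[of Z 1] by (simp add: has_bochner_integral_iff)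

lemma gaussian_space_integrable_mult:
  assumes "Y \<in> G" "Z \<in> G" shows "integrable M (\<lambda>\<omega>. Y \<omega> * Z \<omega>)"
proof -
  have [measurable]: "Y \<in> borel_measurable M" "Z \<in> borel_measurable M"
    using assms gaussian_space_measurable by auto
  show ?thesis
  proof (rule Bochner_Integration.integrable_bound)
    show "integrable M (\<lambda>\<omega>. (Y \<omega>)\<^sup>2 + (Z \<omega>)\<^sup>2)"
      using assms gaussian_space_integrable_square by auto
    show "AE \<omega> in M. norm (Y \<omega> * Z \<omega>) \<le> norm ((Y \<omega>)\<^sup>2 + (Z \<omega>)\<^sup>2)"
      by (rule AE_I2) (rule norm_mult_le_sum_squares)
  qed auto
qed

lemma gaussian_space_second_moment_sum:
  assumes "finite I" "\<And>i. i \<in> I \<Longrightarrow> U i \<in> G"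
  shows "(\<integral>\<omega>. (\<Sum>i\<in>I. c i * U i \<omega>)\<^sup>2 \<partial>M) = (\<Sum>i\<in>I. \<Sum>j\<in>I. c i * c j * (\<integral>\<omega>. U i \<omega> * U j \<omega> \<partial>M))"
proof -
  have "(\<integral>\<omega>. (\<Sum>i\<in>I. c i * U i \<omega>)\<^sup>2 \<partial>M) = (\<integral>\<omega>. (\<Sum>i\<in>I. \<Sum>j\<in>I. c i * c j * (U i \<omega> * U j \<omega>)) \<partial>M)"
    by (simp add: power2_eq_square sum_product mult_ac)
  also have "\<dots> = (\<Sum>i\<in>I. \<Sum>j\<in>I. c i * c j * (\<integral>\<omega>. U i \<omega> * U j \<omega> \<partial>M))"
    using assms by (simp add: Bochner_Integration.integral_sum Bochner_Integration.integrable_sum gaussian_space_integrable_mult)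
  finally show ?thesis .
qed

end

text \<open>The law of a linear combination is fixed by its variance, hence by the covariances. The two
families may live on different probability spaces; this is how independence of uncorrelated
Gaussian variables is obtained, by comparison with a product space.\<close>

theorem gaussian_joint_law_eqI:
  fixes U :: "'i \<Rightarrow> 'a \<Rightarrow> real" and U' :: "'i \<Rightarrow> 'b \<Rightarrow> real"
  assumes M: "prob_space M" and N: "prob_space N" and I: "finite I"
    and G: "gaussian_space M G" and G': "gaussian_space N G'"
    and U: "\<And>i. i \<in> I \<Longrightarrow> U i \<in> G" and U': "\<And>i. i \<in> I \<Longrightarrow> U' i \<in> G'"
    and cov: "\<And>i j. i \<in> I \<Longrightarrow> j \<in> I \<Longrightarrow> (\<integral>\<omega>. U i \<omega> * U j \<omega> \<partial>M) = (\<integral>\<omega>. U' i \<omega> * U' j \<omega> \<partial>N)"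
  shows "distr M (Pi\<^sub>M I (\<lambda>_. borel)) (\<lambda>\<omega>. \<lambda>i\<in>I. U i \<omega>) = distr N (Pi\<^sub>M I (\<lambda>_. borel)) (\<lambda>\<omega>. \<lambda>i\<in>I. U' i \<omega>)"
proof (rule joint_law_eqI[OF M N I])
  fix c :: "'i \<Rightarrow> real"
  have "(\<integral>\<omega>. (\<Sum>i\<in>I. c i * U i \<omega>)\<^sup>2 \<partial>M) = (\<integral>\<omega>. (\<Sum>i\<in>I. c i * U' i \<omega>)\<^sup>2 \<partial>N)"
    by (simp add: gaussian_space_second_moment_sum[OF G I U] gaussian_space_second_moment_sum[OF G' I U'] cov)
  thus "distr M borel (\<lambda>x. \<Sum>i\<in>I. c i * U i x) = distr N borel (\<lambda>x. \<Sum>i\<in>I. c i * U' i x)"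
    using gaussian_space_law[OF G gaussian_space_sum[OF G I U, of _ c]]
      gaussian_space_law[OF G' gaussian_space_sum[OF G' I U', of _ c]] by simp
qed (auto intro: gaussian_space_measurable[OF G U] gaussian_space_measurable[OF G' U'])

text \<open>The sums of a variable of each coordinate are again Gaussian because the coordinates are
independent. This provides the reference space on which uncorrelated parts are independent by construction.\<close>

lemma gaussian_space_pair:
  fixes M :: "'a measure" and N :: "'b measure"
  assumes M: "prob_space M" and N: "prob_space N"
    and G: "gaussian_space M G" and G': "gaussian_space N G'"
  shows "gaussian_space (M \<Otimes>\<^sub>M N) {\<lambda>z. Y (fst z) + Z (snd z) |Y Z. Y \<in> G \<and> Z \<in> G'}" (is "gaussian_space _ ?G2")
    and "Y1 \<in> G \<Longrightarrow> Y2 \<in> G \<Longrightarrow> Z1 \<in> G' \<Longrightarrow> Z2 \<in> G' \<Longrightarrow>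
      (\<integral>z. (Y1 (fst z) + Z1 (snd z)) * (Y2 (fst z) + Z2 (snd z)) \<partial>(M \<Otimes>\<^sub>M N))
        = (\<integral>\<omega>. Y1 \<omega> * Y2 \<omega> \<partial>M) + (\<integral>\<omega>. Z1 \<omega> * Z2 \<omega> \<partial>N)"
proof -
  interpret M: prob_space M by (rule M)
  interpret N: prob_space N by (rule N)
  interpret P: pair_prob_space M N ..
  have fst_law: "distr (M \<Otimes>\<^sub>M N) M fst = M" by (rule N.distr_pair_fst)
  have snd_law: "distr (M \<Otimes>\<^sub>M N) N snd = N"
  proof (rule measure_eqI)
    fix A assume "A \<in> sets (distr (M \<Otimes>\<^sub>M N) N snd)"
    hence A[measurable]: "A \<in> sets N" by simp
    have "snd -` A \<inter> space (M \<Otimes>\<^sub>M N) = space M \<times> A"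
      using sets.sets_into_space[OF A] by (auto simp: space_pair_measure)
    thus "emeasure (distr (M \<Otimes>\<^sub>M N) N snd) A = emeasure N A"
      by (simp add: emeasure_distr N.emeasure_pair_measure_Times M.emeasure_space_1)
  qed simp
  have second: "(\<integral>z. (Y1 (fst z) + Z1 (snd z)) * (Y2 (fst z) + Z2 (snd z)) \<partial>(M \<Otimes>\<^sub>M N))
        = (\<integral>\<omega>. Y1 \<omega> * Y2 \<omega> \<partial>M) + (\<integral>\<omega>. Z1 \<omega> * Z2 \<omega> \<partial>N)"
    if YZ: "Y1 \<in> G" "Y2 \<in> G" "Z1 \<in> G'" "Z2 \<in> G'" for Y1 Y2 Z1 Z2
  proof -
      have fint: "integrable (M \<Otimes>\<^sub>M N) (\<lambda>z. f (fst z))" "(\<integral>z. f (fst z) \<partial>(M \<Otimes>\<^sub>M N)) = (\<integral>x. f x \<partial>M)"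
      if "integrable M f" for f :: "'a \<Rightarrow> real"
      using integrable_distr[of fst "M \<Otimes>\<^sub>M N" M f] integral_distr[of fst "M \<Otimes>\<^sub>M N" M f] that fst_law by auto
    have sint: "integrable (M \<Otimes>\<^sub>M N) (\<lambda>z. f (snd z))" "(\<integral>z. f (snd z) \<partial>(M \<Otimes>\<^sub>M N)) = (\<integral>x. f x \<partial>N)"
      if "integrable N f" for f :: "'b \<Rightarrow> real"
      using integrable_distr[of snd "M \<Otimes>\<^sub>M N" N f] integral_distr[of snd "M \<Otimes>\<^sub>M N" N f] that snd_law by auto
    have cross: "has_bochner_integral (M \<Otimes>\<^sub>M N) (\<lambda>z. Y (fst z) * Z (snd z)) 0" if "Y \<in> G" "Z \<in> G'" for Y Z
    proof -
      have [measurable]: "Y \<in> borel_measurable M" "Z \<in> borel_measurable N"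
        using that gaussian_space_measurable[OF G] gaussian_space_measurable[OF G'] by auto
      have int: "integrable (M \<Otimes>\<^sub>M N) (\<lambda>z. Y (fst z) * Z (snd z))"
      proof (rule Bochner_Integration.integrable_bound)
        show "integrable (M \<Otimes>\<^sub>M N) (\<lambda>z. (Y (fst z))\<^sup>2 + (Z (snd z))\<^sup>2)"
          using fint(1)[OF gaussian_space_integrable_square[OF G that(1)]]
            sint(1)[OF gaussian_space_integrable_square[OF G' that(2)]] by (rule Bochner_Integration.integrable_add)
        show "AE z in M \<Otimes>\<^sub>M N. norm (Y (fst z) * Z (snd z)) \<le> norm ((Y (fst z))\<^sup>2 + (Z (snd z))\<^sup>2)"
          by (rule AE_I2) (rule norm_mult_le_sum_squares)
      qed measurable
      have "(\<integral>z. Y (fst z) * Z (snd z) \<partial>(M \<Otimes>\<^sub>M N)) = (\<integral>x. (\<integral>y. Y x * Z y \<partial>N) \<partial>M)"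
        using P.integral_fst'[OF int] by simp
      also have "\<dots> = 0"
        using gaussian_space_mean[OF G' that(2)] by (simp add: has_bochner_integral_iff)
      finally show ?thesis using int by (simp add: has_bochner_integral_iff)
    qed
    have "(\<lambda>z. (Y1 (fst z) + Z1 (snd z)) * (Y2 (fst z) + Z2 (snd z))) = 
      (\<lambda>z. Y1 (fst z) * Y2 (fst z) + Y1 (fst z) * Z2 (snd z) + Y2 (fst z) * Z1 (snd z) + Z1 (snd z) * Z2 (snd z))"
      by (auto simp: algebra_simps)
    moreover have "has_bochner_integral (M \<Otimes>\<^sub>M N) \<dots> ((\<integral>\<omega>. Y1 \<omega> * Y2 \<omega> \<partial>M) + 0 + 0 + (\<integral>\<omega>. Z1 \<omega> * Z2 \<omega> \<partial>N))"
      using cross[OF YZ(1,4)] cross[OF YZ(2,3)] fint[OF gaussian_space_integrable_mult[OF G YZ(1,2)]]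
        sint[OF gaussian_space_integrable_mult[OF G' YZ(3,4)]]
      by (intro has_bochner_integral_add) (auto simp: has_bochner_integral_iff)
    ultimately show ?thesis by (simp add: has_bochner_integral_iff)
  qed
  show "Y1 \<in> G \<Longrightarrow> Y2 \<in> G \<Longrightarrow> Z1 \<in> G' \<Longrightarrow> Z2 \<in> G' \<Longrightarrow>
      (\<integral>z. (Y1 (fst z) + Z1 (snd z)) * (Y2 (fst z) + Z2 (snd z)) \<partial>(M \<Otimes>\<^sub>M N))
        = (\<integral>\<omega>. Y1 \<omega> * Y2 \<omega> \<partial>M) + (\<integral>\<omega>. Z1 \<omega> * Z2 \<omega> \<partial>N)" by (rule second)
  show "gaussian_space (M \<Otimes>\<^sub>M N) ?G2"
    unfolding gaussian_space_def
  proof (intro conjI ballI allI)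
    have "(\<lambda>_. 0) \<in> G" "(\<lambda>_. 0) \<in> G'" 
      using G G' by (simp_all add: gaussian_space_def)
    thus "(\<lambda>_. 0) \<in> ?G2"
      unfolding mem_Collect_eq by (intro exI[of _ "\<lambda>_. 0"]) simp
  next
    fix X assume "X \<in> ?G2"
    then obtain Y Z where YZ: "Y \<in> G" "Z \<in> G'" and X: "X = (\<lambda>z. Y (fst z) + Z (snd z))" by auto
    have [measurable]: "Y \<in> borel_measurable M" "Z \<in> borel_measurable N"
      using YZ gaussian_space_measurable[OF G] gaussian_space_measurable[OF G'] by auto
    show "X \<in> borel_measurable (M \<Otimes>\<^sub>M N)" unfolding X by measurable
    have d1: "distr (M \<Otimes>\<^sub>M N) borel (\<lambda>z. Y (fst z)) = distr M borel Y"
      using distr_distr[of Y M borel fst "M \<Otimes>\<^sub>M N"] fst_law by (simp add: comp_def)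
    have d2: "distr (M \<Otimes>\<^sub>M N) borel (\<lambda>z. Z (snd z)) = distr N borel Z"
      using distr_distr[of Z N borel snd "M \<Otimes>\<^sub>M N"] snd_law by (simp add: comp_def)
    have "sigma_finite_measure (distr N borel Z)"
      by (intro finite_measure.axioms(1) prob_space.finite_measure N.prob_space_distr) simp
    from pair_measure_distr[OF _ _ this, of Y M borel]
    have ind: "P.indep_var borel (\<lambda>z. Y (fst z)) borel (\<lambda>z. Z (snd z))"
      unfolding P.indep_var_distribution_eq d1 d2
      by (auto simp: case_prod_unfold)
    have "distr (M \<Otimes>\<^sub>M N) borel X = normal_law 0 (sqrt ((\<integral>\<omega>. (Y \<omega>)\<^sup>2 \<partial>M) + (\<integral>\<omega>. (Z \<omega>)\<^sup>2 \<partial>N)))"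
      using P.normal_law_indep_add[OF ind _ _ d1[unfolded gaussian_space_law[OF G YZ(1)]] 
          d2[unfolded gaussian_space_law[OF G' YZ(2)]]] by (simp add: X)
    also have "(\<integral>\<omega>. (Y \<omega>)\<^sup>2 \<partial>M) + (\<integral>\<omega>. (Z \<omega>)\<^sup>2 \<partial>N) = (\<integral>z. (X z)\<^sup>2 \<partial>(M \<Otimes>\<^sub>M N))"
      using second[OF YZ(1,1) YZ(2,2)] by (simp add: X power2_eq_square)
    finally show "distr (M \<Otimes>\<^sub>M N) borel X = normal_law 0 (sqrt (\<integral>z. (X z)\<^sup>2 \<partial>(M \<Otimes>\<^sub>M N)))" .
  next
    fix X1 X2 and a b :: real assume "X1 \<in> ?G2" "X2 \<in> ?G2"
    then obtain Y1 Z1 Y2 Z2 where YZ: "Y1 \<in> G" "Z1 \<in> G'" "Y2 \<in> G" "Z2 \<in> G'"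
      and X: "X1 = (\<lambda>z. Y1 (fst z) + Z1 (snd z))" "X2 = (\<lambda>z. Y2 (fst z) + Z2 (snd z))" by auto
    have "(\<lambda>z. a * X1 z + b * X2 z) = (\<lambda>z. (\<lambda>\<omega>. a * Y1 \<omega> + b * Y2 \<omega>) (fst z) + (\<lambda>\<omega>. a * Z1 \<omega> + b * Z2 \<omega>) (snd z))"
      by (auto simp: X algebra_simps)
    moreover have "(\<lambda>\<omega>. a * Y1 \<omega> + b * Y2 \<omega>) \<in> G" "(\<lambda>\<omega>. a * Z1 \<omega> + b * Z2 \<omega>) \<in> G'"
      by (rule gaussian_space_lincomb[OF G YZ(1,3)], rule gaussian_space_lincomb[OF G' YZ(2,4)])
    ultimately show "(\<lambda>z. a * X1 z + b * X2 z) \<in> ?G2"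
      unfolding mem_Collect_eq
      by (intro exI[of _ "\<lambda>\<omega>. a * Y1 \<omega> + b * Y2 \<omega>"] exI[of _ "\<lambda>\<omega>. a * Z1 \<omega> + b * Z2 \<omega>"] conjI)
  qed
qed

section \<open>Expected maxima of a Gaussian process with stationary increments\<close>

text \<open>\<open>V\<close> is the variance function; that the covariance is \<open>(V s + V t - V \<bar>s - t\<bar>) / 2\<close> expresses
stationarity of the increments. All variables of interest lie in the Gaussian space \<open>G\<close>.\<close>

locale gaussian_stationary_increments = prob_space M for M :: "'a measure" +
  fixes G :: "('a \<Rightarrow> real) set" and Y :: "real \<Rightarrow> 'a \<Rightarrow> real" and V :: "real \<Rightarrow> real"
  assumes G: "gaussian_space M G"
    and YG: "0 \<le> t \<Longrightarrow> Y t \<in> G"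
    and cov: "0 \<le> s \<Longrightarrow> 0 \<le> t \<Longrightarrow> expectation (\<lambda>\<omega>. Y s \<omega> * Y t \<omega>) = (V s + V t - V \<bar>s - t\<bar>) / 2"
    and V0: "V 0 = 0"
begin

lemma second_moment: "0 \<le> t \<Longrightarrow> expectation (\<lambda>\<omega>. (Y t \<omega>)\<^sup>2) = V t"
  using cov[of t t] V0 by (simp add: power2_eq_square)

lemma V_nonneg: "0 \<le> t \<Longrightarrow> 0 \<le> V t"
  unfolding second_moment[symmetric] by simp

lemma increment_moment:
  assumes "0 \<le> s" "0 \<le> t"
  shows "has_bochner_integral M (\<lambda>\<omega>. (Y t \<omega> - Y s \<omega>) ^ (2 * p)) (even_moment p * V \<bar>t - s\<bar> ^ p)"
proof -
  have "(\<lambda>\<omega>. (Y t \<omega> - Y s \<omega>)\<^sup>2) = (\<lambda>\<omega>. Y t \<omega> * Y t \<omega> + Y s \<omega> * Y s \<omega> - 2 * (Y t \<omega> * Y s \<omega>))"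
    by (auto simp: power2_eq_square algebra_simps)
  hence "expectation (\<lambda>\<omega>. (Y t \<omega> - Y s \<omega>)\<^sup>2) = V t + V s - (V t + V s - V \<bar>t - s\<bar>)"
    using assms by (simp add: gaussian_space_integrable_mult[OF G] YG cov V0 field_simps abs_minus_commute)
  moreover have "(\<lambda>\<omega>. Y t \<omega> - Y s \<omega>) \<in> G"
    by (intro gaussian_space_diff[OF G] YG assms)
  ultimately show ?thesis
    using gaussian_space_even_moment[OF G, of "\<lambda>\<omega>. Y t \<omega> - Y s \<omega>" p] by simp
qed

lemma Y_measurable[measurable (raw)]: "0 \<le> t \<Longrightarrow> Y t \<in> borel_measurable M"
  by (rule gaussian_space_measurable[OF G YG])

lemma Y_moment: "0 \<le> t \<Longrightarrow> has_bochner_integral M (\<lambda>\<omega>. Y t \<omega> ^ (2 * p)) (even_moment p * V t ^ p)"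
  using gaussian_space_even_moment[OF G YG] second_moment by simp

lemma Y_mean: "0 \<le> t \<Longrightarrow> has_bochner_integral M (Y t) 0"
  by (rule gaussian_space_mean[OF G YG])

definition running_max :: "real \<Rightarrow> nat \<Rightarrow> 'a \<Rightarrow> real" where
  "running_max \<delta> n \<omega> = Max ((\<lambda>k. Y (real k * \<delta>) \<omega>) ` {0..n})"

definition positive_min :: "real \<Rightarrow> nat \<Rightarrow> 'a \<Rightarrow> real" where
  "positive_min \<delta> n \<omega> = max 0 (Min ((\<lambda>k. Y (real k * \<delta>) \<omega>) ` {1..n}))"

lemma running_max_measurable[measurable]: "0 \<le> \<delta> \<Longrightarrow> running_max \<delta> n \<in> borel_measurable M"
  unfolding running_max_def by (intro borel_measurable_Max Y_measurable) auto

lemma positive_min_measurable[measurable]: "0 \<le> \<delta> \<Longrightarrow> positive_min \<delta> n \<in> borel_measurable M"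
  unfolding positive_min_def by (intro borel_measurable_max borel_measurable_Min Y_measurable) auto

lemma running_max_abs_le: "\<bar>running_max \<delta> n \<omega>\<bar> \<le> (\<Sum>k\<in>{0..n}. \<bar>Y (real k * \<delta>) \<omega>\<bar>)"
proof -
  have "running_max \<delta> n \<omega> \<in> (\<lambda>k. Y (real k * \<delta>) \<omega>) ` {0..n}"
    unfolding running_max_def by (rule Max_in) auto
  then obtain k where "k \<in> {0..n}" "running_max \<delta> n \<omega> = Y (real k * \<delta>) \<omega>" by auto
  thus ?thesis using member_le_sum[of k "{0..n}" "\<lambda>k. \<bar>Y (real k * \<delta>) \<omega>\<bar>"] by auto
qed

lemma running_max_integrable: "0 \<le> \<delta> \<Longrightarrow> integrable M (running_max \<delta> n)"
proof (rule Bochner_Integration.integrable_bound)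
  assume "0 \<le> \<delta>"
  thus "integrable M (\<lambda>\<omega>. \<Sum>k\<in>{0..n}. \<bar>Y (real k * \<delta>) \<omega>\<bar>)"
    by (intro Bochner_Integration.integrable_sum integrable_abs integrable.intros[OF Y_mean]) auto
  show "AE \<omega> in M. norm (running_max \<delta> n \<omega>) \<le> norm (\<Sum>k\<in>{0..n}. \<bar>Y (real k * \<delta>) \<omega>\<bar>)"
    using running_max_abs_le by (intro AE_I2) (simp add: order.trans[OF _ abs_ge_self])
qed simp

lemma running_max_Suc: "running_max \<delta> (Suc n) \<omega> = max (Y (real (Suc n) * \<delta>) \<omega>) (running_max \<delta> n \<omega>)"
  unfolding running_max_def by (simp add: atLeast0_atMost_Suc del: of_nat_Suc)

lemma positive_min_le: "1 \<le> n \<Longrightarrow> positive_min \<delta> n \<omega> \<le> max 0 (Y \<delta> \<omega>)"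
proof -
  assume "1 \<le> n"
  hence "Min ((\<lambda>k. Y (real k * \<delta>) \<omega>) ` {1..n}) \<le> Y (real 1 * \<delta>) \<omega>"
    by (intro Min_le) (auto intro!: image_eqI[of _ _ "1::nat"])
  thus ?thesis unfolding positive_min_def by auto
qed

lemma positive_min_nonneg: "0 \<le> positive_min \<delta> n \<omega>"
  by (simp add: positive_min_def)

lemma positive_min_integrable: "0 \<le> \<delta> \<Longrightarrow> 1 \<le> n \<Longrightarrow> integrable M (positive_min \<delta> n)"
proof (rule Bochner_Integration.integrable_bound)
  assume a: "0 \<le> \<delta>" "1 \<le> n"
  show "integrable M (\<lambda>\<omega>. \<bar>Y \<delta> \<omega>\<bar>)"
    using Y_mean[OF a(1)] by (auto simp: has_bochner_integral_iff)
  show "AE \<omega> in M. norm (positive_min \<delta> n \<omega>) \<le> norm \<bar>Y \<delta> \<omega>\<bar>"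
  proof (rule AE_I2)
    fix \<omega> show "norm (positive_min \<delta> n \<omega>) \<le> norm \<bar>Y \<delta> \<omega>\<bar>"
      using positive_min_le[OF a(2), of \<delta> \<omega>] positive_min_nonneg[of \<delta> n \<omega>] by auto
  qed
qed simp

lemma positive_min_antimono:
  assumes "1 \<le> m" "m \<le> n"
  shows "positive_min \<delta> n \<omega> \<le> positive_min \<delta> m \<omega>"
proof -
  have "Min ((\<lambda>k. Y (real k * \<delta>) \<omega>) ` {1..n}) \<le> Min ((\<lambda>k. Y (real k * \<delta>) \<omega>) ` {1..m})"
    using assms by (intro Min_antimono) auto
  thus ?thesis unfolding positive_min_def by auto
qed

text \<open>Discrete Molchan identity. A new maximum at time \<open>n + 1\<close> exceeds the old one by the positive part of
the minimum of the increments \<open>Y ((n + 1)\<delta>) - Y ((n + 1 - k)\<delta>)\<close>, and this reversed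
family has the same covariances as \<open>Y (k\<delta>)\<close>.\<close>

lemma expected_max_increment:
  assumes d: "0 \<le> \<delta>"
  shows "expectation (running_max \<delta> (Suc n)) - expectation (running_max \<delta> n) = expectation (positive_min \<delta> (Suc n))"
proof -
  let ?I = "{1..Suc n}"
  define g :: "(nat \<Rightarrow> real) \<Rightarrow> real" where "g x = max 0 (Min ((\<lambda>k. x k) ` ?I))" for x
  have g[measurable]: "g \<in> borel_measurable (Pi\<^sub>M ?I (\<lambda>_. borel))"
    unfolding g_def by (intro borel_measurable_max borel_measurable_Min) auto
  define R where "R k \<omega> = Y (real (Suc n) * \<delta>) \<omega> - Y (real (Suc n - k) * \<delta>) \<omega>" for k \<omega>
  have RG: "R k \<in> G" for k
    unfolding R_def by (intro gaussian_space_diff[OF G] YG) (use d in auto)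
  have law: "distr M (Pi\<^sub>M ?I (\<lambda>_. borel)) (\<lambda>\<omega>. \<lambda>k\<in>?I. R k \<omega>) =
     distr M (Pi\<^sub>M ?I (\<lambda>_. borel)) (\<lambda>\<omega>. \<lambda>k\<in>?I. Y (real k * \<delta>) \<omega>)"
  proof (rule gaussian_joint_law_eqI[OF prob_space_axioms prob_space_axioms _ G G])
    fix i j assume ij: "i \<in> ?I" "j \<in> ?I"
    define a b c where "a = real (Suc n) * \<delta>" "b = real (Suc n - i) * \<delta>" "c = real (Suc n - j) * \<delta>"
    have pos: "0 \<le> a" "0 \<le> b" "0 \<le> c" using d by (auto simp: a_b_c_def)
    have abs: "\<bar>a - b\<bar> = real i * \<delta>" "\<bar>a - c\<bar> = real j * \<delta>" "\<bar>b - a\<bar> = real i * \<delta>" "\<bar>c - a\<bar> = real j * \<delta>" 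
      "\<bar>b - c\<bar> = \<bar>real i * \<delta> - real j * \<delta>\<bar>"
      using ij d by (auto simp: a_b_c_def of_nat_diff algebra_simps abs_minus_commute)
    have "(\<lambda>\<omega>. R i \<omega> * R j \<omega>) = (\<lambda>\<omega>. Y a \<omega> * Y a \<omega> - Y a \<omega> * Y c \<omega> - Y b \<omega> * Y a \<omega> + Y b \<omega> * Y c \<omega>)"
      by (auto simp: R_def a_b_c_def algebra_simps simp del: of_nat_Suc)
    hence "expectation (\<lambda>\<omega>. R i \<omega> * R j \<omega>) = 
      V a - (V a + V c - V (real j * \<delta>)) / 2 - (V b + V a - V (real i * \<delta>)) / 2 + (V b + V c - V \<bar>real i * \<delta> - real j * \<delta>\<bar>) / 2"
      using pos by (simp add: gaussian_space_integrable_mult[OF G] YG cov V0 abs)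
    also have "\<dots> = expectation (\<lambda>\<omega>. Y (real i * \<delta>) \<omega> * Y (real j * \<delta>) \<omega>)"
      using d by (simp add: cov field_simps)
    finally show "expectation (\<lambda>\<omega>. R i \<omega> * R j \<omega>) = expectation (\<lambda>\<omega>. Y (real i * \<delta>) \<omega> * Y (real j * \<delta>) \<omega>)" .
  qed (use RG YG d in auto)
  have m: "(\<lambda>\<omega>. \<lambda>k\<in>?I. R k \<omega>) \<in> measurable M (Pi\<^sub>M ?I (\<lambda>_. borel))"
    "(\<lambda>\<omega>. \<lambda>k\<in>?I. Y (real k * \<delta>) \<omega>) \<in> measurable M (Pi\<^sub>M ?I (\<lambda>_. borel))"
    using gaussian_space_measurable[OF G RG] d by (auto intro!: measurable_restrict)
  have "expectation (\<lambda>\<omega>. g (\<lambda>k\<in>?I. R k \<omega>)) = expectation (\<lambda>\<omega>. g (\<lambda>k\<in>?I. Y (real k * \<delta>) \<omega>))"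
    unfolding integral_distr[OF m(1) g, symmetric] integral_distr[OF m(2) g, symmetric] law ..
  moreover have "(\<lambda>\<omega>. g (\<lambda>k\<in>?I. Y (real k * \<delta>) \<omega>)) = positive_min \<delta> (Suc n)"
    by (auto simp: g_def positive_min_def cong: image_cong_simp)
  moreover have "(\<lambda>\<omega>. g (\<lambda>k\<in>?I. R k \<omega>)) = (\<lambda>\<omega>. running_max \<delta> (Suc n) \<omega> - running_max \<delta> n \<omega>)"
  proof
    fix \<omega>
    have im: "(\<lambda>k. Suc n - k) ` ?I = {0..n}"
    proof (intro equalityI subsetI)
      fix k assume "k \<in> {0..n}"
      hence "k = Suc n - (Suc n - k)" "Suc n - k \<in> ?I" by auto
      thus "k \<in> (\<lambda>k. Suc n - k) ` ?I" by blast
    qed auto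
    have "(\<lambda>k. R k \<omega>) ` ?I = (\<lambda>k. Y (real (Suc n) * \<delta>) \<omega> - Y (real k * \<delta>) \<omega>) ` {0..n}"
      unfolding im[symmetric] image_image by (simp add: R_def)
    also have "Min \<dots> = Y (real (Suc n) * \<delta>) \<omega> - running_max \<delta> n \<omega>"
    proof (rule Min_eqI)
      fix y assume "y \<in> (\<lambda>k. Y (real (Suc n) * \<delta>) \<omega> - Y (real k * \<delta>) \<omega>) ` {0..n}"
      thus "Y (real (Suc n) * \<delta>) \<omega> - running_max \<delta> n \<omega> \<le> y"
        unfolding running_max_def by (auto intro!: Max_ge)
    next
      have "running_max \<delta> n \<omega> \<in> (\<lambda>k. Y (real k * \<delta>) \<omega>) ` {0..n}"
        unfolding running_max_def by (rule Max_in) auto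
      thus "Y (real (Suc n) * \<delta>) \<omega> - running_max \<delta> n \<omega> \<in> (\<lambda>k. Y (real (Suc n) * \<delta>) \<omega> - Y (real k * \<delta>) \<omega>) ` {0..n}"
        by auto
    qed auto
    finally have "g (\<lambda>k\<in>?I. R k \<omega>) = max 0 (Y (real (Suc n) * \<delta>) \<omega> - running_max \<delta> n \<omega>)"
      by (simp add: g_def cong: image_cong_simp)
    thus "g (\<lambda>k\<in>?I. R k \<omega>) = running_max \<delta> (Suc n) \<omega> - running_max \<delta> n \<omega>"
      unfolding running_max_Suc by auto
  qed
  ultimately show ?thesis
    using running_max_integrable[OF d] by simp
qed

lemma expected_max_0: "expectation (running_max \<delta> 0) = 0"
proof -
  have "running_max \<delta> 0 = Y 0" by (auto simp: running_max_def)
  thus ?thesis using Y_mean[of 0] by (simp add: has_bochner_integral_iff)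
qed

lemma expected_positive_min_antimono:
  "0 \<le> \<delta> \<Longrightarrow> 1 \<le> m \<Longrightarrow> m \<le> n \<Longrightarrow> expectation (positive_min \<delta> n) \<le> expectation (positive_min \<delta> m)"
  by (intro integral_mono positive_min_integrable positive_min_antimono) auto

text \<open>The expected maximum is a sum of \<open>n\<close> decreasing steps, and the last step is at most
their average.\<close>

lemma expected_positive_min_upper:
  assumes "0 \<le> \<delta>" "1 \<le> n"
  shows "real n * expectation (positive_min \<delta> n) \<le> expectation (running_max \<delta> n)"
proof -
  have "real m * expectation (positive_min \<delta> n) \<le> expectation (running_max \<delta> m)" if "m \<le> n" for m
    using that
  proof (induction m)
    case 0
    then show ?case by (simp add: expected_max_0)
  next
    case (Suc m)
    then show ?case
      using expected_positive_min_antimono[OF assms(1), of "Suc m" n] expected_max_increment[OF assms(1), of m]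
      by (simp add: distrib_right)
  qed
  thus ?thesis by simp
qed

lemma expected_positive_min_lower:
  assumes "0 \<le> \<delta>" "1 \<le> n"
  shows "expectation (running_max \<delta> (n + m)) - expectation (running_max \<delta> n) \<le> real m * expectation (positive_min \<delta> n)"
proof (induction m)
  case (Suc m)
  then show ?case
    using expected_positive_min_antimono[OF assms(1), of n "Suc (n + m)"] expected_max_increment[OF assms(1), of "n + m"] assms
    by (simp add: distrib_right)
qed simp

text \<open>The maximum dominates the positive part of the last value, up to \<open>\<bar>Y 0\<bar>\<close>, which vanishes almost
surely; and \<open>E \<bar>Z\<bar> = sqrt (2 / \<pi>) sqrt (E Z\<^sup>2)\<close> for centred normal \<open>Z\<close>. The constant \<open>1/3\<close> is
half of \<open>2/3 \<le> sqrt (2 / \<pi>)\<close>.\<close>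

lemma expected_max_lower:
  assumes "0 \<le> \<delta>"
  shows "sqrt (V (real n * \<delta>)) / 3 \<le> expectation (running_max \<delta> n)"
proof -
  let ?t = "real n * \<delta>"
  have t: "0 \<le> ?t" using assms by simp
  have i: "integrable M (Y 0)" "integrable M (Y ?t)" "expectation (Y 0) = 0" "expectation (Y ?t) = 0"
    using Y_mean[of 0] Y_mean[OF t] by (auto simp: has_bochner_integral_iff)
  have abs: "has_bochner_integral M (\<lambda>\<omega>. \<bar>Y ?t \<omega>\<bar>) (sqrt (2 / pi) * sqrt (V ?t))"
    using gaussian_space_mean_abs[OF G YG[OF t]] second_moment[OF t] by simp
  have abs0: "has_bochner_integral M (\<lambda>\<omega>. \<bar>Y 0 \<omega>\<bar>) 0"
    using gaussian_space_mean_abs[OF G YG[of 0]] second_moment[of 0] V0 by simp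
  have "(2/3)\<^sup>2 \<le> 2 / pi" using pi_less_4 by (simp add: field_simps power2_eq_square)
  hence "2/3 \<le> sqrt (2 / pi)" by (rule real_le_rsqrt)
  hence "2/3 * sqrt (V ?t) \<le> sqrt (2 / pi) * sqrt (V ?t)"
    using V_nonneg[OF t] by (intro mult_right_mono) auto
  hence "sqrt (V ?t) / 3 \<le> (sqrt (2 / pi) * sqrt (V ?t)) / 2" by simp
  also have "\<dots> = expectation (\<lambda>\<omega>. (\<bar>Y ?t \<omega>\<bar> + Y ?t \<omega>) / 2 - \<bar>Y 0 \<omega>\<bar>)"
    using abs abs0 i by (simp add: has_bochner_integral_iff)
  also have "\<dots> \<le> expectation (running_max \<delta> n)"
  proof (rule integral_mono)
    show "integrable M (\<lambda>\<omega>. (\<bar>Y ?t \<omega>\<bar> + Y ?t \<omega>) / 2 - \<bar>Y 0 \<omega>\<bar>)"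
      using abs abs0 i by (auto simp: has_bochner_integral_iff)
    fix \<omega>
    have "Y (real k * \<delta>) \<omega> \<le> running_max \<delta> n \<omega>" if "k \<le> n" for k
      unfolding running_max_def using that by (intro Max_ge) auto
    from this[of n] this[of 0] show "(\<bar>Y ?t \<omega>\<bar> + Y ?t \<omega>) / 2 - \<bar>Y 0 \<omega>\<bar> \<le> running_max \<delta> n \<omega>"
      by (auto simp: abs_if)
  qed (rule running_max_integrable[OF assms])
  finally show ?thesis .
qed

text \<open>Truncation at level \<open>s\<close> with a moment controlling the excess. For \<open>s = T\<^bsup>e\<^esup>\<close> and large \<open>p\<close> the excess is
smaller than any given power of \<open>T\<close>, so a variable with bounded moments may be replaced by \<open>T\<^bsup>e\<^esup>\<close>.\<close>

lemma le_truncation: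
  fixes y s :: real
  assumes "0 < s" "1 \<le> p"
  shows "y \<le> s + y ^ (2 * p) / s ^ (2 * p - 1)"
proof (cases "y \<le> s")
  case True
  have "0 \<le> y ^ (2 * p) / s ^ (2 * p - 1)" using assms by (simp add: power_mult)
  with True show ?thesis by linarith
next
  case False
  have "y * 1 \<le> y * (y ^ (2 * p - 1) / s ^ (2 * p - 1))"
    using False assms by (intro mult_left_mono) (auto intro!: power_mono)
  also have "\<dots> = y ^ (2 * p) / s ^ (2 * p - 1)"
    using assms by (simp add: power_Suc[symmetric] del: power_Suc)
  finally show ?thesis using assms by simp
qed

text \<open>The excess over \<open>s\<close> is summed over all mesh points. This is cruder than the logarithmic bound
for Gaussian maxima, but a power of \<open>n\<close> with small exponent is affordable.\<close>

lemma expected_max_upper: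
  assumes d: "0 \<le> \<delta>" and s: "0 < s" and p: "1 \<le> p" and V: "\<And>k. k \<le> n \<Longrightarrow> V (real k * \<delta>) \<le> v"
  shows "expectation (running_max \<delta> n) \<le> s + real (Suc n) * (even_moment p * v ^ p) / s ^ (2 * p - 1)"
proof -
  have i: "has_bochner_integral M (\<lambda>\<omega>. Y (real k * \<delta>) \<omega> ^ (2 * p)) (even_moment p * V (real k * \<delta>) ^ p)" for k
    using Y_moment[of "real k * \<delta>" p] d by simp
  have "expectation (running_max \<delta> n) \<le> expectation (\<lambda>\<omega>. s + (\<Sum>k\<in>{0..n}. Y (real k * \<delta>) \<omega> ^ (2 * p)) / s ^ (2 * p - 1))"
  proof (rule integral_mono)
    show "integrable M (\<lambda>\<omega>. s + (\<Sum>k\<in>{0..n}. Y (real k * \<delta>) \<omega> ^ (2 * p)) / s ^ (2 * p - 1))"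
      using i by (auto simp: has_bochner_integral_iff)
    fix \<omega>
    have "running_max \<delta> n \<omega> \<in> (\<lambda>k. Y (real k * \<delta>) \<omega>) ` {0..n}"
      unfolding running_max_def by (rule Max_in) auto
    then obtain k where k: "k \<in> {0..n}" "running_max \<delta> n \<omega> = Y (real k * \<delta>) \<omega>" by auto
    have "Y (real k * \<delta>) \<omega> ^ (2 * p) \<le> (\<Sum>k\<in>{0..n}. Y (real k * \<delta>) \<omega> ^ (2 * p))"
      using k by (intro member_le_sum) (auto simp: power_mult)
    hence "Y (real k * \<delta>) \<omega> ^ (2 * p) / s ^ (2 * p - 1) \<le> (\<Sum>k\<in>{0..n}. Y (real k * \<delta>) \<omega> ^ (2 * p)) / s ^ (2 * p - 1)"
      using s by (intro divide_right_mono) auto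
    thus "running_max \<delta> n \<omega> \<le> s + (\<Sum>k\<in>{0..n}. Y (real k * \<delta>) \<omega> ^ (2 * p)) / s ^ (2 * p - 1)"
      using le_truncation[OF s p, of "Y (real k * \<delta>) \<omega>"] k by linarith
  qed (rule running_max_integrable[OF d])
  also have "\<dots> = s + (\<Sum>k\<in>{0..n}. even_moment p * V (real k * \<delta>) ^ p) / s ^ (2 * p - 1)"
    using i by (simp add: has_bochner_integral_iff prob_space)
  also have "\<dots> \<le> s + (\<Sum>k\<in>{0..n}. even_moment p * v ^ p) / s ^ (2 * p - 1)"
    using V s d even_moment_pos[of p]
    by (intro add_left_mono divide_right_mono sum_mono mult_left_mono power_mono V_nonneg) auto
  finally show ?thesis by simp
qed

text \<open>The positive minimum vanishes off the event on the right and is at most the positive part of its first term \<open>Y \<delta>\<close>,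
which is truncated at \<open>s\<close>.\<close>

lemma expected_positive_min_le_prob:
  assumes d: "0 \<le> \<delta>" and n: "1 \<le> n" and s: "0 < s" and p: "1 \<le> p"
  shows "expectation (positive_min \<delta> n) \<le>
    s * prob {\<omega> \<in> space M. \<forall>k\<in>{1..n}. 0 \<le> Y (real k * \<delta>) \<omega>} + even_moment p * V \<delta> ^ p / s ^ (2 * p - 1)"
proof -
  let ?A = "{\<omega> \<in> space M. \<forall>k\<in>{1..n}. 0 \<le> Y (real k * \<delta>) \<omega>}"
  have [measurable]: "Y (real k * \<delta>) \<in> borel_measurable M" for k using d by simp
  have A[measurable]: "?A \<in> sets M" by measurable
  note i = Y_moment[OF d, of p]
  have iA: "integrable M (\<lambda>\<omega>. indicator ?A \<omega> :: real)"
    by (rule integrable_const_bound[where B=1]) auto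
  have "expectation (positive_min \<delta> n) \<le> expectation (\<lambda>\<omega>. s * indicator ?A \<omega> + Y \<delta> \<omega> ^ (2 * p) / s ^ (2 * p - 1))"
  proof (rule integral_mono)
    show "integrable M (\<lambda>\<omega>. s * indicator ?A \<omega> + Y \<delta> \<omega> ^ (2 * p) / s ^ (2 * p - 1))"
      using i iA unfolding has_bochner_integral_iff
      by (intro Bochner_Integration.integrable_add integrable_mult_right integrable_divide_zero) auto
    fix \<omega> assume \<omega>: "\<omega> \<in> space M"
    have nn: "0 \<le> Y \<delta> \<omega> ^ (2 * p) / s ^ (2 * p - 1)" using s by (simp add: power_mult)
    show "positive_min \<delta> n \<omega> \<le> s * indicator ?A \<omega> + Y \<delta> \<omega> ^ (2 * p) / s ^ (2 * p - 1)"
    proof (cases "\<omega> \<in> ?A")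
      case True
      have "max 0 (Y \<delta> \<omega>) \<le> s + Y \<delta> \<omega> ^ (2 * p) / s ^ (2 * p - 1)"
        using le_truncation[OF s p, of "Y \<delta> \<omega>"] nn s by simp
      from order.trans[OF positive_min_le[OF n] this] True show ?thesis by simp
    next
      case False
      then obtain k where k: "k \<in> {1..n}" "Y (real k * \<delta>) \<omega> < 0" using \<omega> by (auto simp: not_le)
      have "Min ((\<lambda>k. Y (real k * \<delta>) \<omega>) ` {1..n}) \<le> Y (real k * \<delta>) \<omega>"
        using k by (intro Min_le) auto
      hence "Min ((\<lambda>k. Y (real k * \<delta>) \<omega>) ` {1..n}) \<le> 0" using k by linarith
      hence "positive_min \<delta> n \<omega> = 0" unfolding positive_min_def by (rule max_absorb1)
      thus ?thesis using nn False by simp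
    qed
  qed (rule positive_min_integrable[OF d n])
  also have "\<dots> = s * prob ?A + even_moment p * V \<delta> ^ p / s ^ (2 * p - 1)"
    using i iA A by (simp add: has_bochner_integral_iff)
  finally show ?thesis .
qed

lemma prob_ge_1_le_expected_positive_min:
  assumes d: "0 \<le> \<delta>" and n: "1 \<le> n"
  shows "prob {\<omega> \<in> space M. \<forall>k\<in>{1..n}. 1 \<le> Y (real k * \<delta>) \<omega>} \<le> expectation (positive_min \<delta> n)"
proof -
  let ?A = "{\<omega> \<in> space M. \<forall>k\<in>{1..n}. 1 \<le> Y (real k * \<delta>) \<omega>}"
  have [measurable]: "Y (real k * \<delta>) \<in> borel_measurable M" for k using d by simp
  have A[measurable]: "?A \<in> sets M" by measurable
  have iA: "integrable M (indicator ?A :: 'a \<Rightarrow> real)"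
    by (rule integrable_const_bound[where B=1]) auto
  have "prob ?A = expectation (indicator ?A)" by simp
  also have "\<dots> \<le> expectation (positive_min \<delta> n)"
  proof (rule integral_mono)
    fix \<omega> assume "\<omega> \<in> space M"
    have "1 \<le> positive_min \<delta> n \<omega>" if "\<omega> \<in> ?A"
      unfolding positive_min_def using that n by (intro max.coboundedI2 Min.boundedI) auto
    thus "indicator ?A \<omega> \<le> positive_min \<delta> n \<omega>"
      using positive_min_nonneg[of \<delta> n \<omega>] by (auto simp: indicator_def)
  qed (use positive_min_integrable[OF d n] iA in auto)
  finally show ?thesis .
qed

end

section \<open>Raising the barrier\<close>

lemma measure_normal_law:
  assumes "0 < \<sigma>" "A \<in> sets borel"
  shows "measure (normal_law \<mu> \<sigma>) A = (\<integral>x. normal_density \<mu> \<sigma> x * indicator A x \<partial>lborel)"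
    "integrable lborel (\<lambda>x. normal_density \<mu> \<sigma> x * indicator A x)"
proof -
  have [measurable]: "A \<in> sets borel" by fact
  interpret prob_space "normal_law \<mu> \<sigma>" using assms by (intro prob_space_normal_law) simp
  have nl: "normal_law \<mu> \<sigma> = density lborel (\<lambda>x. ennreal (normal_density \<mu> \<sigma> x))"
    using assms by (simp add: normal_law_def)
  have "measure (normal_law \<mu> \<sigma>) A = expectation (indicator A)" using assms by simp
  also have "\<dots> = (\<integral>x. normal_density \<mu> \<sigma> x * indicator A x \<partial>lborel)"
    unfolding nl by (subst integral_density) auto
  finally show "measure (normal_law \<mu> \<sigma>) A = (\<integral>x. normal_density \<mu> \<sigma> x * indicator A x \<partial>lborel)" .
  show "integrable lborel (\<lambda>x. normal_density \<mu> \<sigma> x * indicator A x)"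
    using integrable_real_mult_indicator[of A lborel "normal_density \<mu> \<sigma>"] assms by auto
qed

text \<open>Translating a normal law by \<open>c\<close> multiplies its density by a likelihood ratio \<open>L\<close> having all
moments. Where \<open>L \<le> s\<close> the comparison costs the factor \<open>s\<close>; where \<open>L > s\<close>, \<open>L \<le> L\<^bsup>m + 1\<^esup> / s\<^bsup>m\<^esup>\<close>.
The point is that \<open>C\<close> does not depend on the position \<open>g\<close> of the barrier.\<close>

lemma normal_tail_shift:
  fixes \<sigma> c :: real and m :: nat
  assumes \<sigma>: "0 < \<sigma>"
  shows "\<exists>C\<ge>0. \<forall>g s. 0 < s \<longrightarrow>
    measure (normal_law 0 \<sigma>) {g..} \<le> s * measure (normal_law 0 \<sigma>) {g + c..} + C / s ^ m"
proof -
  define C where "C = exp (((real (Suc m))\<^sup>2 * c\<^sup>2 - real (Suc m) * c\<^sup>2) / (2 * \<sigma>\<^sup>2))"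
  have pw: "normal_density c \<sigma> x \<le> s * normal_density 0 \<sigma> x + C / s ^ m * normal_density (real (Suc m) * c) \<sigma> x"
    if s: "0 < s" for s x
  proof -
    define L where "L = exp ((2 * c * x - c\<^sup>2) / (2 * \<sigma>\<^sup>2))"
    have "L > 0" by (simp add: L_def)
    have nd: "normal_density c \<sigma> x = normal_density 0 \<sigma> x * L"
      unfolding normal_density_def L_def using \<sigma>
      by (simp add: exp_add[symmetric] add_divide_distrib[symmetric] power2_diff field_simps)
    \<comment> \<open>completing the square: tilting by a power of \<open>L\<close> gives another normal density\<close>
    have nd2: "normal_density 0 \<sigma> x * L ^ Suc m = C * normal_density (real (Suc m) * c) \<sigma> x"
    proof -
      have e: "- (x - 0)\<^sup>2 / D + R * ((2 * c * x - c\<^sup>2) / D) = (R\<^sup>2 * c\<^sup>2 - R * c\<^sup>2) / D + - (x - R * c)\<^sup>2 / D"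
        if "D \<noteq> 0" for D R :: real
        using that by (simp add: field_simps power2_eq_square)
      have "exp (- (x - 0)\<^sup>2 / (2 * \<sigma>\<^sup>2)) * L ^ Suc m = C * exp (- (x - real (Suc m) * c)\<^sup>2 / (2 * \<sigma>\<^sup>2))"
        unfolding L_def C_def exp_of_nat_mult[symmetric] exp_add[symmetric]
        using e[of "2 * \<sigma>\<^sup>2" "real (Suc m)"] \<sigma> by simp
      thus ?thesis unfolding normal_density_def by (simp add: mult_ac)
    qed
    have "L \<le> s + L ^ Suc m / s ^ m"
    proof (cases "L \<le> s")
      case True
      have "0 \<le> L ^ Suc m / s ^ m" using \<open>L > 0\<close> s by simp
      with True show ?thesis by linarith
    next
      case False
      have "L * 1 \<le> L * (L ^ m / s ^ m)"
        using False s by (intro mult_left_mono) (auto intro!: power_mono)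
      with s show ?thesis by simp
    qed
    hence "normal_density 0 \<sigma> x * L \<le> normal_density 0 \<sigma> x * (s + L ^ Suc m / s ^ m)"
      by (intro mult_left_mono) auto
    also have "\<dots> = s * normal_density 0 \<sigma> x + (normal_density 0 \<sigma> x * L ^ Suc m) / s ^ m"
      by (simp add: algebra_simps)
    finally show ?thesis unfolding nd nd2 by simp
  qed
  have "measure (normal_law 0 \<sigma>) {g..} \<le> s * measure (normal_law 0 \<sigma>) {g + c..} + C / s ^ m"
    if s: "0 < s" for s g
  proof -
    let ?A = "{g + c..}"
    have "measure (normal_law 0 \<sigma>) {g..} = (\<integral>x. normal_density 0 \<sigma> x * indicator {g..} x \<partial>lborel)"
      by (rule measure_normal_law[OF \<sigma>]) simp
    also have "\<dots> = (\<integral>x. normal_density 0 \<sigma> (- c + 1 * x) * indicator {g..} (- c + 1 * x) \<partial>lborel)"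
      by (subst lborel_integral_real_affine[of 1 _ "- c"]) auto
    also have "\<dots> = (\<integral>x. normal_density c \<sigma> x * indicator ?A x \<partial>lborel)"
      by (intro Bochner_Integration.integral_cong) (auto simp: normal_density_def indicator_def)
    also have "\<dots> \<le> (\<integral>x. s * (normal_density 0 \<sigma> x * indicator ?A x) + 
        C / s ^ m * (normal_density (real (Suc m) * c) \<sigma> x * indicator ?A x) \<partial>lborel)"
    proof (rule integral_mono)
      fix x show "normal_density c \<sigma> x * indicator ?A x \<le> s * (normal_density 0 \<sigma> x * indicator ?A x) + 
        C / s ^ m * (normal_density (real (Suc m) * c) \<sigma> x * indicator ?A x)"
        using pw[OF s, of x] by (auto simp: indicator_def)
    qed (use measure_normal_law(2)[OF \<sigma>, of ?A] in auto)
    also have "\<dots> = s * measure (normal_law 0 \<sigma>) ?A + C / s ^ m * measure (normal_law (real (Suc m) * c) \<sigma>) ?A"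
      using measure_normal_law[OF \<sigma>, of ?A] by simp
    also have "\<dots> \<le> s * measure (normal_law 0 \<sigma>) ?A + C / s ^ m * 1"
      using s \<sigma> prob_space.prob_le_1[OF prob_space_normal_law[of \<sigma> "real (Suc m) * c"]]
      by (intro add_left_mono mult_left_mono) (auto simp: C_def)
    finally show ?thesis by simp
  qed
  thus ?thesis by (intro exI[of _ C]) (auto simp: C_def)
qed

context gaussian_stationary_increments
begin

text \<open>Write \<open>Y k = f k \<cdot> Y 1 + Z k\<close> with \<open>Z k\<close> uncorrelated to \<open>Y 1\<close>, hence independent of it.
Monotonicity of \<open>V\<close> gives \<open>f k \<ge> 1/2\<close>. For fixed values of \<open>Z\<close> the event
that every \<open>Y k\<close> is at least \<open>-1\<close> has the form \<open>Y 1 \<ge> g\<close>, and raising \<open>Y 1\<close> by \<open>4\<close> raises every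
\<open>Y k\<close> by at least \<open>2\<close>. The one-dimensional comparison is then integrated over \<open>Z\<close>.\<close>

lemma prob_lift:
  assumes mono: "\<And>s t. 0 \<le> s \<Longrightarrow> s \<le> t \<Longrightarrow> V s \<le> V t" and V1: "0 < V 1"
  shows "\<exists>C\<ge>0. \<forall>n\<ge>1. \<forall>s>0. prob {\<omega> \<in> space M. \<forall>k\<in>{1..n}. -1 \<le> Y (real k) \<omega>}
    \<le> s * prob {\<omega> \<in> space M. \<forall>k\<in>{1..n}. 1 \<le> Y (real k) \<omega>} + C / s ^ m"
proof -
  obtain C where C: "C \<ge> 0" "\<And>g s. 0 < s \<Longrightarrow>
    measure (normal_law 0 (sqrt (V 1))) {g..} \<le> s * measure (normal_law 0 (sqrt (V 1))) {g + 4..} + C / s ^ m"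
    using normal_tail_shift[of "sqrt (V 1)" 4 m] V1 by auto
  have "prob {\<omega> \<in> space M. \<forall>k\<in>{1..n}. -1 \<le> Y (real k) \<omega>}
    \<le> s * prob {\<omega> \<in> space M. \<forall>k\<in>{1..n}. 1 \<le> Y (real k) \<omega>} + C / s ^ m"
    if n: "1 \<le> n" and s: "0 < s" for n :: nat and s :: real
  proof -
    let ?I = "{1..n}"
    define f where "f k = expectation (\<lambda>\<omega>. Y (real k) \<omega> * Y 1 \<omega>) / V 1" for k :: nat
    define Z where "Z k \<omega> = Y (real k) \<omega> - f k * Y 1 \<omega>" for k \<omega>
    \<comment> \<open>a copy of the process on the product space, in which \<open>Y 1\<close> and \<open>Z\<close> depend on different coordinates\<close>
    define W where "W k z = f k * Y 1 (fst z) + Z k (snd z)" for k and z :: "'a \<times> 'a"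
    have f: "1 / 2 \<le> f k" if "k \<in> ?I" for k
    proof -
      have "V \<bar>real k - 1\<bar> \<le> V (real k)" using that by (intro mono) auto
      thus ?thesis using V1 by (simp add: f_def cov field_simps abs_minus_commute)
    qed
    have G1: "(\<lambda>\<omega>. f k * Y 1 \<omega>) \<in> G" for k
      using gaussian_space_lincomb[OF G YG YG, of 1 1 "f k" 0] by simp
    have ZG: "Z k \<in> G" for k
      using gaussian_space_lincomb[OF G YG YG, of "real k" 1 1 "- f k"] by (simp add: Z_def[abs_def])
    note G2 = gaussian_space_pair[OF prob_space_axioms prob_space_axioms G G]
    interpret P: pair_prob_space M M ..
    have ps: "prob_space (M \<Otimes>\<^sub>M M)" by unfold_locales
    have law: "distr M (Pi\<^sub>M ?I (\<lambda>_. borel)) (\<lambda>\<omega>. \<lambda>k\<in>?I. Y (real k) \<omega>) =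
       distr (M \<Otimes>\<^sub>M M) (Pi\<^sub>M ?I (\<lambda>_. borel)) (\<lambda>z. \<lambda>k\<in>?I. W k z)"
    proof (rule gaussian_joint_law_eqI[OF prob_space_axioms ps _ G G2(1)])
      fix i j
      have c1: "expectation (\<lambda>\<omega>. Y (real k) \<omega> * Y 1 \<omega>) = f k * V 1" for k
        using V1 by (simp add: f_def)
      have c11: "expectation (\<lambda>\<omega>. Y 1 \<omega> * Y 1 \<omega>) = V 1"
        using second_moment[of 1] by (simp add: power2_eq_square)
      have "(\<lambda>\<omega>. Z i \<omega> * Z j \<omega>) = (\<lambda>\<omega>. Y (real i) \<omega> * Y (real j) \<omega> - f j * (Y (real i) \<omega> * Y 1 \<omega>)
        - f i * (Y (real j) \<omega> * Y 1 \<omega>) + f i * f j * (Y 1 \<omega> * Y 1 \<omega>))"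
        by (auto simp: Z_def algebra_simps)
      hence "expectation (\<lambda>\<omega>. Z i \<omega> * Z j \<omega>) = expectation (\<lambda>\<omega>. Y (real i) \<omega> * Y (real j) \<omega>) - f i * f j * V 1"
        by (simp add: gaussian_space_integrable_mult[OF G] YG c1 c11)
      moreover have "expectation (\<lambda>\<omega>. f i * Y 1 \<omega> * (f j * Y 1 \<omega>)) = f i * f j * V 1"
      proof -
        have "(\<lambda>\<omega>. f i * Y 1 \<omega> * (f j * Y 1 \<omega>)) = (\<lambda>\<omega>. f i * f j * (Y 1 \<omega> * Y 1 \<omega>))" by auto
        thus ?thesis by (simp add: c11)
      qed
      ultimately show "expectation (\<lambda>\<omega>. Y (real i) \<omega> * Y (real j) \<omega>) = P.expectation (\<lambda>z. W i z * W j z)"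
        unfolding W_def using G2(2)[OF G1[of i] G1[of j] ZG[of i] ZG[of j]] by simp
    next
      fix i
      show "W i \<in> {\<lambda>z. Y (fst z) + Z (snd z) |Y Z. Y \<in> G \<and> Z \<in> G}"
        unfolding mem_Collect_eq W_def[abs_def]
        by (intro exI[of _ "\<lambda>\<omega>. f i * Y 1 \<omega>"] exI[of _ "Z i"] conjI G1 ZG refl)
    qed (auto intro: YG)
    have [measurable]: "Y (real k) \<in> borel_measurable M" "Y 1 \<in> borel_measurable M" "Z k \<in> borel_measurable M" for k
      using gaussian_space_measurable[OF G ZG] by auto
    have Wm[measurable]: "W k \<in> borel_measurable (M \<Otimes>\<^sub>M M)" for k
      unfolding W_def by measurable
    define q where "q a \<omega>' = prob {\<omega> \<in> space M. \<forall>k\<in>?I. a \<le> f k * Y 1 \<omega> + Z k \<omega>'}" for a :: real and \<omega>'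
    have fub: "ennreal (prob {\<omega> \<in> space M. \<forall>k\<in>?I. a \<le> Y (real k) \<omega>}) = (\<integral>\<^sup>+\<omega>'. ennreal (q a \<omega>') \<partial>M)" for a
    proof -
      let ?B = "{x \<in> space (Pi\<^sub>M ?I (\<lambda>_. borel)). \<forall>k\<in>?I. a \<le> x k}"
      have B: "?B \<in> sets (Pi\<^sub>M ?I (\<lambda>_. borel))" by measurable
      have m1: "(\<lambda>\<omega>. \<lambda>k\<in>?I. Y (real k) \<omega>) \<in> measurable M (Pi\<^sub>M ?I (\<lambda>_. borel))" by measurable
      have m2: "(\<lambda>z. \<lambda>k\<in>?I. W k z) \<in> measurable (M \<Otimes>\<^sub>M M) (Pi\<^sub>M ?I (\<lambda>_. borel))" by measurable
      have Am: "{z \<in> space (M \<Otimes>\<^sub>M M). \<forall>k\<in>?I. a \<le> W k z} \<in> sets (M \<Otimes>\<^sub>M M)" by measurable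
      have "emeasure M {\<omega> \<in> space M. \<forall>k\<in>?I. a \<le> Y (real k) \<omega>} = 
        emeasure (distr M (Pi\<^sub>M ?I (\<lambda>_. borel)) (\<lambda>\<omega>. \<lambda>k\<in>?I. Y (real k) \<omega>)) ?B"
        unfolding emeasure_distr[OF m1 B] by (intro arg_cong2[of _ _ _ _ emeasure]) (auto simp: space_PiM)
      also have "\<dots> = emeasure (M \<Otimes>\<^sub>M M) {z \<in> space (M \<Otimes>\<^sub>M M). \<forall>k\<in>?I. a \<le> W k z}"
        unfolding law emeasure_distr[OF m2 B] by (intro arg_cong2[of _ _ _ _ emeasure]) (auto simp: space_PiM)
      also have "\<dots> = (\<integral>\<^sup>+\<omega>'. emeasure M ((\<lambda>\<omega>. (\<omega>, \<omega>')) -` {z \<in> space (M \<Otimes>\<^sub>M M). \<forall>k\<in>?I. a \<le> W k z}) \<partial>M)"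
        by (rule P.emeasure_pair_measure_alt2[OF Am])
      also have "\<dots> = (\<integral>\<^sup>+\<omega>'. ennreal (q a \<omega>') \<partial>M)"
      proof (rule nn_integral_cong)
        fix \<omega>' assume "\<omega>' \<in> space M"
        hence "(\<lambda>\<omega>. (\<omega>, \<omega>')) -` {z \<in> space (M \<Otimes>\<^sub>M M). \<forall>k\<in>?I. a \<le> W k z} = {\<omega> \<in> space M. \<forall>k\<in>?I. a \<le> f k * Y 1 \<omega> + Z k \<omega>'}"
          by (auto simp: space_pair_measure W_def)
        thus "emeasure M ((\<lambda>\<omega>. (\<omega>, \<omega>')) -` {z \<in> space (M \<Otimes>\<^sub>M M). \<forall>k\<in>?I. a \<le> W k z}) = ennreal (q a \<omega>')"
          by (simp add: q_def emeasure_eq_measure)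
      qed
      finally show ?thesis by (simp add: emeasure_eq_measure)
    qed
    have q: "q (-1) \<omega>' \<le> s * q 1 \<omega>' + C / s ^ m" for \<omega>'
    proof -
      define g where "g = Max ((\<lambda>k. (- 1 - Z k \<omega>') / f k) ` ?I)"
      have fpos: "0 < f k" if "k \<in> ?I" for k using f[OF that] by linarith
      have tail: "measure (normal_law 0 (sqrt (V 1))) {x..} = prob {\<omega> \<in> space M. x \<le> Y 1 \<omega>}" for x
      proof -
        have "distr M borel (Y 1) = normal_law 0 (sqrt (V 1))"
          using gaussian_space_law[OF G YG[of 1]] second_moment[of 1] by simp
        hence "measure (normal_law 0 (sqrt (V 1))) {x..} = measure (distr M borel (Y 1)) {x..}" by simp
        also have "\<dots> = prob {\<omega> \<in> space M. x \<le> Y 1 \<omega>}"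
          by (subst measure_distr) (auto intro!: arg_cong[of _ _ prob])
        finally show ?thesis .
      qed
      have iff: "(-1 \<le> f k * y + Z k \<omega>') \<longleftrightarrow> (- 1 - Z k \<omega>') / f k \<le> y" if "k \<in> ?I" for k y
        using fpos[OF that] by (simp add: field_simps)
      have "(\<forall>k\<in>?I. -1 \<le> f k * y + Z k \<omega>') \<longleftrightarrow> g \<le> y" for y
        unfolding g_def using n iff by (subst Max_le_iff) auto
      hence "q (-1) \<omega>' = prob {\<omega> \<in> space M. g \<le> Y 1 \<omega>}" unfolding q_def by simp
      also have "\<dots> \<le> s * prob {\<omega> \<in> space M. g + 4 \<le> Y 1 \<omega>} + C / s ^ m"
        using C(2)[OF s, of g] unfolding tail .
      also have "\<dots> \<le> s * q 1 \<omega>' + C / s ^ m"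
      proof -
        have "prob {\<omega> \<in> space M. g + 4 \<le> Y 1 \<omega>} \<le> q 1 \<omega>'"
          unfolding q_def
        proof (rule finite_measure_mono)
          show "{\<omega> \<in> space M. g + 4 \<le> Y 1 \<omega>} \<subseteq> {\<omega> \<in> space M. \<forall>k\<in>?I. 1 \<le> f k * Y 1 \<omega> + Z k \<omega>'}"
          proof (intro subsetI CollectI conjI ballI)
            fix \<omega> k assume \<omega>: "\<omega> \<in> {\<omega> \<in> space M. g + 4 \<le> Y 1 \<omega>}" and k: "k \<in> ?I"
            have "(- 1 - Z k \<omega>') / f k \<le> g" unfolding g_def using k by (intro Max_ge) auto
            hence "f k * ((- 1 - Z k \<omega>') / f k + 4) \<le> f k * Y 1 \<omega>"
              using \<omega> fpos[OF k] by (intro mult_left_mono) auto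
            hence "- 1 - Z k \<omega>' + 4 * f k \<le> f k * Y 1 \<omega>"
              using fpos[OF k] by (simp add: distrib_left)
            with f[OF k] show "1 \<le> f k * Y 1 \<omega> + Z k \<omega>'" by linarith
          qed auto
        qed measurable
        thus ?thesis using s by (intro add_right_mono mult_left_mono) auto
      qed
      finally show ?thesis .
    qed
    have q0: "0 \<le> q a \<omega>'" for a \<omega>' by (simp add: q_def)
    have C0: "0 \<le> C / s ^ m" using C(1) s by simp
    have qm: "q a \<in> borel_measurable M" for a
    proof -
      have "{z \<in> space (M \<Otimes>\<^sub>M M). \<forall>k\<in>?I. a \<le> f k * Y 1 (snd z) + Z k (fst z)} \<in> sets (M \<Otimes>\<^sub>M M)"
        by measurable
      moreover have "{z \<in> space (M \<Otimes>\<^sub>M M). \<forall>k\<in>?I. a \<le> f k * Y 1 (snd z) + Z k (fst z)} =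
        {z \<in> space (M \<Otimes>\<^sub>M M). snd z \<in> {\<omega> \<in> space M. \<forall>k\<in>?I. a \<le> f k * Y 1 \<omega> + Z k (fst z)}}"
        by (auto simp: space_pair_measure)
      ultimately show ?thesis unfolding q_def by (intro measurable_measure) auto
    qed
    have "ennreal (prob {\<omega> \<in> space M. \<forall>k\<in>?I. -1 \<le> Y (real k) \<omega>}) \<le> (\<integral>\<^sup>+\<omega>'. ennreal s * ennreal (q 1 \<omega>') + ennreal (C / s ^ m) \<partial>M)"
      unfolding fub using q q0 C0 s
      by (intro nn_integral_mono) (simp add: ennreal_mult[symmetric] ennreal_plus[symmetric] del: ennreal_plus)
    also have "\<dots> = ennreal s * (\<integral>\<^sup>+\<omega>'. ennreal (q 1 \<omega>') \<partial>M) + ennreal (C / s ^ m)"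
      using qm by (simp add: nn_integral_add nn_integral_cmult emeasure_space_1)
    also have "\<dots> = ennreal (s * prob {\<omega> \<in> space M. \<forall>k\<in>?I. 1 \<le> Y (real k) \<omega>} + C / s ^ m)"
      unfolding fub[symmetric] using s C0 by (simp add: ennreal_mult ennreal_plus)
    finally show ?thesis
      using s C0 by (subst (asm) ennreal_le_iff) auto
  qed
  with C(1) show ?thesis by blast
qed

end

section \<open>Oscillation on short intervals\<close>

text \<open>The increments at level \<open>j\<close> are bounded by the terms \<open>(1 - r) r\<^sup>j\<close> of a series with sum \<open>1\<close>. A dyadic
point of level \<open>j\<close> is reached from \<open>u\<close> by at most one step on each level; continuity passes to all points.\<close>

lemma dyadic_chaining:
  fixes f :: "real \<Rightarrow> real" and \<delta> r :: real
  assumes \<delta>: "0 < \<delta>" and r: "0 < r" "r < 1" and f: "continuous_on {u..u + \<delta>} f"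
    and inc: "\<And>j k. k < 2 ^ j \<Longrightarrow>
      \<bar>f (u + real (Suc k) * \<delta> / 2 ^ j) - f (u + real k * \<delta> / 2 ^ j)\<bar> \<le> (1 - r) * r ^ j"
    and t: "t \<in> {u..u + \<delta>}"
  shows "\<bar>f t - f u\<bar> \<le> 1"
proof -
  have dy: "\<bar>f (u + real k * \<delta> / 2 ^ j) - f u\<bar> \<le> (\<Sum>i\<le>j. (1 - r) * r ^ i)" if "k \<le> 2 ^ j" for j k
    using that
  proof (induction j arbitrary: k)
    case 0
    hence "k = 0 \<or> k = 1" by auto
    thus ?case using inc[of 0 0] r by auto
  next
    case (Suc j)
    show ?case
    proof (cases "even k")
      case True
      then obtain l where l: "k = 2 * l" by (elim evenE)
      have "u + real k * \<delta> / 2 ^ Suc j = u + real l * \<delta> / 2 ^ j" by (simp add: l)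
      moreover have "0 \<le> (1 - r) * r ^ Suc j" using r by simp
      ultimately show ?thesis using Suc.IH[of l] Suc.prems l by simp
    next
      case False
      then obtain l where l: "k = 2 * l + 1" by (elim oddE)
      have "u + real (2 * l) * \<delta> / 2 ^ Suc j = u + real l * \<delta> / 2 ^ j" by simp
      moreover have "2 * l < 2 ^ Suc j" using Suc.prems l by simp
      ultimately show ?thesis using Suc.IH[of l] inc[of "2 * l" "Suc j"] Suc.prems l by simp
    qed
  qed
  have sum: "(\<Sum>i\<le>j. (1 - r) * r ^ i) \<le> 1" for j
  proof -
    have "(\<Sum>i\<le>j. (1 - r) * r ^ i) = 1 - r ^ Suc j"
      by (induction j) (auto simp: algebra_simps)
    thus ?thesis using r by simp
  qed
  define a where "a j = nat \<lfloor>(t - u) * 2 ^ j / \<delta>\<rfloor>" for j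
  define x where "x j = u + real (a j) * \<delta> / 2 ^ j" for j
  have aj: "real (a j) \<le> (t - u) * 2 ^ j / \<delta>" "(t - u) * 2 ^ j / \<delta> < real (a j) + 1" for j
  proof -
    have "0 \<le> (t - u) * 2 ^ j / \<delta>" using t \<delta> by simp
    thus "real (a j) \<le> (t - u) * 2 ^ j / \<delta>" "(t - u) * 2 ^ j / \<delta> < real (a j) + 1"
      unfolding a_def by (auto simp: of_nat_nat)
  qed
  have xt: "x j \<le> t" "t - \<delta> / 2 ^ j \<le> x j" for j
  proof -
    have "real (a j) * (\<delta> / 2 ^ j) \<le> (t - u) * 2 ^ j / \<delta> * (\<delta> / 2 ^ j)"
      using aj(1)[of j] \<delta> by (intro mult_right_mono) auto
    thus "x j \<le> t" using \<delta> by (simp add: x_def)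
    have "(t - u) * 2 ^ j / \<delta> * (\<delta> / 2 ^ j) \<le> (real (a j) + 1) * (\<delta> / 2 ^ j)"
      using aj(2)[of j] \<delta> by (intro mult_right_mono) auto
    moreover have "(t - u) * 2 ^ j / \<delta> * (\<delta> / 2 ^ j) = t - u" using \<delta> by simp
    moreover have "(real (a j) + 1) * (\<delta> / 2 ^ j) = real (a j) * \<delta> / 2 ^ j + \<delta> / 2 ^ j"
      by (simp add: distrib_right add_divide_distrib)
    ultimately show "t - \<delta> / 2 ^ j \<le> x j" unfolding x_def by linarith
  qed
  have aj2: "a j \<le> 2 ^ j" for j
  proof -
    have "(t - u) * 2 ^ j / \<delta> \<le> \<delta> * 2 ^ j / \<delta>"
      using t \<delta> by (intro divide_right_mono mult_right_mono) auto
    hence "(t - u) * 2 ^ j / \<delta> \<le> 2 ^ j" using \<delta> by simp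
    hence "real (a j) \<le> 2 ^ j" using aj[of j] by linarith
    hence "real (a j) \<le> real (2 ^ j)" by simp
    thus ?thesis by (simp only: of_nat_le_iff)
  qed
  have fx: "\<bar>f (x j) - f u\<bar> \<le> 1" for j
    unfolding x_def using dy[OF aj2[of j]] sum[of j] by linarith
  have xl: "x \<longlonglongrightarrow> t"
  proof (rule tendsto_sandwich[of "\<lambda>j. t - \<delta> / 2 ^ j" _ _ "\<lambda>_. t"])
    have "(\<lambda>j. t - \<delta> * (1 / 2) ^ j) \<longlonglongrightarrow> t - \<delta> * 0"
      by (intro tendsto_intros LIMSEQ_power_zero) auto
    thus "(\<lambda>j. t - \<delta> / 2 ^ j) \<longlonglongrightarrow> t" by (simp add: power_one_over)
  qed (use xt in auto)
  have "x j \<in> {u..u + \<delta>}" for j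
    using xt[of j] t \<delta> by (auto simp: x_def)
  hence "(\<lambda>j. f (x j)) \<longlonglongrightarrow> f t"
    using f xl t unfolding continuous_on_sequentially by (auto simp: comp_def)
  hence "(\<lambda>j. \<bar>f (x j) - f u\<bar>) \<longlonglongrightarrow> \<bar>f t - f u\<bar>" by (intro tendsto_intros)
  thus ?thesis by (rule LIMSEQ_le_const2) (use fx in auto)
qed

context gaussian_stationary_increments
begin

lemma increment_tail:
  assumes s: "0 \<le> s" and t: "0 \<le> t" and c: "0 < c"
  shows "prob {\<omega> \<in> space M. c < \<bar>Y t \<omega> - Y s \<omega>\<bar>} \<le> even_moment p * V \<bar>t - s\<bar> ^ p / c ^ (2 * p)"
proof -
  let ?A = "{\<omega> \<in> space M. c < \<bar>Y t \<omega> - Y s \<omega>\<bar>}"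
  have [measurable]: "Y s \<in> borel_measurable M" "Y t \<in> borel_measurable M" using s t by auto
  have A: "?A \<in> sets M" by measurable
  note i = increment_moment[OF s t, of p]
  have "prob ?A = expectation (indicator ?A)" using A by simp
  also have "\<dots> \<le> expectation (\<lambda>\<omega>. (Y t \<omega> - Y s \<omega>) ^ (2 * p) / c ^ (2 * p))"
  proof (rule integral_mono)
    show "integrable M (indicator ?A :: 'a \<Rightarrow> real)"
      by (rule integrable_const_bound[where B=1]) (use A in auto)
    show "integrable M (\<lambda>\<omega>. (Y t \<omega> - Y s \<omega>) ^ (2 * p) / c ^ (2 * p))"
      using i by (auto simp: has_bochner_integral_iff)
    fix \<omega>
    have "1 \<le> (Y t \<omega> - Y s \<omega>) ^ (2 * p) / c ^ (2 * p)" if "\<omega> \<in> ?A"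
    proof -
      have "c ^ (2 * p) \<le> \<bar>Y t \<omega> - Y s \<omega>\<bar> ^ (2 * p)" using that c by (intro power_mono) auto
      also have "\<dots> = (Y t \<omega> - Y s \<omega>) ^ (2 * p)" by (simp add: power_even_abs)
      finally show ?thesis using c by simp
    qed
    thus "indicator ?A \<omega> \<le> (Y t \<omega> - Y s \<omega>) ^ (2 * p) / c ^ (2 * p)"
      using c by (auto simp: indicator_def power_mult)
  qed
  also have "\<dots> = even_moment p * V \<bar>t - s\<bar> ^ p / c ^ (2 * p)"
    using i by (simp add: has_bochner_integral_iff)
  finally show ?thesis .
qed

text \<open>Markov's inequality on all dyadic increments. With \<open>r = 2\<^bsup>-K/2\<^esup>\<close> the increments of level \<open>j\<close> have
\<open>2p\<close>-th moment at most of order \<open>(\<delta> 2\<^bsup>-j\<^esup>)\<^bsup>2pK\<^esup>\<close>, and the \<open>2p\<close>-th power of the threshold is of order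
\<open>2\<^bsup>-jpK\<^esup>\<close>, which leaves \<open>\<delta>\<^bsup>2pK\<^esup> 2\<^bsup>-jpK\<^esup>\<close>; for \<open>p K \<ge> 2\<close> this beats the number \<open>2\<^sup>j\<close> of increments.\<close>

lemma oscillation_tail:
  assumes cont: "\<And>\<omega>. \<omega> \<in> space M \<Longrightarrow> continuous_on {0..} (\<lambda>t. Y t \<omega>)"
    and V: "\<And>t. 0 \<le> t \<Longrightarrow> t \<le> 1 \<Longrightarrow> V t \<le> c * t powr (2 * K)" and c: "0 \<le> c" and K: "0 < K"
    and p: "2 \<le> real p * K"
  shows "\<exists>C\<ge>0. \<forall>u\<ge>0. \<forall>\<delta>. 0 < \<delta> \<and> \<delta> \<le> 1 \<longrightarrow> (\<exists>E\<in>sets M. prob E \<le> C * \<delta> powr (2 * real p * K) \<and>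
     (\<forall>\<omega>\<in>space M - E. \<forall>t\<in>{u..u + \<delta>}. \<bar>Y t \<omega> - Y u \<omega>\<bar> \<le> 1))"
proof -
  define r :: real where "r = 2 powr (- K / 2)"
  have r: "0 < r" "r < 1" using K by (auto simp: r_def powr_less_one)
  define D where "D = even_moment p * c ^ p / (1 - r) ^ (2 * p)"
  have D0: "0 \<le> D" using c r even_moment_pos[of p] by (simp add: D_def)
  have main: "\<exists>E\<in>sets M. prob E \<le> (2 * D) * \<delta> powr (2 * real p * K) \<and>
     (\<forall>\<omega>\<in>space M - E. \<forall>t\<in>{u..u + \<delta>}. \<bar>Y t \<omega> - Y u \<omega>\<bar> \<le> 1)"
    if u: "0 \<le> u" and d: "0 < \<delta>" "\<delta> \<le> 1" for u \<delta>
  proof -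
    define B where "B j k = {\<omega> \<in> space M. (1 - r) * r ^ j <
       \<bar>Y (u + real (Suc k) * \<delta> / 2 ^ j) \<omega> - Y (u + real k * \<delta> / 2 ^ j) \<omega>\<bar>}" for j k :: nat
    have pos: "0 \<le> u + real k * \<delta> / 2 ^ j" for j k :: nat using u d by simp
    have [measurable]: "Y (u + real k * \<delta> / 2 ^ j) \<in> borel_measurable M" for k j :: nat
      using pos by (rule Y_measurable)
    have Bm: "B j k \<in> sets M" for j k unfolding B_def by measurable
    have PB: "prob (B j k) \<le> D * \<delta> powr (2 * real p * K) * (1 / 4) ^ j" for j k
    proof -
      have cj: "0 < (1 - r) * r ^ j" using r by simp
      have st: "\<bar>(u + real (Suc k) * \<delta> / 2 ^ j) - (u + real k * \<delta> / 2 ^ j)\<bar> = \<delta> / 2 ^ j"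
        using d by (simp add: field_simps)
      have dj: "0 \<le> \<delta> / 2 ^ j" "\<delta> / 2 ^ j \<le> 1"
      proof -
        have "\<delta> \<le> 1 * 1" using d by simp
        also have "\<dots> \<le> 1 * 2 ^ j" by (intro mult_left_mono) auto
        finally show "\<delta> / 2 ^ j \<le> 1" by simp
      qed (use d in auto)
      have "prob (B j k) \<le> even_moment p * V (\<delta> / 2 ^ j) ^ p / ((1 - r) * r ^ j) ^ (2 * p)"
        unfolding B_def using increment_tail[OF pos pos cj, of "Suc k" j k j p] unfolding st .
      also have "\<dots> \<le> even_moment p * (c * (\<delta> / 2 ^ j) powr (2 * K)) ^ p / ((1 - r) * r ^ j) ^ (2 * p)"
        using cj dj V[of "\<delta> / 2 ^ j"] even_moment_pos[of p] V_nonneg[OF dj(1)]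
        by (intro divide_right_mono mult_left_mono power_mono) auto
      also have "\<dots> = D * (((\<delta> / 2 ^ j) powr (2 * K)) ^ p / (r ^ j) ^ (2 * p))"
        by (simp add: D_def power_mult_distrib)
      also have "((\<delta> / 2 ^ j) powr (2 * K)) ^ p / (r ^ j) ^ (2 * p) = \<delta> powr (2 * real p * K) * 2 powr (- real p * K * real j)"
      proof -
        have "((\<delta> / 2 ^ j) powr (2 * K)) ^ p = (\<delta> / 2 powr real j) powr (2 * real p * K)"
          using d by (simp add: powr_power powr_realpow mult_ac)
        also have "\<dots> = \<delta> powr (2 * real p * K) / 2 powr (2 * real p * K * real j)"
          using d by (simp add: powr_divide powr_powr mult_ac)
        finally have 1: "((\<delta> / 2 ^ j) powr (2 * K)) ^ p = \<delta> powr (2 * real p * K) / 2 powr (2 * real p * K * real j)" .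
        have "(r ^ j) ^ (2 * p) = r powr (real j * real (2 * p))"
          using r by (simp add: powr_realpow[symmetric] powr_powr)
        also have "\<dots> = 2 powr (- real p * K * real j)"
          unfolding r_def powr_powr by (rule arg_cong[where f="\<lambda>x. 2 powr x"]) (simp add: field_simps)
        finally have 2: "(r ^ j) ^ (2 * p) = 2 powr (- real p * K * real j)" .
        have "1 / 2 powr (2 * real p * K * real j) = 2 powr (- real p * K * real j) * 2 powr (- real p * K * real j)"
          unfolding powr_add[symmetric] powr_minus_divide[symmetric] by (rule arg_cong[where f="\<lambda>x. 2 powr x"]) simp
        thus ?thesis unfolding 1 2 by (simp add: field_simps)
      qed
      also have "\<dots> \<le> \<delta> powr (2 * real p * K) * (1 / 4) ^ j"
      proof (rule mult_left_mono)
        have "2 * real j \<le> real p * K * real j" using p by (intro mult_right_mono) auto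
        hence "2 powr (- real p * K * real j) \<le> 2 powr (- 2 * real j)"
          by (intro powr_mono) auto
        also have "\<dots> = (1 / 4) ^ j"
        proof -
          have "2 powr (- 2 * real j) = (2 powr (-2)) powr real j" by (simp add: powr_powr)
          also have "(2::real) powr (-2) = 1 / 4" by (simp add: powr_minus_divide)
          finally show ?thesis by (simp add: powr_realpow)
        qed
        finally show "2 powr (- real p * K * real j) \<le> (1 / 4) ^ j" .
      qed simp
      finally show ?thesis using D0 by (simp add: mult.assoc mult_left_mono)
    qed
    define E where "E = (\<Union>j. \<Union>k\<in>{..<2 ^ j}. B j k)"
    have Em: "E \<in> sets M" unfolding E_def using Bm by auto
    have Pj: "prob (\<Union>k\<in>{..<2 ^ j}. B j k) \<le> D * \<delta> powr (2 * real p * K) * (1 / 2) ^ j" for j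
    proof -
      have "prob (\<Union>k\<in>{..<2 ^ j}. B j k) \<le> (\<Sum>k\<in>{..<2 ^ j}. prob (B j k))"
        using Bm by (intro finite_measure_subadditive_finite) auto
      also have "\<dots> \<le> (\<Sum>k\<in>{..<(2::nat) ^ j}. D * \<delta> powr (2 * real p * K) * (1 / 4) ^ j)"
        by (intro sum_mono PB)
      also have "\<dots> = D * \<delta> powr (2 * real p * K) * (2 ^ j * (1 / 4) ^ j)" by simp
      also have "(2::real) ^ j * (1 / 4) ^ j = (1 / 2) ^ j" by (simp add: power_mult_distrib[symmetric])
      finally show ?thesis .
    qed
    have geo: "(\<lambda>j. D * \<delta> powr (2 * real p * K) * (1 / 2) ^ j) sums (D * \<delta> powr (2 * real p * K) * 2)"
      using geometric_sums[of "1/2 :: real"] by (intro sums_mult) simp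
    have sm: "summable (\<lambda>j. prob (\<Union>k\<in>{..<2 ^ j}. B j k))"
      by (rule summable_comparison_test'[OF sums_summable[OF geo]]) (use Pj in auto)
    have "prob E \<le> (\<Sum>j. prob (\<Union>k\<in>{..<2 ^ j}. B j k))"
      unfolding E_def using Bm by (intro finite_measure_subadditive_countably sm) auto
    also have "\<dots> \<le> D * \<delta> powr (2 * real p * K) * 2"
      using suminf_le[OF Pj sm sums_summable[OF geo]] sums_unique[OF geo] by simp
    finally have "prob E \<le> (2 * D) * \<delta> powr (2 * real p * K)" by (simp add: mult_ac)
    moreover have "\<bar>Y t \<omega> - Y u \<omega>\<bar> \<le> 1" if \<omega>: "\<omega> \<in> space M - E" and t: "t \<in> {u..u + \<delta>}" for \<omega> t
    proof (rule dyadic_chaining[OF d(1) r _ _ t])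
      show "continuous_on {u..u + \<delta>} (\<lambda>t. Y t \<omega>)"
        using \<omega> u by (intro continuous_on_subset[OF cont]) auto
      fix j k :: nat assume "k < 2 ^ j"
      hence "\<omega> \<notin> B j k" using \<omega> unfolding E_def by auto
      thus "\<bar>Y (u + real (Suc k) * \<delta> / 2 ^ j) \<omega> - Y (u + real k * \<delta> / 2 ^ j) \<omega>\<bar> \<le> (1 - r) * r ^ j"
        using \<omega> unfolding B_def by auto
    qed
    ultimately show ?thesis using Em by blast
  qed
  show ?thesis using main D0 by (intro exI[of _ "2 * D"]) auto
qed

end

section \<open>The persistence exponent\<close>

lemma eventually_powr_dominates:
  fixes a b c :: real
  assumes "a < b"
  shows "eventually (\<lambda>T. c * T powr a \<le> T powr b) at_top"
proof -
  have "filterlim (\<lambda>T. T powr (b - a)) at_top (at_top :: real filter)"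
    using assms by real_asymp
  hence "eventually (\<lambda>T. c \<le> T powr (b - a)) at_top"
    by (simp add: filterlim_at_top)
  thus ?thesis
  proof (rule eventually_mono)
    fix T :: real assume "c \<le> T powr (b - a)"
    hence "c * T powr a \<le> T powr (b - a) * T powr a" by (intro mult_right_mono) auto
    thus "c * T powr a \<le> T powr b" by (simp add: powr_add[symmetric])
  qed
qed

text \<open>Bounds with an arbitrary loss \<open>\<epsilon>\<close> in the exponent suffice.\<close>

lemma has_decay_exponentI:
  assumes "\<And>\<epsilon>. 0 < \<epsilon> \<Longrightarrow> eventually (\<lambda>T. T powr (- \<theta> - \<epsilon>) \<le> f T) at_top"
    and "\<And>\<epsilon>. 0 < \<epsilon> \<Longrightarrow> eventually (\<lambda>T. f T \<le> T powr (- \<theta> + \<epsilon>)) at_top"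
  shows "has_decay_exponent f \<theta>"
  unfolding has_decay_exponent_def
proof
  show pos: "eventually (\<lambda>T. 0 < f T) at_top"
    using assms(1)[OF zero_less_one] eventually_gt_at_top[of 0]
    by eventually_elim (simp add: less_le_trans[rotated])
  show "((\<lambda>T. ln (f T) / ln T) \<longlongrightarrow> - \<theta>) at_top"
  proof (rule tendstoI)
    fix e :: real assume e: "0 < e"
    have "eventually (\<lambda>T. T powr (- \<theta> - e / 2) \<le> f T) at_top"
      "eventually (\<lambda>T. f T \<le> T powr (- \<theta> + e / 2)) at_top" using assms e by auto
    with pos eventually_gt_at_top[of 1]
    show "eventually (\<lambda>T. dist (ln (f T) / ln T) (- \<theta>) < e) at_top"
    proof eventually_elim
      case (elim T)
      have "ln (T powr (- \<theta> - e / 2)) \<le> ln (f T)"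
        by (rule ln_mono) (use elim in auto)
      moreover have "ln (f T) \<le> ln (T powr (- \<theta> + e / 2))"
        by (rule ln_mono) (use elim in auto)
      moreover have "ln (T powr y) = y * ln T" for y using elim by (simp add: ln_powr)
      ultimately have "(- \<theta> - e / 2) * ln T \<le> ln (f T)" "ln (f T) \<le> (- \<theta> + e / 2) * ln T"
        by metis+
      hence "- \<theta> - e / 2 \<le> ln (f T) / ln T" "ln (f T) / ln T \<le> - \<theta> + e / 2"
        using elim by (auto simp: field_simps)
      thus ?case using e unfolding dist_real_def abs_less_iff by auto
    qed
  qed
qed

text \<open>\<open>H\<close> governs the variance at large times and \<open>K\<close> its decay at small times.\<close>

locale continuous_gaussian_stationary_increments = gaussian_stationary_increments M G Y V
  for M :: "'a measure" and G Y V +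
  fixes H K A C :: real
  assumes HK: "0 < K" "K \<le> H" "H < 1" and A: "0 < A"
    and V_lower: "0 \<le> t \<Longrightarrow> A * t powr (2 * H) \<le> V t"
    and V_large: "1 \<le> t \<Longrightarrow> V t \<le> C * t powr (2 * H)"
    and V_small: "0 \<le> t \<Longrightarrow> t \<le> 1 \<Longrightarrow> V t \<le> C * t powr (2 * K)"
    and V_mono: "0 \<le> s \<Longrightarrow> s \<le> t \<Longrightarrow> V s \<le> V t"
    and cont: "\<omega> \<in> space M \<Longrightarrow> continuous_on {0..} (\<lambda>t. Y t \<omega>)"
begin

lemma C_pos: "0 < C"
  using V_lower[of 1] V_large[of 1] A by simp

text \<open>Truncation at \<open>s = T\<^bsup>H + e\<^esup>\<close>, slightly above the standard deviation at time \<open>T\<close>. The choice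
\<open>e (2p - 1) \<ge> 2\<close> makes the excess compensate up to \<open>4 T\<^sup>2 + 1\<close> mesh points, uniformly in the mesh.\<close>

lemma expected_max_growth:
  assumes e: "0 < e"
  shows "\<exists>D\<ge>0. \<forall>T \<delta> n. 1 \<le> T \<and> 0 \<le> \<delta> \<and> real n * \<delta> \<le> 2 * T \<and> real n \<le> 4 * T\<^sup>2 \<longrightarrow>
    expectation (running_max \<delta> n) \<le> D * T powr (H + e)"
proof -
  obtain p0 :: nat where p0: "2 / e \<le> real p0" using real_arch_simple by blast
  define p where "p = Suc p0"
  have p: "1 \<le> p" "2 \<le> e * real (2 * p - 1)"
  proof -
    have "2 \<le> e * real p0" using p0 e by (simp add: field_simps)
    also have "\<dots> \<le> e * real (2 * p - 1)" using e by (intro mult_left_mono) (auto simp: p_def)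
    finally show "2 \<le> e * real (2 * p - 1)" .
  qed (simp add: p_def)
  define D where "D = 1 + 5 * (even_moment p * (4 * C) ^ p)"
  have D0: "0 \<le> even_moment p * (4 * C) ^ p" using C_pos even_moment_pos[of p] by simp
  have "expectation (running_max \<delta> n) \<le> D * T powr (H + e)"
    if T: "1 \<le> T" and d: "0 \<le> \<delta>" and n: "real n * \<delta> \<le> 2 * T" "real n \<le> 4 * T\<^sup>2" for T \<delta> n
  proof -
    define s where "s = T powr (H + e)"
    define v where "v = (4 * C) * T powr (2 * H)"
    have s: "0 < s" using T by (simp add: s_def)
    have v: "V (real k * \<delta>) \<le> v" if "k \<le> n" for k
    proof -
      have "real k * \<delta> \<le> real n * \<delta>" using that d by (intro mult_right_mono) auto
      hence "V (real k * \<delta>) \<le> V (2 * T)" using n d by (intro V_mono) auto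
      also have "\<dots> \<le> C * (2 * T) powr (2 * H)" using T by (intro V_large) auto
      also have "\<dots> = C * (2 powr (2 * H) * T powr (2 * H))" using T by (simp add: powr_mult)
      also have "\<dots> \<le> C * (4 * T powr (2 * H))"
      proof -
        have "2 powr (2 * H) \<le> (2::real) powr 2" using HK by (intro powr_mono) auto
        thus ?thesis using C_pos by (intro mult_left_mono mult_right_mono) auto
      qed
      finally show ?thesis by (simp add: v_def)
    qed
    have "expectation (running_max \<delta> n) \<le> s + real (Suc n) * (even_moment p * v ^ p) / s ^ (2 * p - 1)"
      by (rule expected_max_upper[OF d s p(1) v])
    also have "v ^ p = (4 * C) ^ p * T powr (2 * H * real p)"
      using T by (simp add: v_def power_mult_distrib powr_power mult_ac)
    also have "s ^ (2 * p - 1) = T powr ((H + e) * real (2 * p - 1))"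
      using T by (simp add: s_def powr_power mult_ac)
    also have "real (Suc n) * (even_moment p * ((4 * C) ^ p * T powr (2 * H * real p))) / T powr ((H + e) * real (2 * p - 1))
      = real (Suc n) * (even_moment p * (4 * C) ^ p) * T powr (2 * H * real p - (H + e) * real (2 * p - 1))"
      by (simp add: powr_diff)
    also have "\<dots> \<le> (5 * T powr 2) * (even_moment p * (4 * C) ^ p) * T powr (H - 2)"
    proof (rule mult_mono[OF mult_right_mono])
      have "1 \<le> T\<^sup>2" using T by simp
      hence "real (Suc n) \<le> 5 * T\<^sup>2" using n by simp
      thus "real (Suc n) \<le> 5 * T powr 2" using T by (simp add: powr_numeral)
      have "real (2 * p - 1) = 2 * real p - 1" using p by (simp add: of_nat_diff)
      hence "2 * H * real p - (H + e) * real (2 * p - 1) = H - e * real (2 * p - 1)"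
        by (simp add: algebra_simps)
      also have "\<dots> \<le> H - 2" using p by simp
      finally show "T powr (2 * H * real p - (H + e) * real (2 * p - 1)) \<le> T powr (H - 2)"
        using T by (intro powr_mono) auto
    qed (use D0 T in auto)
    also have "\<dots> = 5 * (even_moment p * (4 * C) ^ p) * (T powr 2 * T powr (H - 2))"
      by (simp only: mult_ac)
    also have "T powr 2 * T powr (H - 2) = T powr H"
      unfolding powr_add[symmetric] by simp
    also have "5 * (even_moment p * (4 * C) ^ p) * T powr H \<le> 5 * (even_moment p * (4 * C) ^ p) * s"
      unfolding s_def using T e D0 by (intro mult_left_mono powr_mono) auto
    finally show ?thesis by (simp add: D_def s_def algebra_simps)
  qed
  thus ?thesis using D0 by (intro exI[of _ D]) (auto simp: D_def)
qed

text \<open>Continuity reduces the condition to a countable dense set of times.\<close>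

lemma persistence_event_measurable:
  assumes "0 \<le> T"
  shows "{\<omega> \<in> space M. \<forall>t\<in>{0..T}. -1 \<le> Y t \<omega>} \<in> sets M"
proof -
  obtain Q :: "real set" where Q: "countable Q" "Q \<subseteq> {0..T}" "{0..T} \<subseteq> closure Q"
    using separable[of "{0..T}"] by blast
  have "{\<omega> \<in> space M. \<forall>t\<in>{0..T}. -1 \<le> Y t \<omega>} = {\<omega> \<in> space M. \<forall>t\<in>Q. -1 \<le> Y t \<omega>}"
  proof (intro Collect_cong conj_cong refl iffI ballI)
    fix \<omega> t assume \<omega>: "\<omega> \<in> space M" "\<forall>t\<in>Q. -1 \<le> Y t \<omega>" and t: "t \<in> {0..T}"
    obtain x where x: "\<And>n. x n \<in> Q" "x \<longlonglongrightarrow> t"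
      using Q(3) t closure_sequential by blast
    have "0 \<le> x n" for n using x(1)[of n] Q(2) by auto
    hence "(\<lambda>n. Y (x n) \<omega>) \<longlonglongrightarrow> Y t \<omega>"
      using cont[OF \<omega>(1)] x Q(2) t unfolding continuous_on_sequentially by (auto simp: comp_def)
    thus "-1 \<le> Y t \<omega>" by (rule LIMSEQ_le_const) (use x \<omega> in auto)
  qed (use Q in auto)
  also have "\<dots> \<in> sets M"
  proof -
    have "{\<omega> \<in> space M. -1 \<le> Y t \<omega>} \<in> sets M" if "t \<in> Q" for t
    proof -
      have [measurable]: "Y t \<in> borel_measurable M" using that Q by (intro Y_measurable) auto
      show ?thesis by measurable
    qed
    moreover have "Q \<noteq> {}" using Q(3) assms by auto
    ultimately have "(\<Inter>t\<in>Q. {\<omega> \<in> space M. -1 \<le> Y t \<omega>}) \<in> sets M"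
      using Q(1) by (intro sets.countable_INT') auto
    moreover have "(\<Inter>t\<in>Q. {\<omega> \<in> space M. -1 \<le> Y t \<omega>}) = {\<omega> \<in> space M. \<forall>t\<in>Q. -1 \<le> Y t \<omega>}"
      using \<open>Q \<noteq> {}\<close> by auto
    ultimately show ?thesis by simp
  qed
  finally show ?thesis .
qed

text \<open>On the mesh \<open>1, \<dots>, n\<close> with \<open>n = \<lfloor>T\<rfloor>\<close>, raising the barrier to \<open>1\<close> costs a factor \<open>T\<^sup>e\<close>, and the probability
of staying above \<open>1\<close> is at most \<open>S n / n\<close>, which is of order \<open>T\<^bsup>H + e - 1\<^esup>\<close>.\<close>

lemma persistence_upper:
  assumes \<epsilon>: "0 < \<epsilon>"
  shows "eventually (\<lambda>T. prob {\<omega> \<in> space M. \<forall>t\<in>{0..T}. -1 \<le> Y t \<omega>} \<le> T powr (- (1 - H) + \<epsilon>)) at_top"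
proof -
  define e where "e = \<epsilon> / 3"
  have e: "0 < e" using \<epsilon> by (simp add: e_def)
  obtain m :: nat where m0: "1 / e \<le> real m" using real_arch_simple by blast
  have m: "1 \<le> e * real m" using m0 e by (simp add: field_simps)
  have V1: "0 < V 1" using V_lower[of 1] A by simp
  obtain B where B: "0 \<le> B" "\<And>n s. 1 \<le> n \<Longrightarrow> 0 < s \<Longrightarrow> prob {\<omega> \<in> space M. \<forall>k\<in>{1..n}. -1 \<le> Y (real k) \<omega>}
    \<le> s * prob {\<omega> \<in> space M. \<forall>k\<in>{1..n}. 1 \<le> Y (real k) \<omega>} + B / s ^ m"
    using prob_lift[OF V_mono V1, of m] by blast
  obtain D where D: "0 \<le> D" "\<And>T \<delta> n. 1 \<le> T \<Longrightarrow> 0 \<le> \<delta> \<Longrightarrow> real n * \<delta> \<le> 2 * T \<Longrightarrow> real n \<le> 4 * T\<^sup>2 \<Longrightarrow>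
    expectation (running_max \<delta> n) \<le> D * T powr (H + e)"
    using expected_max_growth[OF e] by blast
  have bound: "prob {\<omega> \<in> space M. \<forall>t\<in>{0..T}. -1 \<le> Y t \<omega>} \<le> (2 * D + B) * T powr (- (1 - H) + 2 * e)" if T: "1 \<le> T" for T
  proof -
    define n where "n = nat \<lfloor>T\<rfloor>"
    define s where "s = T powr e"
    have s: "0 < s" using T by (simp add: s_def)
    have n: "1 \<le> n" "real n \<le> T" "T \<le> 2 * real n"
    proof -
      show "1 \<le> n" unfolding n_def using T by (simp add: le_nat_iff le_floor_iff)
      show "real n \<le> T" unfolding n_def using T by (simp add: of_nat_nat)
      have "T < real n + 1" unfolding n_def using T by (simp add: of_nat_nat)
      with \<open>1 \<le> n\<close> show "T \<le> 2 * real n" by linarith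
    qed
    have [measurable]: "Y (real k) \<in> borel_measurable M" for k by simp
    have "prob {\<omega> \<in> space M. \<forall>t\<in>{0..T}. -1 \<le> Y t \<omega>} \<le> prob {\<omega> \<in> space M. \<forall>k\<in>{1..n}. -1 \<le> Y (real k) \<omega>}"
      using n(2) by (intro finite_measure_mono) auto
    also have "\<dots> \<le> s * prob {\<omega> \<in> space M. \<forall>k\<in>{1..n}. 1 \<le> Y (real k) \<omega>} + B / s ^ m"
      by (rule B(2)[OF n(1) s])
    also have "\<dots> \<le> s * (2 * D * T powr (H + e - 1)) + B * T powr (- 1)"
    proof (intro add_mono mult_left_mono)
      have "prob {\<omega> \<in> space M. \<forall>k\<in>{1..n}. 1 \<le> Y (real k) \<omega>} \<le> expectation (positive_min 1 n)"
        using prob_ge_1_le_expected_positive_min[of 1 n] n by simp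
      also have "\<dots> \<le> expectation (running_max 1 n) / real n"
        using expected_positive_min_upper[of 1 n] n by (simp add: field_simps)
      also have "\<dots> \<le> (D * T powr (H + e)) / (T / 2)"
      proof (rule frac_le)
        have "T \<le> T\<^sup>2" using T by (simp add: power2_eq_square)
        thus "expectation (running_max 1 n) \<le> D * T powr (H + e)"
          using n T by (intro D(2)) auto
      qed (use n T D(1) in auto)
      also have "\<dots> = 2 * D * T powr (H + e - 1)" using T by (simp add: powr_diff)
      finally show "prob {\<omega> \<in> space M. \<forall>k\<in>{1..n}. 1 \<le> Y (real k) \<omega>} \<le> 2 * D * T powr (H + e - 1)" .
      have "T powr 1 \<le> T powr (e * real m)" using m T by (intro powr_mono) auto
      hence "T \<le> s ^ m" using T by (simp add: s_def powr_power mult_ac)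
      hence "B / s ^ m \<le> B / T" using B(1) T s by (intro divide_left_mono) auto
      thus "B / s ^ m \<le> B * T powr (- 1)" using T by (simp add: powr_minus_divide)
    qed (use s in auto)
    also have "\<dots> \<le> 2 * D * T powr (- (1 - H) + 2 * e) + B * T powr (- (1 - H) + 2 * e)"
    proof (rule add_mono)
      show "s * (2 * D * T powr (H + e - 1)) \<le> 2 * D * T powr (- (1 - H) + 2 * e)"
      proof -
        have "T powr e * T powr (H + e - 1) = T powr (- (1 - H) + 2 * e)"
          by (simp add: powr_add[symmetric] algebra_simps)
        thus ?thesis unfolding s_def by (simp add: mult_ac)
      qed
      show "B * T powr (- 1) \<le> B * T powr (- (1 - H) + 2 * e)"
        using T HK e B(1) by (intro mult_left_mono powr_mono) auto
    qed
    finally show ?thesis by (simp add: distrib_right)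
  qed
  have "- (1 - H) + 2 * e < - (1 - H) + \<epsilon>" using \<epsilon> by (simp add: e_def)
  from eventually_powr_dominates[OF this, of "2 * D + B"] eventually_ge_at_top[of 1]
  show ?thesis
    by eventually_elim (use bound order.trans in blast)
qed

text \<open>The expected maximum at a time beyond \<open>T\<^bsup>1 + e\<^esup>\<close> outweighs that at time \<open>T\<close>, by the two
growth bounds. The difference is at most the number of steps times \<open>d n\<close>; with mesh
\<open>\<delta> = T\<^bsup>-e\<^esup>\<close> there are about \<open>T\<^bsup>1 + 2e\<^esup>\<close> steps, so \<open>d n\<close> is at least of order \<open>T\<^bsup>H - 1 - 2e\<^esup>\<close>. Passing from
\<open>d n\<close> to a probability costs another factor \<open>T\<^sup>e\<close>.\<close>

lemma mesh_persistence_lower: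
  assumes e: "0 < e" "e \<le> 1 / 4"
  shows "eventually (\<lambda>T. T powr (- (1 - H) - 3 * e) / 8 \<le>
    prob {\<omega> \<in> space M. \<forall>k\<in>{1..nat \<lceil>T powr (1 + e)\<rceil>}. 0 \<le> Y (real k * T powr (- e)) \<omega>}) at_top"
proof -
  define e' where "e' = e * H / 2"
  have e': "0 < e'" using e HK by (simp add: e'_def)
  obtain D where D: "0 \<le> D" "\<And>T \<delta> n. 1 \<le> T \<Longrightarrow> 0 \<le> \<delta> \<Longrightarrow> real n * \<delta> \<le> 2 * T \<Longrightarrow> real n \<le> 4 * T\<^sup>2 \<Longrightarrow>
    expectation (running_max \<delta> n) \<le> D * T powr (H + e')"
    using expected_max_growth[OF e'] by blast
  obtain p0 :: nat where p0: "2 / e \<le> real p0" using real_arch_simple by blast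
  define p where "p = Suc p0"
  have p: "1 \<le> p" "2 \<le> e * real (2 * p - 1)"
  proof -
    have "2 \<le> e * real p0" using p0 e by (simp add: field_simps)
    also have "\<dots> \<le> e * real (2 * p - 1)" using e by (intro mult_left_mono) (auto simp: p_def)
    finally show "2 \<le> e * real (2 * p - 1)" .
  qed (simp add: p_def)
  define B where "B = even_moment p * C ^ p"
  have B: "0 \<le> B" using even_moment_pos[of p] C_pos by (simp add: B_def)
  have "eventually (\<lambda>T. (6 / sqrt A) * T powr H \<le> T powr (H + e * H)) at_top"
    "eventually (\<lambda>T. (6 * D / sqrt A) * T powr (H + e') \<le> T powr (H + e * H)) at_top"
    "eventually (\<lambda>T. (8 * B) * T powr (- 2) \<le> T powr (- (1 - H) - 2 * e)) at_top"
    subgoal by (rule eventually_powr_dominates) (use e HK in auto)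
    subgoal by (rule eventually_powr_dominates) (use e HK in \<open>auto simp: e'_def\<close>)
    subgoal by (rule eventually_powr_dominates) (use e HK in auto)
    done
  with eventually_ge_at_top[of 1]
  show ?thesis
  proof eventually_elim
    case (elim T)
    note T = elim(1)
    define \<delta> where "\<delta> = T powr (- e)"
    define n where "n = nat \<lceil>T powr (1 + e)\<rceil>"
    \<comment> \<open>\<open>n\<close> steps of the mesh reach \<open>T\<close>, and \<open>N * n\<close> steps reach \<open>T powr (1 + e)\<close>\<close>
    define N where "N = nat \<lceil>T powr e\<rceil>"
    have d: "0 < \<delta>" "\<delta> \<le> 1" using T e powr_mono[of "- e" 0 T] by (auto simp: \<delta>_def)
    have Te: "1 \<le> T powr e" "1 \<le> T powr (1 + e)" using T e by (auto intro: ge_one_powr_ge_zero)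
    have n: "T powr (1 + e) \<le> real n" "real n \<le> 2 * T powr (1 + e)"
      using Te unfolding n_def by linarith+
    have N: "T powr e \<le> real N" "real N \<le> 2 * T powr e"
      using Te unfolding N_def by linarith+
    have n1: "1 \<le> n" using n Te by linarith
    have Td: "T powr (1 + e) * \<delta> = T" using T by (simp add: \<delta>_def powr_add[symmetric])
    have nd: "T \<le> real n * \<delta>" "real n * \<delta> \<le> 2 * T"
    proof -
      show "T \<le> real n * \<delta>" using mult_right_mono[OF n(1), of \<delta>] d Td by simp
      have "real n * \<delta> \<le> 2 * (T powr (1 + e) * \<delta>)"
        using mult_right_mono[OF n(2), of \<delta>] d by (simp add: mult.assoc)
      thus "real n * \<delta> \<le> 2 * T" unfolding Td .
    qed
    have nT: "real n \<le> 4 * T\<^sup>2"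
    proof -
      have "T powr (1 + e) \<le> T powr 2" using T e by (intro powr_mono) auto
      thus ?thesis using n T by (simp add: powr_numeral)
    qed
    have S2: "sqrt A * T powr (H + e * H) / 3 \<le> expectation (running_max \<delta> (n + N * n))"
    proof -
      have "T powr e * T \<le> real N * (real n * \<delta>)" using N nd T by (intro mult_mono) auto
      also have "\<dots> \<le> real (n + N * n) * \<delta>" using d by (simp add: algebra_simps)
      finally have t: "T powr (1 + e) \<le> real (n + N * n) * \<delta>" using T by (simp add: powr_add mult.commute)
      have "A * (T powr (1 + e)) powr (2 * H) \<le> A * (real (n + N * n) * \<delta>) powr (2 * H)"
        using t A HK by (intro mult_left_mono powr_mono2) auto
      also have "\<dots> \<le> V (real (n + N * n) * \<delta>)" using d by (intro V_lower) auto
      finally have "sqrt (A * (T powr (1 + e)) powr (2 * H)) \<le> sqrt (V (real (n + N * n) * \<delta>))"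
        by simp
      moreover have "sqrt (A * (T powr (1 + e)) powr (2 * H)) = sqrt A * T powr (H + e * H)"
      proof -
        have "(T powr (1 + e)) powr (2 * H) = (T powr (H + e * H)) powr 2"
          by (simp add: powr_powr algebra_simps)
        also have "\<dots> = (T powr (H + e * H))\<^sup>2" using T by (simp add: powr_numeral)
        finally show ?thesis by (simp add: real_sqrt_mult)
      qed
      ultimately show ?thesis using expected_max_lower[of \<delta> "n + N * n"] d by simp
    qed
    \<comment> \<open>the lower bound \<open>S2\<close> is spent half on \<open>T powr H\<close> and half on the upper bound for the expected maximum up to time \<open>2 * T\<close>\<close>
    have "T powr H \<le> sqrt A * T powr (H + e * H) / 6"
      using elim(2) A by (simp add: field_simps)
    moreover have "D * T powr (H + e') \<le> sqrt A * T powr (H + e * H) / 6"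
      using elim(3) A by (simp add: field_simps)
    moreover have "expectation (running_max \<delta> n) \<le> D * T powr (H + e')"
      using T d nd nT by (intro D(2)) auto
    ultimately have "T powr H \<le> expectation (running_max \<delta> (n + N * n)) - expectation (running_max \<delta> n)"
      using S2 by linarith
    also have "\<dots> \<le> real (N * n) * expectation (positive_min \<delta> n)"
      using d n1 by (intro expected_positive_min_lower) auto
    also have "\<dots> \<le> (4 * T powr (1 + 2 * e)) * expectation (positive_min \<delta> n)"
    proof (rule mult_right_mono)
      have "real N * real n \<le> (2 * T powr e) * (2 * T powr (1 + e))"
        using N n by (intro mult_mono) auto
      also have "\<dots> = 4 * T powr (1 + 2 * e)" by (simp add: powr_add[symmetric] algebra_simps)
      finally show "real (N * n) \<le> 4 * T powr (1 + 2 * e)" by simp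
    qed (simp add: positive_min_nonneg)
    finally have "T powr H / T powr (1 + 2 * e) \<le> 4 * expectation (positive_min \<delta> n)"
      using T by (simp add: field_simps)
    moreover have "H - (1 + 2 * e) = - (1 - H) - 2 * e" by simp
    ultimately have d_lower: "T powr (- (1 - H) - 2 * e) \<le> 4 * expectation (positive_min \<delta> n)"
      by (metis powr_diff)
    define P where "P = prob {\<omega> \<in> space M. \<forall>k\<in>{1..n}. 0 \<le> Y (real k * \<delta>) \<omega>}"
    have "expectation (positive_min \<delta> n) \<le> T powr e * P + even_moment p * V \<delta> ^ p / (T powr e) ^ (2 * p - 1)"
      unfolding P_def using d n1 T p by (intro expected_positive_min_le_prob) auto
    also have "\<dots> \<le> T powr e * P + B * T powr (- 2)"
    proof (rule add_left_mono)
      have "V \<delta> \<le> C * \<delta> powr (2 * K)" using d by (intro V_small) auto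
      also have "\<dots> \<le> C * 1" using d HK C_pos by (intro mult_left_mono powr_le1) auto
      finally have "even_moment p * V \<delta> ^ p \<le> B"
        unfolding B_def using even_moment_pos[of p] V_nonneg[of \<delta>] d
        by (intro mult_left_mono power_mono) auto
      moreover have "T powr 2 \<le> (T powr e) ^ (2 * p - 1)"
      proof -
        have "T powr 2 \<le> T powr (e * real (2 * p - 1))" using p T by (intro powr_mono) auto
        thus ?thesis using T by (simp add: powr_power mult_ac)
      qed
      ultimately have "even_moment p * V \<delta> ^ p / (T powr e) ^ (2 * p - 1) \<le> B / T powr 2"
        using T B by (intro frac_le) auto
      thus "even_moment p * V \<delta> ^ p / (T powr e) ^ (2 * p - 1) \<le> B * T powr (- 2)"
        by (simp add: powr_minus_divide)
    qed
    finally have "T powr (- (1 - H) - 2 * e) / 8 \<le> T powr e * P"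
      using d_lower elim(4) by linarith
    hence "T powr (- e) * (T powr (- (1 - H) - 2 * e) / 8) \<le> T powr (- e) * (T powr e * P)"
      by (intro mult_left_mono) auto
    also have "\<dots> = P" using T by (simp add: mult.assoc[symmetric] powr_add[symmetric])
    also have "T powr (- e) * (T powr (- (1 - H) - 2 * e) / 8) = T powr (- (1 - H) - 3 * e) / 8"
      by (simp add: powr_add[symmetric])
    finally show ?case unfolding P_def n_def \<delta>_def .
  qed
qed

text \<open>If \<open>Y \<ge> 0\<close> at all mesh points and \<open>Y\<close> moves by at most \<open>1\<close> on each mesh interval, then \<open>Y \<ge> -1\<close> on
\<open>[0, T]\<close>. With \<open>2 \<le> e p K\<close> the exceptional events together have probability of order \<open>T\<^bsup>-2\<^esup>\<close>, which is
negligible against \<open>T\<^bsup>H - 1 - 3e\<^esup>\<close>. The mesh point \<open>0\<close> is covered by \<open>Y 0 = 0\<close> almost surely.\<close>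

lemma persistence_lower:
  assumes \<epsilon>: "0 < \<epsilon>"
  shows "eventually (\<lambda>T. T powr (- (1 - H) - \<epsilon>) \<le> prob {\<omega> \<in> space M. \<forall>t\<in>{0..T}. -1 \<le> Y t \<omega>}) at_top"
proof -
  define e where "e = min (1 / 4) (\<epsilon> / 4)"
  have e: "0 < e" "e \<le> 1 / 4" "4 * e \<le> \<epsilon>" using \<epsilon> by (auto simp: e_def)
  obtain p :: nat where p0: "2 / (e * K) \<le> real p" using real_arch_simple by blast
  have p: "2 \<le> e * (real p * K)" using p0 e HK by (simp add: field_simps)
  have p': "2 \<le> real p * K"
  proof -
    have "e * (real p * K) \<le> 1 * (real p * K)" using e HK by (intro mult_right_mono) auto
    thus ?thesis using p by simp
  qed
  obtain B where B: "0 \<le> B" "\<And>u \<delta>. 0 \<le> u \<Longrightarrow> 0 < \<delta> \<Longrightarrow> \<delta> \<le> 1 \<Longrightarrow> (\<exists>E\<in>sets M. prob E \<le> B * \<delta> powr (2 * real p * K) \<and>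
     (\<forall>\<omega>\<in>space M - E. \<forall>t\<in>{u..u + \<delta>}. \<bar>Y t \<omega> - Y u \<omega>\<bar> \<le> 1))"
    using oscillation_tail[OF cont V_small _ HK(1) p'] C_pos by (auto simp del: atLeastAtMost_iff)
  have "eventually (\<lambda>T. 8 * T powr (- (1 - H) - 4 * e) \<le> T powr (- (1 - H) - 3 * e) / 2) at_top"
  proof -
    have "eventually (\<lambda>T. 16 * T powr (- (1 - H) - 4 * e) \<le> T powr (- (1 - H) - 3 * e)) at_top"
      by (rule eventually_powr_dominates) (use e in auto)
    thus ?thesis by (rule eventually_mono) auto
  qed
  moreover have "eventually (\<lambda>T. 32 * B * T powr (- 2) \<le> T powr (- (1 - H) - 3 * e)) at_top"
    by (rule eventually_powr_dominates) (use e HK in auto)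
  ultimately show ?thesis
    using mesh_persistence_lower[OF e(1,2)] eventually_ge_at_top[of 1]
  proof eventually_elim
    case (elim T)
    note T = elim(4)
    define \<delta> where "\<delta> = T powr (- e)"
    define n where "n = nat \<lceil>T powr (1 + e)\<rceil>"
    have d: "0 < \<delta>" "\<delta> \<le> 1" using T e powr_mono[of "- e" 0 T] by (auto simp: \<delta>_def)
    have Te: "1 \<le> T powr (1 + e)" using T e by (auto intro: ge_one_powr_ge_zero)
    have n: "T powr (1 + e) \<le> real n" "real n \<le> 2 * T powr (1 + e)"
      using Te unfolding n_def by linarith+
    have nd: "T \<le> real n * \<delta>"
    proof -
      have "T powr (1 + e) * \<delta> = T" using T by (simp add: \<delta>_def powr_add[symmetric])
      thus ?thesis using mult_right_mono[OF n(1), of \<delta>] d by simp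
    qed
    have "\<exists>E\<in>sets M. prob E \<le> B * \<delta> powr (2 * real p * K) \<and>
     (\<forall>\<omega>\<in>space M - E. \<forall>t\<in>{real k * \<delta>..real k * \<delta> + \<delta>}. \<bar>Y t \<omega> - Y (real k * \<delta>) \<omega>\<bar> \<le> 1)" for k
      using d by (intro B(2)) auto
    then obtain E where E: "\<And>k. E k \<in> sets M" "\<And>k. prob (E k) \<le> B * \<delta> powr (2 * real p * K)"
      "\<And>k \<omega> t. \<omega> \<in> space M - E k \<Longrightarrow> t \<in> {real k * \<delta>..real k * \<delta> + \<delta>} \<Longrightarrow> \<bar>Y t \<omega> - Y (real k * \<delta>) \<omega>\<bar> \<le> 1"
      by metis
    define Q where "Q = {\<omega> \<in> space M. \<forall>k\<in>{1..n}. 0 \<le> Y (real k * \<delta>) \<omega>}"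
    define Z where "Z = {\<omega> \<in> space M. Y 0 \<omega> \<noteq> 0}"
    define F where "F = {\<omega> \<in> space M. \<forall>t\<in>{0..T}. -1 \<le> Y t \<omega>}"
    define U where "U = (\<Union>k\<in>{..<n}. E k)"
    have [measurable]: "Y (real k * \<delta>) \<in> borel_measurable M" "Y 0 \<in> borel_measurable M" for k using d by simp_all
    have ms: "Q \<in> sets M" "Z \<in> sets M" "F \<in> sets M" "U \<in> sets M"
      using persistence_event_measurable[of T] T E(1) by (auto simp: Q_def Z_def F_def U_def)
    have Z0: "prob Z = 0"
    proof -
      have "AE \<omega> in M. (Y 0 \<omega>)\<^sup>2 = 0"
        using integral_nonneg_eq_0_iff_AE[OF gaussian_space_integrable_square[OF G YG[of 0]]] second_moment[of 0] V0 by simp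
      hence "AE \<omega> in M. \<omega> \<notin> Z" by eventually_elim (simp add: Z_def)
      thus ?thesis using ms by (simp add: prob_eq_0)
    qed
    have sub: "Q \<subseteq> F \<union> Z \<union> U"
    proof
      fix \<omega> assume \<omega>: "\<omega> \<in> Q"
      show "\<omega> \<in> F \<union> Z \<union> U"
      proof (rule ccontr)
        assume no: "\<omega> \<notin> F \<union> Z \<union> U"
        have \<omega>M: "\<omega> \<in> space M" using \<omega> by (simp add: Q_def)
        have "-1 \<le> Y t \<omega>" if t: "t \<in> {0..T}" for t
        \<comment> \<open>the right endpoint of the last mesh interval belongs to no interval \<open>[k\<delta>, (k + 1)\<delta>)\<close> with \<open>k < n\<close>\<close>
        proof (cases "t = T \<and> T = real n * \<delta>")
          case True
          have "n \<in> {1..n}" using n Te by auto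
          hence "0 \<le> Y (real n * \<delta>) \<omega>" using \<omega> unfolding Q_def by blast
          thus ?thesis using True by simp
        next
          case False
          define k where "k = nat \<lfloor>t / \<delta>\<rfloor>"
          have k: "real k \<le> t / \<delta>" "t / \<delta> < real k + 1"
            using t d unfolding k_def by (auto simp: of_nat_nat)
          have k1: "real k * \<delta> \<le> t" "t < real k * \<delta> + \<delta>" using k d by (auto simp: field_simps)
          have "t < real n * \<delta>" using nd t False by (cases "t = T") auto
          with k1(1) have "real k * \<delta> < real n * \<delta>" by linarith
          hence kn: "k < n" using d by simp
          have "0 \<le> Y (real k * \<delta>) \<omega>"
          proof (cases "k = 0")
            case True
            thus ?thesis using no \<omega>M by (simp add: Z_def)
          next
            case False
            thus ?thesis using \<omega> kn unfolding Q_def by auto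
          qed
          moreover have "\<bar>Y t \<omega> - Y (real k * \<delta>) \<omega>\<bar> \<le> 1"
            using no \<omega>M kn k1 by (intro E(3)) (auto simp: U_def)
          ultimately show ?thesis by linarith
        qed
        thus False using no \<omega>M by (auto simp: F_def)
      qed
    qed
    have "prob Q \<le> prob (F \<union> Z \<union> U)" by (rule finite_measure_mono[OF sub]) (use ms in auto)
    also have "\<dots> \<le> prob (F \<union> Z) + prob U" using ms by (intro measure_Un_le) auto
    also have "\<dots> \<le> prob F + prob Z + prob U" using ms by (intro add_right_mono measure_Un_le) auto
    also have "prob U \<le> (\<Sum>k\<in>{..<n}. prob (E k))"
      unfolding U_def using E(1) by (intro finite_measure_subadditive_finite) auto
    also have "\<dots> \<le> (\<Sum>k\<in>{..<n}. B * \<delta> powr (2 * real p * K))" by (intro sum_mono E(2))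
    also have "\<dots> = real n * (B * \<delta> powr (2 * real p * K))" by simp
    also have "\<dots> \<le> (2 * T powr 2) * (B * T powr (- 4))"
    proof (intro mult_mono mult_left_mono)
      have "T powr (1 + e) \<le> T powr 2" using T e by (intro powr_mono) auto
      thus "real n \<le> 2 * T powr 2" using n by linarith
      have "\<delta> powr (2 * real p * K) = T powr (- (2 * (e * (real p * K))))"
        by (simp add: \<delta>_def powr_powr mult_ac)
      also have "\<dots> \<le> T powr (- 4)" using T p by (intro powr_mono) (auto simp: mult_ac)
      finally show "\<delta> powr (2 * real p * K) \<le> T powr (- 4)" .
    qed (use B T in auto)
    also have "\<dots> = 2 * B * T powr (- 2)"
    proof -
      have "T powr 2 * T powr (- 4) = T powr (- 2)" unfolding powr_add[symmetric] by simp
      thus ?thesis by (simp add: mult_ac)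
    qed
    finally have "prob Q \<le> prob F + 2 * B * T powr (- 2)" using Z0 by simp
    moreover have "T powr (- (1 - H) - 3 * e) / 8 \<le> prob Q"
      using elim(3) unfolding Q_def n_def \<delta>_def .
    moreover have "T powr (- (1 - H) - \<epsilon>) \<le> T powr (- (1 - H) - 4 * e)"
      using T e by (intro powr_mono) auto
    ultimately have "T powr (- (1 - H) - \<epsilon>) \<le> prob F" using elim(1,2) by linarith
    thus ?case unfolding F_def .
  qed
qed

theorem persistence_exponent:
  "has_decay_exponent (\<lambda>T. prob {\<omega> \<in> space M. \<forall>t\<in>{0..T}. -1 \<le> Y t \<omega>}) (1 - H)"
  by (rule has_decay_exponentI) (use persistence_lower persistence_upper in auto)

end

section \<open>Mixed fractional Brownian motion\<close>

context prob_space
begin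

lemma fbm_measurable:
  "fractional_brownian_motion H B \<Longrightarrow> 0 \<le> t \<Longrightarrow> B t \<in> borel_measurable M"
  by (auto simp: fractional_brownian_motion_def gaussian_process_def)

lemma normal_law_integrals:
  assumes Z[measurable]: "Z \<in> borel_measurable M" and law: "distr M borel Z = normal_law \<mu> \<sigma>" and \<sigma>: "0 \<le> \<sigma>"
  shows "has_bochner_integral M Z \<mu>" and "has_bochner_integral M (\<lambda>\<omega>. (Z \<omega> - \<mu>)\<^sup>2) (\<sigma>\<^sup>2)"
proof -
  note * = has_bochner_integral_law[OF Z, unfolded law]
  have "has_bochner_integral M (\<lambda>\<omega>. (Z \<omega> - \<mu>) + \<mu>) (0 + \<mu>)"
    using *[OF normal_law_has_moment(3)[OF \<sigma>, of \<mu>]]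
    by (intro has_bochner_integral_add) (auto simp: has_bochner_integral_iff prob_space)
  thus "has_bochner_integral M Z \<mu>" by simp
  show "has_bochner_integral M (\<lambda>\<omega>. (Z \<omega> - \<mu>)\<^sup>2) (\<sigma>\<^sup>2)"
    using *[OF normal_law_has_moment(1)[OF \<sigma>, of \<mu> 1]] even_moment_1 by simp
qed

lemma fbm_mean:
  assumes B: "fractional_brownian_motion H B" and t: "0 \<le> t"
  shows "has_bochner_integral M (B t) 0"
proof -
  have g: "gaussian_process {0..} B" "expectation (B t) = 0"
    using B t by (auto simp: fractional_brownian_motion_def)
  hence "\<exists>\<mu> \<sigma>. 0 \<le> \<sigma> \<and> distr M borel (\<lambda>\<omega>. \<Sum>s\<in>{t}. 1 * B s \<omega>) = normal_law \<mu> \<sigma>"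
    using t unfolding gaussian_process_def by (elim conjE allE[of _ "{t}"] allE[of _ "\<lambda>_. 1"]) auto
  then obtain \<mu> \<sigma> where "0 \<le> \<sigma>" "distr M borel (B t) = normal_law \<mu> \<sigma>" by auto
  from normal_law_integrals(1)[OF fbm_measurable[OF B t] this(2,1)] g(2)
  show ?thesis by (simp add: has_bochner_integral_iff)
qed

text \<open>Gaussianity leaves the mean and the standard deviation of each linear combination open; the
vanishing means and the second moment identify them.\<close>

lemma fbm_linear_combination:
  fixes c :: "real \<Rightarrow> real"
  assumes B: "fractional_brownian_motion H B" and F: "finite F" "F \<subseteq> {0..}"
  defines "Z \<equiv> \<lambda>\<omega>. \<Sum>t\<in>F. c t * B t \<omega>"
  shows "Z \<in> borel_measurable M" and "has_bochner_integral M Z 0"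
    and "distr M borel Z = normal_law 0 (sqrt (expectation (\<lambda>\<omega>. (Z \<omega>)\<^sup>2)))"
    and "integrable M (\<lambda>\<omega>. (Z \<omega>)\<^sup>2)"
proof -
  show Zm: "Z \<in> borel_measurable M"
    unfolding Z_def using F fbm_measurable[OF B] by (intro borel_measurable_sum borel_measurable_times) auto
  have "has_bochner_integral M Z (\<Sum>t\<in>F. c t * 0)"
    unfolding Z_def using F by (intro has_bochner_integral_sum has_bochner_integral_mult_right fbm_mean[OF B]) auto
  thus Z0: "has_bochner_integral M Z 0" by simp
  have "gaussian_process {0..} B" using B by (auto simp: fractional_brownian_motion_def)
  hence "\<exists>\<mu> \<sigma>. 0 \<le> \<sigma> \<and> distr M borel Z = normal_law \<mu> \<sigma>"
    using F unfolding gaussian_process_def Z_def by blast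
  then obtain \<mu> \<sigma> where \<sigma>: "0 \<le> \<sigma>" and law: "distr M borel Z = normal_law \<mu> \<sigma>" by blast
  note i = normal_law_integrals[OF Zm law \<sigma>]
  have "\<mu> = 0" using i(1) Z0 by (simp add: has_bochner_integral_iff)
  with i(2) have "has_bochner_integral M (\<lambda>\<omega>. (Z \<omega>)\<^sup>2) (\<sigma>\<^sup>2)" by simp
  thus "distr M borel Z = normal_law 0 (sqrt (expectation (\<lambda>\<omega>. (Z \<omega>)\<^sup>2)))" "integrable M (\<lambda>\<omega>. (Z \<omega>)\<^sup>2)"
    using law \<open>\<mu> = 0\<close> \<sigma> by (auto simp: has_bochner_integral_iff)
qed

lemma fbm_covariance:
  assumes B: "fractional_brownian_motion H B" and "0 \<le> s" "0 \<le> t"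
  shows "expectation (\<lambda>\<omega>. B s \<omega> * B t \<omega>) = (t powr (2 * H) + s powr (2 * H) - \<bar>t - s\<bar> powr (2 * H)) / 2"
proof -
  have "expectation (B s) = 0" "expectation (B t) = 0" 
    "covariance (B s) (B t) = (t powr (2 * H) + s powr (2 * H) - \<bar>t - s\<bar> powr (2 * H)) / 2"
    using assms by (auto simp: fractional_brownian_motion_def)
  thus ?thesis by (simp add: covariance_def)
qed

lemma indep_processes_linear_combinations:
  assumes "indep_processes X Y" "finite F" "F \<subseteq> {0..}" "finite F'" "F' \<subseteq> {0..}"
  shows "indep_var borel (\<lambda>\<omega>. \<Sum>t\<in>F. c t * X t \<omega>) borel (\<lambda>\<omega>. \<Sum>t\<in>F'. d t * Y t \<omega>)"
proof -
  have m: "(\<lambda>x. \<Sum>t\<in>F. c t * x t) \<in> borel_measurable (Pi\<^sub>M {0..} (\<lambda>_. borel))"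
    if "F \<subseteq> {0..}" for F and c :: "real \<Rightarrow> real"
    using that by (intro borel_measurable_sum borel_measurable_times measurable_component_singleton) auto
  have eq: "(\<lambda>x. \<Sum>t\<in>F. c t * x t) \<circ> (\<lambda>\<omega>. \<lambda>t\<in>{0..}. X t \<omega>) = (\<lambda>\<omega>. \<Sum>t\<in>F. c t * X t \<omega>)"
    if "F \<subseteq> {0..}" for F and c :: "real \<Rightarrow> real" and X :: "real \<Rightarrow> 'a \<Rightarrow> real"
  proof
    fix \<omega> show "((\<lambda>x. \<Sum>t\<in>F. c t * x t) \<circ> (\<lambda>\<omega>. \<lambda>t\<in>{0..}. X t \<omega>)) \<omega> = (\<Sum>t\<in>F. c t * X t \<omega>)"
      unfolding comp_def using that by (intro sum.cong) auto
  qed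
  from indep_var_compose[OF assms(1)[unfolded indep_processes_def] m[OF assms(3), of c] m[OF assms(5), of d]]
  show ?thesis unfolding eq[OF assms(3)] eq[OF assms(5)] .
qed

lemma indep_processes_sym:
  assumes "indep_processes X Y" shows "indep_processes Y X"
proof -
  have "indep_set B A" if "indep_set A B" for A B
    using that unfolding indep_sets2_eq by (metis Int_commute mult.commute)
  with assms show ?thesis unfolding indep_processes_def indep_var_eq by blast
qed

text \<open>A linear combination of the mixture is the sum of one for \<open>X\<close> and one for \<open>Y\<close>, which are
independent centred normal variables.\<close>

proposition mixed_fbm_gaussian_space:
  assumes X: "fractional_brownian_motion H X" and Y: "fractional_brownian_motion K Y"
    and ind: "indep_processes X Y"
  shows "gaussian_space M {Z. \<exists>F c. finite F \<and> F \<subseteq> {0..} \<and> Z = (\<lambda>\<omega>. \<Sum>t\<in>F. c t * (a * X t \<omega> + b * Y t \<omega>))}"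
    (is "gaussian_space M ?G")
  unfolding gaussian_space_def
proof (intro conjI ballI allI)
  show "(\<lambda>_. 0) \<in> ?G" by (auto intro!: exI[of _ "{}"])
next
  fix Z assume "Z \<in> ?G"
  then obtain F c where F: "finite F" "F \<subseteq> {0..}" and Z: "Z = (\<lambda>\<omega>. \<Sum>t\<in>F. c t * (a * X t \<omega> + b * Y t \<omega>))" by auto
  define Z1 where "Z1 \<omega> = (\<Sum>t\<in>F. (c t * a) * X t \<omega>)" for \<omega>
  define Z2 where "Z2 \<omega> = (\<Sum>t\<in>F. (c t * b) * Y t \<omega>)" for \<omega>
  have Zs: "Z = (\<lambda>\<omega>. Z1 \<omega> + Z2 \<omega>)"
    by (auto simp: Z Z1_def Z2_def sum.distrib[symmetric] algebra_simps)
  note l1 = fbm_linear_combination[OF X F, where c="\<lambda>t. c t * a", folded Z1_def]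
  note l2 = fbm_linear_combination[OF Y F, where c="\<lambda>t. c t * b", folded Z2_def]
  have i12: "indep_var borel Z1 borel Z2"
    unfolding Z1_def[abs_def] Z2_def[abs_def] by (rule indep_processes_linear_combinations[OF ind F F])
  have cross: "integrable M (\<lambda>\<omega>. Z1 \<omega> * Z2 \<omega>)" "expectation (\<lambda>\<omega>. Z1 \<omega> * Z2 \<omega>) = 0"
    using indep_var_lebesgue_integral[OF i12] indep_var_integrable[OF i12] l1(2) l2(2)
    by (auto simp: has_bochner_integral_iff)
  show "Z \<in> borel_measurable M" unfolding Zs using l1(1) l2(1) by simp
  have "(\<lambda>\<omega>. (Z \<omega>)\<^sup>2) = (\<lambda>\<omega>. (Z1 \<omega>)\<^sup>2 + (Z2 \<omega>)\<^sup>2 + 2 * (Z1 \<omega> * Z2 \<omega>))"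
    by (auto simp: Zs power2_eq_square algebra_simps)
  hence "expectation (\<lambda>\<omega>. (Z \<omega>)\<^sup>2) = expectation (\<lambda>\<omega>. (Z1 \<omega>)\<^sup>2) + expectation (\<lambda>\<omega>. (Z2 \<omega>)\<^sup>2)"
    using l1(4) l2(4) cross by simp
  thus "distr M borel Z = normal_law 0 (sqrt (expectation (\<lambda>\<omega>. (Z \<omega>)\<^sup>2)))"
    using normal_law_indep_add[OF i12 _ _ l1(3) l2(3)] by (simp add: Zs)
next
  fix Z1 Z2 and p q :: real assume "Z1 \<in> ?G" "Z2 \<in> ?G"
  then obtain F1 c1 F2 c2 where F: "finite F1" "F1 \<subseteq> {0..}" "finite F2" "F2 \<subseteq> {0..}"
    and Z: "Z1 = (\<lambda>\<omega>. \<Sum>t\<in>F1. c1 t * (a * X t \<omega> + b * Y t \<omega>))" "Z2 = (\<lambda>\<omega>. \<Sum>t\<in>F2. c2 t * (a * X t \<omega> + b * Y t \<omega>))"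
    by auto
  define d where "d t = p * (if t \<in> F1 then c1 t else 0) + q * (if t \<in> F2 then c2 t else 0)" for t
  have ext: "(\<Sum>t\<in>F. c t * f t) = (\<Sum>t\<in>F1 \<union> F2. (if t \<in> F then c t else 0) * f t)"
    if "F \<subseteq> F1 \<union> F2" for F and c f :: "real \<Rightarrow> real"
    using F that by (intro sum.mono_neutral_cong_left) auto
  have "(\<lambda>\<omega>. p * Z1 \<omega> + q * Z2 \<omega>) = (\<lambda>\<omega>. \<Sum>t\<in>F1 \<union> F2. d t * (a * X t \<omega> + b * Y t \<omega>))"
  proof
    fix \<omega>
    show "p * Z1 \<omega> + q * Z2 \<omega> = (\<Sum>t\<in>F1 \<union> F2. d t * (a * X t \<omega> + b * Y t \<omega>))"
      unfolding Z ext[of F1, OF Un_upper1] ext[of F2, OF Un_upper2] sum_distrib_left sum.distrib[symmetric]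
      by (intro sum.cong refl) (simp add: d_def distrib_right mult.assoc)
  qed
  thus "(\<lambda>\<omega>. p * Z1 \<omega> + q * Z2 \<omega>) \<in> ?G"
    using F by (intro CollectI exI[of _ "F1 \<union> F2"] exI[of _ d]) auto
qed

proposition mixed_fbm_covariance:
  fixes a b :: real
  assumes X: "fractional_brownian_motion H X" and Y: "fractional_brownian_motion K Y"
    and ind: "indep_processes X Y" and s: "0 \<le> s" and t: "0 \<le> t"
  defines "V \<equiv> \<lambda>t. a\<^sup>2 * t powr (2 * H) + b\<^sup>2 * t powr (2 * K)"
  shows "expectation (\<lambda>\<omega>. (a * X s \<omega> + b * Y s \<omega>) * (a * X t \<omega> + b * Y t \<omega>)) = (V s + V t - V \<bar>s - t\<bar>) / 2"
proof -
  have cross: "integrable M (\<lambda>\<omega>. X u \<omega> * Y v \<omega>)" "expectation (\<lambda>\<omega>. X u \<omega> * Y v \<omega>) = 0" if "0 \<le> u" "0 \<le> v" for u v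
  proof -
    have "indep_var borel (X u) borel (Y v)"
      using indep_processes_linear_combinations[OF ind, of "{u}" "{v}" "\<lambda>_. 1" "\<lambda>_. 1"] that by simp
    with indep_var_lebesgue_integral[of "X u" "Y v"] indep_var_integrable[of "X u" "Y v"] fbm_mean[OF X that(1)] fbm_mean[OF Y that(2)]
    show "integrable M (\<lambda>\<omega>. X u \<omega> * Y v \<omega>)" "expectation (\<lambda>\<omega>. X u \<omega> * Y v \<omega>) = 0"
      by (auto simp: has_bochner_integral_iff)
  qed
  have sq: "integrable M (\<lambda>\<omega>. B s \<omega> * B t \<omega>)" if B: "fractional_brownian_motion L B" for L B
  proof -
    have i: "integrable M (\<lambda>\<omega>. (\<Sum>u\<in>F. c u * B u \<omega>)\<^sup>2)" if "finite F" "F \<subseteq> {0..}" for F c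
      by (rule fbm_linear_combination(4)[OF B that])
    have 1: "integrable M (\<lambda>\<omega>. (B u \<omega>)\<^sup>2)" if "0 \<le> u" for u
      using i[of "{u}" "\<lambda>_. 1"] that by simp
    have [measurable]: "B s \<in> borel_measurable M" "B t \<in> borel_measurable M"
      using fbm_measurable[OF B] s t by auto
    show ?thesis
    proof (rule Bochner_Integration.integrable_bound)
      show "integrable M (\<lambda>\<omega>. (B s \<omega>)\<^sup>2 + (B t \<omega>)\<^sup>2)" using 1 s t by simp
      show "AE \<omega> in M. norm (B s \<omega> * B t \<omega>) \<le> norm ((B s \<omega>)\<^sup>2 + (B t \<omega>)\<^sup>2)"
        by (rule AE_I2) (rule norm_mult_le_sum_squares)
    qed measurable
  qed
  have "(\<lambda>\<omega>. (a * X s \<omega> + b * Y s \<omega>) * (a * X t \<omega> + b * Y t \<omega>)) =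
    (\<lambda>\<omega>. a\<^sup>2 * (X s \<omega> * X t \<omega>) + b\<^sup>2 * (Y s \<omega> * Y t \<omega>) + (a * b) * (X s \<omega> * Y t \<omega>) + (a * b) * (X t \<omega> * Y s \<omega>))"
    by (auto simp: power2_eq_square algebra_simps)
  hence "expectation (\<lambda>\<omega>. (a * X s \<omega> + b * Y s \<omega>) * (a * X t \<omega> + b * Y t \<omega>)) = 
    a\<^sup>2 * expectation (\<lambda>\<omega>. X s \<omega> * X t \<omega>) + b\<^sup>2 * expectation (\<lambda>\<omega>. Y s \<omega> * Y t \<omega>)"
    using sq[OF X] sq[OF Y] cross s t by simp
  also have "\<dots> = (V s + V t - V \<bar>s - t\<bar>) / 2"
    unfolding fbm_covariance[OF X s t] fbm_covariance[OF Y s t] V_def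
    by (simp add: abs_minus_commute[of t s] field_simps)
  finally show ?thesis .
qed

lemma has_decay_exponent_cong:
  assumes "has_decay_exponent g \<theta>" "eventually (\<lambda>T. f T = g T) at_top"
  shows "has_decay_exponent f \<theta>"
proof -
  have "((\<lambda>T. ln (f T) / ln T) \<longlongrightarrow> - \<theta>) at_top \<longleftrightarrow> ((\<lambda>T. ln (g T) / ln T) \<longlongrightarrow> - \<theta>) at_top"
    by (rule tendsto_cong) (use assms(2) in \<open>eventually_elim, simp\<close>)
  moreover have "eventually (\<lambda>T. 0 < f T) at_top"
    using assms unfolding has_decay_exponent_def by (auto elim: eventually_elim2)
  ultimately show ?thesis using assms(1) unfolding has_decay_exponent_def by blast
qed

text \<open>The sign change in \<open>Z\<close> turns the upper barrier \<open>1\<close> into the lower barrier \<open>-1\<close>. For \<open>K = H\<close> the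
mixture has the law of a multiple of a single fractional Brownian motion, as for two Brownian motions.\<close>

theorem mixed_fbm_persistence:
  assumes X: "fractional_brownian_motion H X" and Y: "fractional_brownian_motion K Y"
    and ind: "indep_processes X Y" and KH: "K \<le> H" and a: "a \<noteq> 0"
  shows "has_decay_exponent (persistence_prob (\<lambda>t \<omega>. a * X t \<omega> + b * Y t \<omega>)) (1 - H)"
proof -
  define Z where "Z t \<omega> = (- a) * X t \<omega> + (- b) * Y t \<omega>" for t \<omega>
  define V where "V t = a\<^sup>2 * t powr (2 * H) + b\<^sup>2 * t powr (2 * K)" for t
  define G where "G = {U. \<exists>F c. finite F \<and> F \<subseteq> {0..} \<and> U = (\<lambda>\<omega>. \<Sum>t\<in>F. c t * Z t \<omega>)}"
  have HK: "0 < H" "H < 1" "0 < K"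
    using X Y by (auto simp: fractional_brownian_motion_def)
  have cont: "continuous_on {0..} (\<lambda>t. Z t \<omega>)" if "\<omega> \<in> space M" for \<omega>
    using X Y that unfolding Z_def fractional_brownian_motion_def by (intro continuous_intros) auto
  interpret P: continuous_gaussian_stationary_increments M G Z V H K "a\<^sup>2" "a\<^sup>2 + b\<^sup>2"
  proof unfold_locales
    show "gaussian_space M G"
      unfolding G_def Z_def by (rule mixed_fbm_gaussian_space[OF X Y ind])
    fix t :: real assume t: "0 \<le> t"
    show "Z t \<in> G"
      unfolding G_def using t by (intro CollectI exI[of _ "{t}"] exI[of _ "\<lambda>_. 1"]) auto
    show "a\<^sup>2 * t powr (2 * H) \<le> V t" by (simp add: V_def)
    fix s :: real assume s: "0 \<le> s"
    show "expectation (\<lambda>\<omega>. Z s \<omega> * Z t \<omega>) = (V s + V t - V \<bar>s - t\<bar>) / 2"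
      using mixed_fbm_covariance[OF X Y ind s t, of "- a" "- b"] unfolding Z_def V_def by simp
  next
    fix t :: real assume t: "1 \<le> t"
    have "t powr (2 * K) \<le> t powr (2 * H)" using t KH by (intro powr_mono) auto
    hence "b\<^sup>2 * t powr (2 * K) \<le> b\<^sup>2 * t powr (2 * H)" by (intro mult_left_mono) auto
    thus "V t \<le> (a\<^sup>2 + b\<^sup>2) * t powr (2 * H)" by (simp add: V_def distrib_right)
  next
    fix t :: real assume t: "0 \<le> t" "t \<le> 1"
    have "t powr (2 * H) \<le> t powr (2 * K)" using t KH by (intro powr_mono') auto
    hence "a\<^sup>2 * t powr (2 * H) \<le> a\<^sup>2 * t powr (2 * K)" by (intro mult_left_mono) auto
    thus "V t \<le> (a\<^sup>2 + b\<^sup>2) * t powr (2 * K)" by (simp add: V_def distrib_right)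
  next
    fix s t :: real assume "0 \<le> s" "s \<le> t"
    thus "V s \<le> V t"
      unfolding V_def using HK by (intro add_mono mult_left_mono powr_mono2) auto
  qed (use HK KH a cont in \<open>auto simp: V_def\<close>)
  have "eventually (\<lambda>T. persistence_prob (\<lambda>t \<omega>. a * X t \<omega> + b * Y t \<omega>) T = prob {\<omega> \<in> space M. \<forall>t\<in>{0..T}. -1 \<le> Z t \<omega>}) at_top"
    using eventually_ge_at_top[of 0]
  proof eventually_elim
    case (elim T)
    have "(SUP t\<in>{0..T}. a * X t \<omega> + b * Y t \<omega>) \<le> 1 \<longleftrightarrow> (\<forall>t\<in>{0..T}. -1 \<le> Z t \<omega>)" if \<omega>: "\<omega> \<in> space M" for \<omega>
    proof -
      have "continuous_on {0..T} (\<lambda>t. - Z t \<omega>)"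
        using cont[OF \<omega>] by (intro continuous_on_minus) (rule continuous_on_subset, auto)
      hence bdd: "bdd_above ((\<lambda>t. - Z t \<omega>) ` {0..T})"
        by (intro bounded_imp_bdd_above compact_imp_bounded compact_continuous_image) auto
      have "a * X t \<omega> + b * Y t \<omega> = - Z t \<omega>" for t by (simp add: Z_def)
      moreover have "(SUP t\<in>{0..T}. - Z t \<omega>) \<le> 1 \<longleftrightarrow> (\<forall>t\<in>{0..T}. - Z t \<omega> \<le> 1)"
        using elim bdd by (intro cSUP_le_iff) auto
      moreover have "- Z t \<omega> \<le> 1 \<longleftrightarrow> -1 \<le> Z t \<omega>" for t by linarith
      ultimately show ?thesis by presburger
    qed
    thus ?case unfolding persistence_prob_def by (intro arg_cong[of _ _ prob]) auto
  qed
  with P.persistence_exponent show ?thesis by (rule has_decay_exponent_cong)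
qed

end


theorem corollary2:
  fixes M :: "'a measure"
  assumes "prob_space M"
  shows "(\<forall>(H::real) (K::real) (a::real) (b::real) BH BK.
            0 < K \<and> K < H \<and> H < 1 \<and> a * b \<noteq> 0 \<and>
            prob_space.fractional_brownian_motion M H BH \<and>
            prob_space.fractional_brownian_motion M K BK \<and>
            prob_space.indep_processes M BH BK \<longrightarrow>
            has_decay_exponent
              (prob_space.persistence_prob M (\<lambda>t \<omega>. a * BH t \<omega> + b * BK t \<omega>)) (1 - H)) \<and>
         (\<forall>(H::real) (\<alpha>::real) W BH.
            0 < H \<and> H < 1 \<and> \<alpha> \<noteq> 0 \<and>
            prob_space.fractional_brownian_motion M (1/2) W \<and>
            prob_space.fractional_brownian_motion M H BH \<and>
            prob_space.indep_processes M W BH \<longrightarrow>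
            has_decay_exponent
              (prob_space.persistence_prob M (\<lambda>t \<omega>. W t \<omega> + \<alpha> * BH t \<omega>)) (1 - max (1/2) H))"
proof (intro conjI allI impI; elim conjE)
  interpret prob_space M by (rule assms)
  fix H K a b :: real and BH BK
  assume "K < H" "a * b \<noteq> 0" "fractional_brownian_motion H BH" "fractional_brownian_motion K BK"
    "indep_processes BH BK"
  thus "has_decay_exponent (persistence_prob (\<lambda>t \<omega>. a * BH t \<omega> + b * BK t \<omega>)) (1 - H)"
    by (intro mixed_fbm_persistence) auto
next
  interpret prob_space M by (rule assms)
  fix H \<alpha> :: real and W BH
  assume a: "\<alpha> \<noteq> 0" and W: "fractional_brownian_motion (1/2) W" and BH: "fractional_brownian_motion H BH"
    and ind: "indep_processes W BH"
  show "has_decay_exponent (persistence_prob (\<lambda>t \<omega>. W t \<omega> + \<alpha> * BH t \<omega>)) (1 - max (1/2) H)"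
  proof (cases "H \<le> 1/2")
    case True
    thus ?thesis using mixed_fbm_persistence[OF W BH ind True, of 1 \<alpha>] by (simp add: max_absorb1)
  next
    case False
    thus ?thesis using mixed_fbm_persistence[OF BH W indep_processes_sym[OF ind] _ a, of 1]
      by (simp add: max_absorb2 add.commute)
  qed
qed

end
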